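(* Let $\mathbb{F}_\Theta=U/K_\Theta$ be a generalized flag manifold, let $X\in\mathfrak{m}_\Theta$ and let $\gamma:[0,a]\to U/K_\Theta$ be the homogeneous curve $\gamma(t)=\exp(tX)\cdot o$. Let $\mathcal{P}\subset\Pi(\Theta)$, let $g_1=(\lambda_\sigma)_{\sigma\in\Pi(\Theta)}$ be an invariant metric and let $g_2$ be a $\mathcal{P}$-perturbation of $g_1$, with perturbation parameters $\xi_\sigma$, $\sigma\in\Pi(\Theta)\setminus\mathcal{P}$. Assume that $\gamma$ is subordinated to $\mathcal{P}$ and that $\gamma$ is a homogeneous geodesic, with geodesic vector $X$, with respect to both $g_1$ and $g_2$. Then for every differentiable map $q:[0,a]\to\mathfrak{u}$, $$I^{\gamma}_{g_2}(q)=I^{\gamma}_{g_1}(q)+4\sum_{\sigma\in\Pi(\Theta)\setminus\mathcal{P}}\ \sum_{\alpha\in\sigma}\xi_\sigma\int_0^a\big(\tilde f_\alpha^2(t)+\tilde g_\alpha^2(t)\big)\,dt,$$ where $\tilde f_\alpha,\tilde g_\alpha:[0,a]\to\mathbb{R}$ are the differentiable functions determined by $$\big(\mathrm{Ad}(\exp(-tX))\,q'(t)\big)_{\mathfrak{m}_\Theta}=\sum_{\alpha\in\Pi^+\setminus\langle\Theta\rangle}\big(\tilde f_\alpha(t)A_\alpha+\tilde g_\alpha(t)S_\alpha\big).$$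
   Context: Flag manifolds. $\mathfrak{g}$ is a complex simple Lie algebra, $G$ a Lie group with Lie algebra $\mathfrak{g}$, $\mathfrak{h}$ a Cartan subalgebra, $\Pi$ the set of roots, $\mathfrak{g}_\alpha$ the root spaces, $(\cdot,\cdot)$ the Cartan-Killing form, and $H_\alpha\in\mathfrak{h}$ is given by $\alpha(\cdot)=(H_\alpha,\cdot)$. Fix a Weyl basis: $X_\alpha\in\mathfrak{g}_\alpha$ with $(X_\alpha,X_{-\alpha})=1$ and $[X_\alpha,X_\beta]=m_{\alpha,\beta}X_{\alpha+\beta}$, $m_{\alpha,\beta}\in\mathbb{R}$, $m_{-\alpha,-\beta}=-m_{\alpha,\beta}$, $m_{\alpha,\beta}=0$ if $\alpha+\beta$ is not a root. Let $\Pi^+$ be a choice of positive roots, $\Sigma$ the simple roots, $\Theta\subset\Sigma$, $\langle\Theta\rangle$ the set of roots spanned by $\Theta$, and $\langle\Theta\rangle^-=\langle\Theta\rangle\cap(-\Pi^+)$. Put $\mathfrak{p}_\Theta=\mathfrak{h}\oplus\sum_{\alpha\in\langle\Theta\rangle^-}\mathfrak{g}_\alpha\oplus\sum_{\alpha\in\Pi^+}\mathfrak{g}_\alpha$ and let $P_\Theta$ be the normalizer of $\mathfrak{p}_\Theta$ in $G$. With $A_\alpha=X_\alpha-X_{-\alpha}$ and $S_\alpha=\sqrt{-1}(X_\alpha+X_{-\alpha})$, let $\mathfrak{u}=\mathrm{span}_{\mathbb{R}}\{\sqrt{-1}H_\alpha,A_\alpha,S_\alpha:\alpha\in\Pi\}$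 be the compact real form, $U=\exp\mathfrak{u}$, $K_\Theta=P_\Theta\cap U$. The generalized flag manifold is $\mathbb{F}_\Theta=G/P_\Theta=U/K_\Theta$, with origin $o=eK_\Theta$. Let $\mathfrak{k}_\Theta$ be the Lie algebra of $K_\Theta$ and $\mathfrak{m}_\Theta=\mathrm{span}_{\mathbb{R}}\{A_\alpha,S_\alpha:\alpha\in\Pi^+\setminus\langle\Theta\rangle\}$; then $\mathfrak{u}=\mathfrak{k}_\Theta\oplus\mathfrak{m}_\Theta$ is a reductive decomposition, $\mathfrak{m}_\Theta$ is identified with $T_o\mathbb{F}_\Theta$, and $(\cdot)_{\mathfrak{m}_\Theta}$ is the projection onto $\mathfrak{m}_\Theta$ along $\mathfrak{k}_\Theta$. Invariant metrics. The isotropy representation decomposes as $\mathfrak{m}_\Theta=\mathfrak{m}_1\oplus\dots\oplus\mathfrak{m}_r$ into irreducible components, with $\mathfrak{m}_i=\sum_{\alpha\in\sigma_i}\mathrm{span}_{\mathbb{R}}\{A_\alpha,S_\alpha\}$ for subsets $\sigma_i\subset\Pi^+\setminus\langle\Theta\rangle$; $\Pi(\Theta)=\{\sigma_1,\dots,\sigma_r\}$. A $U$-invariant metric is given by positive reals $\Lambda=(\lambda_\sigma)_{\sigma\in\Pi(\Theta)}$, namely by the scalar product $B_\Lambda(Y,Z)=-(\Lambda Y,Z)$ on $\mathfrak{m}_\Theta$, where $\Lambda$ acts on $\mathfrak{m}_i$ as $\lambda_{\sigma_i}\mathrm{Id}$. $\mathcal{P}$-perturbation. For $\mathcal{P}\subset\Pi(\Theta)$,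 an invariant metric $(\lambda^\#_\sigma)$ is a $\mathcal{P}$-perturbation of $(\lambda_\sigma)$ if $\lambda_\sigma^\#=\lambda_\sigma$ for $\sigma\in\mathcal{P}$ and $\lambda^\#_\sigma=\lambda_\sigma+\xi_\sigma>0$, $\xi_\sigma\in\mathbb{R}$, for $\sigma\in\Pi(\Theta)\setminus\mathcal{P}$. Subordinated curves. For $g\in U$ let $\phi_g:\mathbb{F}_\Theta\to\mathbb{F}_\Theta$, $\phi_g(x)=g\cdot x$. Write $\gamma'(t)=\sum_{\alpha\in\Pi^+\setminus\langle\Theta\rangle}\big(f_\alpha(t)(d\phi_{\exp tX})_o(A_\alpha)+g_\alpha(t)(d\phi_{\exp tX})_o(S_\alpha)\big)$. The curve $\gamma$ is subordinated to $\mathcal{P}$ if $f_\alpha=g_\alpha=0$ for all $\alpha\in\sigma$ with $\sigma\in\Pi(\Theta)\setminus\mathcal{P}$. Geodesic vector: $X$ is a geodesic vector for an invariant metric if $t\mapsto\exp(tX)\cdot o$ is a geodesic of that metric (then called a homogeneous geodesic). Second variation. Given differentiable (smooth) $q:[0,a]\to\mathfrak{u}$, consider the variation $f(s,t)=\exp(sq(t))\cdot\gamma(t)$ of $\gamma$ and its energy $E(s)=\int_0^a\left|\frac{\partial f}{\partial t}(s,t)\right|^2_{g}\,dt$ with respect to an invariant metric $g$. Then $I^\gamma_g(q)=E''(0)$. *)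

theory Defs
  imports
    "HOL-Analysis.Analysis"
    "HOL-Algebra.Generated_Groups"
    "HOL-Library.Disjoint_Sets"
begin

section \<open>Smooth maps and Lie groups\<close>

text \<open>The derivative is taken within \<^term>\<open>S\<close>, so that the same notion covers open subsets of a
  Euclidean space and nondegenerate real intervals, with one-sided derivatives at endpoints.
  It is only used for such sets, where the derivative is unique.\<close>

primrec Ck_on :: "nat \<Rightarrow> ('a::euclidean_space \<Rightarrow> 'b::euclidean_space) \<Rightarrow> 'a set \<Rightarrow> bool" where
  "Ck_on 0 f S \<longleftrightarrow> continuous_on S f"
| "Ck_on (Suc k) f S \<longleftrightarrow> f differentiable_on S \<and>
     (\<forall>v. Ck_on k (\<lambda>x. frechet_derivative f (at x within S) v) S)"

definition smooth_on :: "('a::euclidean_space \<Rightarrow> 'b::euclidean_space) \<Rightarrow> 'a set \<Rightarrow> bool" where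
  "smooth_on f S \<longleftrightarrow> (\<forall>k. Ck_on k f S)"

type_synonym ('a, 'e) charts = "('a set \<times> ('a \<Rightarrow> 'e)) set"

definition smooth_manifold :: "'a topology \<Rightarrow> ('a, 'e::euclidean_space) charts \<Rightarrow> bool" where
  "smooth_manifold T A \<longleftrightarrow> Hausdorff_space T \<and> second_countable T \<and>
     \<Union> (fst ` A) = topspace T \<and>
     (\<forall>(C, \<phi>) \<in> A. openin T C \<and> open (\<phi> ` C) \<and>
        homeomorphic_map (subtopology T C) (subtopology euclidean (\<phi> ` C)) \<phi>) \<and>
     (\<forall>(C, \<phi>) \<in> A. \<forall>(C', \<psi>) \<in> A. smooth_on (\<psi> \<circ> inv_into C \<phi>) (\<phi> ` (C \<inter> C')))"

definition smooth_map :: "'a topology \<Rightarrow> ('a, 'e::euclidean_space) charts \<Rightarrow>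
    'b topology \<Rightarrow> ('b, 'f::euclidean_space) charts \<Rightarrow> ('a \<Rightarrow> 'b) \<Rightarrow> bool" where
  "smooth_map T A T' A' f \<longleftrightarrow> continuous_map T T' f \<and>
     (\<forall>(C, \<phi>) \<in> A. \<forall>(C', \<psi>) \<in> A'.
        smooth_on (\<psi> \<circ> f \<circ> inv_into C \<phi>) (\<phi> ` (C \<inter> f -` C')))"

definition prod_charts :: "('a, 'e) charts \<Rightarrow> ('b, 'f) charts \<Rightarrow> ('a \<times> 'b, 'e \<times> 'f) charts" where
  "prod_charts A B = {(C \<times> C', map_prod \<phi> \<psi>) | C \<phi> C' \<psi>. (C, \<phi>) \<in> A \<and> (C', \<psi>) \<in> B}"

definition lie_group :: "'a monoid \<Rightarrow> 'a topology \<Rightarrow> ('a, 'e::euclidean_space) charts \<Rightarrow> bool" where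
  "lie_group G T A \<longleftrightarrow> Group.group G \<and> topspace T = carrier G \<and> smooth_manifold T A \<and>
     smooth_map (prod_topology T T) (prod_charts A A) T A (\<lambda>(x, y). x \<otimes>\<^bsub>G\<^esub> y) \<and>
     smooth_map T A T A (\<lambda>x. inv\<^bsub>G\<^esub> x)"

text \<open>The differential at 0 of \<^term>\<open>E\<close> identifies the Euclidean space with the tangent space at
  the unit, and \<^term>\<open>E\<close> is then the exponential map, being determined by its one-parameter
  subgroups.\<close>

definition exponential_map :: "'a monoid \<Rightarrow> 'a topology \<Rightarrow> ('a, 'e::euclidean_space) charts \<Rightarrow>
    ('e \<Rightarrow> 'a) \<Rightarrow> bool" where
  "exponential_map G T A E \<longleftrightarrow> smooth_map euclidean {(UNIV, id)} T A E \<and>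
     (\<forall>X s t. E ((s + t) *\<^sub>R X) = E (s *\<^sub>R X) \<otimes>\<^bsub>G\<^esub> E (t *\<^sub>R X)) \<and>
     (\<forall>(C, \<phi>) \<in> A. \<one>\<^bsub>G\<^esub> \<in> C \<longrightarrow> bij (frechet_derivative (\<phi> \<circ> E) (at 0)))"

definition Ad_rep :: "'a monoid \<Rightarrow> ('e::euclidean_space \<Rightarrow> 'a) \<Rightarrow> 'a \<Rightarrow> 'e \<Rightarrow> 'e" where
  "Ad_rep G E g Y = (THE Z. \<forall>t. E (t *\<^sub>R Z) = g \<otimes>\<^bsub>G\<^esub> E (t *\<^sub>R Y) \<otimes>\<^bsub>G\<^esub> inv\<^bsub>G\<^esub> g)"

text \<open>The last conjunct says that the bracket is the Lie bracket of the group, in the form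
  \<open>[X, Y] = d/dt Ad(exp tX) Y\<close> at \<open>t = 0\<close>.\<close>

definition lie_group_with_algebra :: "'a monoid \<Rightarrow> 'a topology \<Rightarrow> ('a, 'e::euclidean_space) charts \<Rightarrow>
    ('e \<Rightarrow> 'a) \<Rightarrow> ('e \<Rightarrow> 'e \<Rightarrow> 'e) \<Rightarrow> bool" where
  "lie_group_with_algebra G T A E br \<longleftrightarrow> lie_group G T A \<and> exponential_map G T A E \<and>
     (\<forall>X Y. ((\<lambda>t. Ad_rep G E (E (t *\<^sub>R X)) Y) has_vector_derivative br X Y) (at 0))"


section \<open>Complex simple Lie algebras\<close>

text \<open>A complex Lie algebra of dimension \<open>CARD('n)\<close> is a bracket on \<^typ>\<open>complex ^ 'n\<close>, i.e. a
  basis has been chosen. The real inner product of this type plays no role.\<close>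

definition complex_lie_algebra :: "(complex ^ 'n \<Rightarrow> complex ^ 'n \<Rightarrow> complex ^ 'n) \<Rightarrow> bool" where
  "complex_lie_algebra br \<longleftrightarrow>
     (\<forall>x. Vector_Spaces.linear (*s) (*s) (br x)) \<and>
     (\<forall>y. Vector_Spaces.linear (*s) (*s) (\<lambda>x. br x y)) \<and>
     (\<forall>x. br x x = 0) \<and>
     (\<forall>x y z. br x (br y z) + br y (br z x) + br z (br x y) = 0)"

definition simple_lie_algebra :: "(complex ^ 'n \<Rightarrow> complex ^ 'n \<Rightarrow> complex ^ 'n) \<Rightarrow> bool" where
  "simple_lie_algebra br \<longleftrightarrow> complex_lie_algebra br \<and> (\<exists>x y. br x y \<noteq> 0) \<and>
     (\<forall>I. vec.subspace I \<and> (\<forall>x. \<forall>y\<in>I. br x y \<in> I) \<longrightarrow> I = {0} \<or> I = UNIV)"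

definition killing :: "(complex ^ 'n \<Rightarrow> complex ^ 'n \<Rightarrow> complex ^ 'n) \<Rightarrow>
    complex ^ 'n \<Rightarrow> complex ^ 'n \<Rightarrow> complex" where
  "killing br x y = trace (matrix (\<lambda>z. br x (br y z)))"

definition abelian_subalgebra :: "(complex ^ 'n \<Rightarrow> complex ^ 'n \<Rightarrow> complex ^ 'n) \<Rightarrow>
    (complex ^ 'n) set \<Rightarrow> bool" where
  "abelian_subalgebra br h \<longleftrightarrow> vec.subspace h \<and> (\<forall>x\<in>h. \<forall>y\<in>h. br x y = 0)"

text \<open>The usual definition for semisimple algebras: a maximal abelian subalgebra all of whose
  elements act diagonalizably.\<close>

definition cartan_subalgebra :: "(complex ^ 'n \<Rightarrow> complex ^ 'n \<Rightarrow> complex ^ 'n) \<Rightarrow>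
    (complex ^ 'n) set \<Rightarrow> bool" where
  "cartan_subalgebra br h \<longleftrightarrow> abelian_subalgebra br h \<and>
     (\<forall>h'. abelian_subalgebra br h' \<and> h \<subseteq> h' \<longrightarrow> h' = h) \<and>
     (\<forall>H\<in>h. vec.span {x. \<exists>c. br H x = c *s x} = UNIV)"


section \<open>Flag manifolds\<close>

type_synonym 'n functional = "complex ^ 'n \<Rightarrow> complex"

record ('n, 'a) flag_data =
  grp :: "'a monoid"
  gtop :: "'a topology"
  gcharts :: "('a, complex ^ 'n) charts"
  gexp :: "complex ^ 'n \<Rightarrow> 'a"
  brk :: "complex ^ 'n \<Rightarrow> complex ^ 'n \<Rightarrow> complex ^ 'n"
  cartan :: "(complex ^ 'n) set"
  simples :: "'n functional set"
  Theta :: "'n functional set"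
  rootvec :: "'n functional \<Rightarrow> complex ^ 'n"
  weylm :: "'n functional \<Rightarrow> 'n functional \<Rightarrow> real"
  isotropy :: "'n functional set set"

text \<open>A linear form on the Cartan subalgebra is represented by its extension by 0 outside of it.
  Linearity of a root follows from its root space being nonzero.\<close>

definition root_space :: "('n::finite, 'a) flag_data \<Rightarrow> 'n functional \<Rightarrow> (complex ^ 'n) set" where
  "root_space D \<alpha> = {x. \<forall>H\<in>cartan D. brk D H x = \<alpha> H *s x}"

definition roots :: "('n::finite, 'a) flag_data \<Rightarrow> 'n functional set" where
  "roots D = {\<alpha>. (\<forall>x. x \<notin> cartan D \<longrightarrow> \<alpha> x = 0) \<and> \<alpha> \<noteq> (\<lambda>x. 0) \<and> root_space D \<alpha> \<noteq> {0}}"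

definition H_vec :: "('n::finite, 'a) flag_data \<Rightarrow> 'n functional \<Rightarrow> complex ^ 'n" where
  "H_vec D \<alpha> = (THE Z. Z \<in> cartan D \<and> (\<forall>H\<in>cartan D. \<alpha> H = killing (brk D) Z H))"

text \<open>A choice of positive roots is given by its simple system: the positive roots are those
  with nonnegative coefficients.\<close>

definition simple_system :: "('n::finite, 'a) flag_data \<Rightarrow> 'n functional set \<Rightarrow> bool" where
  "simple_system D B \<longleftrightarrow> B \<subseteq> roots D \<and>
     (\<forall>c :: 'n functional \<Rightarrow> real.
        (\<forall>H. (\<Sum>\<beta>\<in>B. of_real (c \<beta>) * \<beta> H) = 0) \<longrightarrow> (\<forall>\<beta>\<in>B. c \<beta> = 0)) \<and>
     (\<forall>\<alpha>\<in>roots D. \<exists>c :: 'n functional \<Rightarrow> int. (\<forall>H. \<alpha> H = (\<Sum>\<beta>\<in>B. of_int (c \<beta>) * \<beta> H)) \<and>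
        ((\<forall>\<beta>\<in>B. 0 \<le> c \<beta>) \<or> (\<forall>\<beta>\<in>B. c \<beta> \<le> 0)))"

definition pos_roots :: "('n::finite, 'a) flag_data \<Rightarrow> 'n functional set" where
  "pos_roots D = {\<alpha>\<in>roots D. \<exists>c :: 'n functional \<Rightarrow> nat.
     \<forall>H. \<alpha> H = (\<Sum>\<beta>\<in>simples D. of_nat (c \<beta>) * \<beta> H)}"

definition Theta_roots :: "('n::finite, 'a) flag_data \<Rightarrow> 'n functional set" where
  "Theta_roots D = {\<alpha>\<in>roots D. \<exists>c :: 'n functional \<Rightarrow> real.
     \<forall>H. \<alpha> H = (\<Sum>\<beta>\<in>Theta D. of_real (c \<beta>) * \<beta> H)}"

definition compl_roots :: "('n::finite, 'a) flag_data \<Rightarrow> 'n functional set" where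
  "compl_roots D = pos_roots D - Theta_roots D"

text \<open>For \<open>\<beta> = - \<alpha>\<close> the bracket is \<^term>\<open>H_vec D \<alpha>\<close>, which is a consequence of the normalization.\<close>

definition weyl_basis :: "('n::finite, 'a) flag_data \<Rightarrow> bool" where
  "weyl_basis D \<longleftrightarrow>
     (\<forall>\<alpha>\<in>roots D. rootvec D \<alpha> \<in> root_space D \<alpha> \<and>
        killing (brk D) (rootvec D \<alpha>) (rootvec D (- \<alpha>)) = 1) \<and>
     (\<forall>\<alpha>\<in>roots D. \<forall>\<beta>\<in>roots D. \<beta> \<noteq> - \<alpha> \<longrightarrow>
        brk D (rootvec D \<alpha>) (rootvec D \<beta>) =
          complex_of_real (weylm D \<alpha> \<beta>) *s rootvec D (\<lambda>H. \<alpha> H + \<beta> H)) \<and>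
     (\<forall>\<alpha>\<in>roots D. \<forall>\<beta>\<in>roots D. weylm D (- \<alpha>) (- \<beta>) = - weylm D \<alpha> \<beta>) \<and>
     (\<forall>\<alpha>\<in>roots D. \<forall>\<beta>\<in>roots D. (\<lambda>H. \<alpha> H + \<beta> H) \<notin> roots D \<longrightarrow> weylm D \<alpha> \<beta> = 0)"

definition A_vec :: "('n::finite, 'a) flag_data \<Rightarrow> 'n functional \<Rightarrow> complex ^ 'n" where
  "A_vec D \<alpha> = rootvec D \<alpha> - rootvec D (- \<alpha>)"

definition S_vec :: "('n::finite, 'a) flag_data \<Rightarrow> 'n functional \<Rightarrow> complex ^ 'n" where
  "S_vec D \<alpha> = \<i> *s (rootvec D \<alpha> + rootvec D (- \<alpha>))"

definition u_alg :: "('n::finite, 'a) flag_data \<Rightarrow> (complex ^ 'n) set" where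
  "u_alg D = span ((\<lambda>\<alpha>. \<i> *s H_vec D \<alpha>) ` roots D \<union> A_vec D ` roots D \<union> S_vec D ` roots D)"

definition m_of :: "('n::finite, 'a) flag_data \<Rightarrow> 'n functional set \<Rightarrow> (complex ^ 'n) set" where
  "m_of D \<sigma> = span (A_vec D ` \<sigma> \<union> S_vec D ` \<sigma>)"

definition m_Theta :: "('n::finite, 'a) flag_data \<Rightarrow> (complex ^ 'n) set" where
  "m_Theta D = m_of D (compl_roots D)"

definition p_Theta :: "('n::finite, 'a) flag_data \<Rightarrow> (complex ^ 'n) set" where
  "p_Theta D = vec.span (cartan D \<union>
     (\<Union>\<alpha>\<in>{\<alpha>\<in>Theta_roots D. - \<alpha> \<in> pos_roots D}. root_space D \<alpha>) \<union>
     (\<Union>\<alpha>\<in>pos_roots D. root_space D \<alpha>))"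

abbreviation Ad :: "('n::finite, 'a) flag_data \<Rightarrow> 'a \<Rightarrow> complex ^ 'n \<Rightarrow> complex ^ 'n" where
  "Ad D \<equiv> Ad_rep (grp D) (gexp D)"

definition P_grp :: "('n::finite, 'a) flag_data \<Rightarrow> 'a set" where
  "P_grp D = {g \<in> carrier (grp D). Ad D g ` p_Theta D = p_Theta D}"

text \<open>The connected subgroup with Lie algebra \<^term>\<open>u_alg D\<close>. It is compact, so it is also the
  image of \<^term>\<open>u_alg D\<close> under the exponential map.\<close>

definition U_grp :: "('n::finite, 'a) flag_data \<Rightarrow> 'a set" where
  "U_grp D = generate (grp D) (gexp D ` u_alg D)"

definition K_grp :: "('n::finite, 'a) flag_data \<Rightarrow> 'a set" where
  "K_grp D = P_grp D \<inter> U_grp D"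

definition k_Theta :: "('n::finite, 'a) flag_data \<Rightarrow> (complex ^ 'n) set" where
  "k_Theta D = {Y. \<forall>t. gexp D (t *\<^sub>R Y) \<in> K_grp D}"

definition proj_m :: "('n::finite, 'a) flag_data \<Rightarrow> complex ^ 'n \<Rightarrow> complex ^ 'n" where
  "proj_m D Y = (THE Z. Z \<in> m_Theta D \<and> Y - Z \<in> k_Theta D)"

definition isotropy_decomposition :: "('n::finite, 'a) flag_data \<Rightarrow> bool" where
  "isotropy_decomposition D \<longleftrightarrow> partition_on (compl_roots D) (isotropy D) \<and>
     (\<forall>\<sigma>\<in>isotropy D.
        (\<forall>k\<in>K_grp D. Ad D k ` m_of D \<sigma> \<subseteq> m_of D \<sigma>) \<and> m_of D \<sigma> \<noteq> {0} \<and>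
        (\<forall>W. subspace W \<and> W \<subseteq> m_of D \<sigma> \<and> (\<forall>k\<in>K_grp D. Ad D k ` W \<subseteq> W) \<longrightarrow>
           W = {0} \<or> W = m_of D \<sigma>))"

definition generalized_flag_manifold :: "('n::finite, 'a) flag_data \<Rightarrow> bool" where
  "generalized_flag_manifold D \<longleftrightarrow>
     simple_lie_algebra (brk D) \<and>
     lie_group_with_algebra (grp D) (gtop D) (gcharts D) (gexp D) (brk D) \<and>
     cartan_subalgebra (brk D) (cartan D) \<and>
     simple_system D (simples D) \<and> Theta D \<subseteq> simples D \<and>
     weyl_basis D \<and> isotropy_decomposition D"


section \<open>Tangent vectors and invariant metrics\<close>

text \<open>Points are the left cosets \<open>gK\<close> with \<open>g\<close> in \<^term>\<open>U_grp D\<close>; the action is left translation of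
  cosets, and the origin is the coset of the unit.\<close>

abbreviation act :: "('n::finite, 'a) flag_data \<Rightarrow> 'a \<Rightarrow> 'a set \<Rightarrow> 'a set" where
  "act D g x \<equiv> g <#\<^bsub>grp D\<^esub> x"

definition origin :: "('n::finite, 'a) flag_data \<Rightarrow> 'a set" where
  "origin D = act D \<one>\<^bsub>grp D\<^esub> (K_grp D)"

text \<open>A function on the quotient is smooth iff its pullback to the group \<^term>\<open>U_grp D\<close> is, and
  \<open>Y \<mapsto> g exp Y\<close>, for \<open>Y\<close> in \<^term>\<open>u_alg D\<close> near 0, are local parametrizations of that group.
  Smoothness on the real subspace \<^term>\<open>u_alg D\<close>, which is not a type, is expressed by composing
  with linear maps into it.\<close>

definition smooth_funs :: "('n::finite, 'a) flag_data \<Rightarrow> ('a set \<Rightarrow> real) set" where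
  "smooth_funs D = {h. \<forall>g\<in>U_grp D. \<forall>L. linear L \<and> range L \<subseteq> u_alg D \<longrightarrow>
     smooth_on (\<lambda>Y::complex ^ 'n. h (act D g (act D (gexp D (L Y)) (origin D)))) UNIV}"

text \<open>Tangent vectors are derivations of the algebra of smooth functions, set to 0 on functions
  that are not smooth.\<close>

type_synonym 'a tangent = "('a set \<Rightarrow> real) \<Rightarrow> real"

definition velocity :: "('n::finite, 'a) flag_data \<Rightarrow> real set \<Rightarrow> (real \<Rightarrow> 'a set) \<Rightarrow> real \<Rightarrow> 'a tangent"
  where "velocity D I c t = (\<lambda>h. if h \<in> smooth_funs D
     then vector_derivative (\<lambda>\<tau>. h (c \<tau>)) (at t within I) else 0)"

text \<open>On \<^term>\<open>m_Theta D\<close>, the identification of this space with the tangent space at the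
  origin.\<close>

definition tangent_o :: "('n::finite, 'a) flag_data \<Rightarrow> complex ^ 'n \<Rightarrow> 'a tangent" where
  "tangent_o D Y = velocity D UNIV (\<lambda>t. act D (gexp D (t *\<^sub>R Y)) (origin D)) 0"

definition dphi :: "('n::finite, 'a) flag_data \<Rightarrow> 'a \<Rightarrow> 'a tangent \<Rightarrow> 'a tangent" where
  "dphi D g v = (\<lambda>h. if h \<in> smooth_funs D then v (\<lambda>x. h (act D g x)) else 0)"

text \<open>The operator is only determined on \<^term>\<open>m_Theta D\<close>, and only used there.\<close>

definition Lambda_op :: "('n::finite, 'a) flag_data \<Rightarrow> ('n functional set \<Rightarrow> real) \<Rightarrow>
    complex ^ 'n \<Rightarrow> complex ^ 'n" where
  "Lambda_op D lam = (SOME L. linear L \<and> (\<forall>\<sigma>\<in>isotropy D. \<forall>Y\<in>m_of D \<sigma>. L Y = lam \<sigma> *\<^sub>R Y))"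

definition B_form :: "('n::finite, 'a) flag_data \<Rightarrow> ('n functional set \<Rightarrow> real) \<Rightarrow>
    complex ^ 'n \<Rightarrow> complex ^ 'n \<Rightarrow> real" where
  "B_form D lam Y Z = - Re (killing (brk D) (Lambda_op D lam Y) Z)"

definition invariant_metric :: "('n::finite, 'a) flag_data \<Rightarrow> ('n functional set \<Rightarrow> real) \<Rightarrow> bool" where
  "invariant_metric D lam \<longleftrightarrow> (\<forall>\<sigma>\<in>isotropy D. 0 < lam \<sigma>)"

text \<open>The \<^term>\<open>U_grp D\<close>-invariant extension of \<^term>\<open>B_form D lam\<close> to the tangent vectors at
  any point; it does not depend on the representative \<open>g\<close> since \<^term>\<open>B_form D lam\<close> is
  \<open>Ad(K)\<close>-invariant.\<close>

definition metric :: "('n::finite, 'a) flag_data \<Rightarrow> ('n functional set \<Rightarrow> real) \<Rightarrow>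
    'a set \<Rightarrow> 'a tangent \<Rightarrow> 'a tangent \<Rightarrow> real" where
  "metric D lam p v w = (THE r. \<exists>g\<in>U_grp D. \<exists>Y\<in>m_Theta D. \<exists>Z\<in>m_Theta D.
     p = act D g (origin D) \<and> v = dphi D g (tangent_o D Y) \<and> w = dphi D g (tangent_o D Z) \<and>
     r = B_form D lam Y Z)"

definition perturbation :: "('n::finite, 'a) flag_data \<Rightarrow> 'n functional set set \<Rightarrow>
    ('n functional set \<Rightarrow> real) \<Rightarrow> ('n functional set \<Rightarrow> real) \<Rightarrow> ('n functional set \<Rightarrow> real) \<Rightarrow> bool"
  where "perturbation D P lam lam' \<xi> \<longleftrightarrow> invariant_metric D lam' \<and>
     (\<forall>\<sigma>\<in>P. lam' \<sigma> = lam \<sigma>) \<and> (\<forall>\<sigma>\<in>isotropy D - P. lam' \<sigma> = lam \<sigma> + \<xi> \<sigma>)"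


section \<open>Geodesics\<close>

text \<open>For \<open>Y\<close> in \<^term>\<open>m_Theta D\<close> near 0 this is a local parametrization of the flag manifold around
  the point \<open>gK\<close>.\<close>

definition param :: "('n::finite, 'a) flag_data \<Rightarrow> 'a \<Rightarrow> complex ^ 'n \<Rightarrow> 'a set" where
  "param D g Y = act D g (act D (gexp D Y) (origin D))"

definition metric_coeff :: "('n::finite, 'a) flag_data \<Rightarrow> ('n functional set \<Rightarrow> real) \<Rightarrow> 'a \<Rightarrow>
    complex ^ 'n \<Rightarrow> complex ^ 'n \<Rightarrow> complex ^ 'n \<Rightarrow> real" where
  "metric_coeff D lam g Y v w = metric D lam (param D g Y)
     (velocity D UNIV (\<lambda>\<tau>. param D g (Y + \<tau> *\<^sub>R v)) 0)
     (velocity D UNIV (\<lambda>\<tau>. param D g (Y + \<tau> *\<^sub>R w)) 0)"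

text \<open>The equation \<open>\<nabla>\<^bsub>c'\<^esub> c' = 0\<close> for the Levi-Civita connection, with lowered index, i.e. written
  with Christoffel symbols of the first kind, which satisfy
  \<open>\<Gamma>(v, v; w) = \<partial>\<^sub>v G(v, w) - \<partial>\<^sub>w G(v, v) / 2\<close>. At each time \<open>t\<^sub>0\<close> it is written in the coordinates
  \<open>x\<close> of \<^term>\<open>param D g\<close> centred at the point \<open>c(t\<^sub>0)\<close>.\<close>

definition geodesic :: "('n::finite, 'a) flag_data \<Rightarrow> ('n functional set \<Rightarrow> real) \<Rightarrow>
    (real \<Rightarrow> 'a set) \<Rightarrow> bool" where
  "geodesic D lam c \<longleftrightarrow> (\<forall>t\<^sub>0. \<exists>g\<in>U_grp D. c t\<^sub>0 = act D g (origin D)) \<and>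
     (\<forall>t\<^sub>0. \<forall>g\<in>U_grp D. c t\<^sub>0 = act D g (origin D) \<longrightarrow>
       (\<exists>x \<delta>. 0 < \<delta> \<and> x t\<^sub>0 = 0 \<and> smooth_on x {t\<^sub>0 - \<delta><..<t\<^sub>0 + \<delta>} \<and>
          (\<forall>t\<in>{t\<^sub>0 - \<delta><..<t\<^sub>0 + \<delta>}. x t \<in> m_Theta D \<and> c t = param D g (x t)) \<and>
          (let x' = (\<lambda>t. vector_derivative x (at t)); v = x' t\<^sub>0;
               acc = vector_derivative x' (at t\<^sub>0); G = metric_coeff D lam g
           in \<forall>w\<in>m_Theta D. G 0 acc w + deriv (\<lambda>\<epsilon>. G (\<epsilon> *\<^sub>R v) v w) 0
                - deriv (\<lambda>\<epsilon>. G (\<epsilon> *\<^sub>R w) v v) 0 / 2 = 0)))"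

definition hom_curve :: "('n::finite, 'a) flag_data \<Rightarrow> complex ^ 'n \<Rightarrow> real \<Rightarrow> 'a set" where
  "hom_curve D X t = act D (gexp D (t *\<^sub>R X)) (origin D)"

definition geodesic_vector :: "('n::finite, 'a) flag_data \<Rightarrow> ('n functional set \<Rightarrow> real) \<Rightarrow>
    complex ^ 'n \<Rightarrow> bool" where
  "geodesic_vector D lam X \<longleftrightarrow> geodesic D lam (hom_curve D X)"

definition subordinated :: "('n::finite, 'a) flag_data \<Rightarrow> 'n functional set set \<Rightarrow>
    complex ^ 'n \<Rightarrow> real \<Rightarrow> bool" where
  "subordinated D P X a \<longleftrightarrow> (\<exists>f g :: 'n functional \<Rightarrow> real \<Rightarrow> real.
     (\<forall>t\<in>{0..a}. velocity D {0..a} (hom_curve D X) t =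
        (\<lambda>h. \<Sum>\<alpha>\<in>compl_roots D.
           f \<alpha> t * dphi D (gexp D (t *\<^sub>R X)) (tangent_o D (A_vec D \<alpha>)) h +
           g \<alpha> t * dphi D (gexp D (t *\<^sub>R X)) (tangent_o D (S_vec D \<alpha>)) h)) \<and>
     (\<forall>\<sigma>\<in>isotropy D - P. \<forall>\<alpha>\<in>\<sigma>. \<forall>t\<in>{0..a}. f \<alpha> t = 0 \<and> g \<alpha> t = 0))"


section \<open>Second variation of the energy\<close>

definition variation :: "('n::finite, 'a) flag_data \<Rightarrow> complex ^ 'n \<Rightarrow> (real \<Rightarrow> complex ^ 'n) \<Rightarrow>
    real \<Rightarrow> real \<Rightarrow> 'a set" where
  "variation D X q s t = act D (gexp D (s *\<^sub>R q t)) (hom_curve D X t)"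

definition energy :: "('n::finite, 'a) flag_data \<Rightarrow> ('n functional set \<Rightarrow> real) \<Rightarrow>
    real \<Rightarrow> (real \<Rightarrow> 'a set) \<Rightarrow> real" where
  "energy D lam a c = integral {0..a}
     (\<lambda>t. metric D lam (c t) (velocity D {0..a} c t) (velocity D {0..a} c t))"

definition second_variation :: "('n::finite, 'a) flag_data \<Rightarrow> ('n functional set \<Rightarrow> real) \<Rightarrow>
    real \<Rightarrow> complex ^ 'n \<Rightarrow> (real \<Rightarrow> complex ^ 'n) \<Rightarrow> real" where
  "second_variation D lam a X q = deriv (deriv (\<lambda>s. energy D lam a (variation D X q s))) 0"

definition component_functions :: "('n::finite, 'a) flag_data \<Rightarrow> real \<Rightarrow> complex ^ 'n \<Rightarrow>
    (real \<Rightarrow> complex ^ 'n) \<Rightarrow> ('n functional \<Rightarrow> real \<Rightarrow> real) \<Rightarrow> ('n functional \<Rightarrow> real \<Rightarrow> real) \<Rightarrow> bool"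
  where "component_functions D a X q f g \<longleftrightarrow> (\<forall>t\<in>{0..a}.
     proj_m D (Ad D (gexp D (- t *\<^sub>R X)) (vector_derivative q (at t within {0..a}))) =
     (\<Sum>\<alpha>\<in>compl_roots D. f \<alpha> t *\<^sub>R A_vec D \<alpha> + g \<alpha> t *\<^sub>R S_vec D \<alpha>))"

end

theory Submission
  imports Defs
begin

text \<open>The point \<open>f(s,t) = exp(s q(t)) exp(tX) o\<close> is \<open>h o\<close> with \<open>h = exp(s q(t)) exp(tX)\<close>, so the velocity
\<open>\<partial>\<^sub>t f\<close> is the image under \<open>d\<phi>\<^sub>h\<close> of the part in \<open>\<m>\<close> of the left logarithmic derivative of \<open>h\<close>,
  \<open>W(s,t) = X + Ad(exp(-tX)) w(s,t)\<close>,  with \<open>w(s,t)\<close> the integral of \<open>Ad(exp(-r q(t))) q'(t)\<close> over \<open>0 \<le> r \<le> s\<close>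
(\<open>velocity_variation\<close>). An invariant metric is read off at the origin, where \<open>B_form\<close> is diagonal in the
vectors \<open>A\<^sub>\<alpha>\<close>, \<open>S\<^sub>\<alpha>\<close> with \<open>(A\<^sub>\<alpha>,A\<^sub>\<alpha>) = (S\<^sub>\<alpha>,S\<^sub>\<alpha>) = -2\<close>. Hence the energy is the sum over \<open>\<sigma>\<close> and
\<open>\<alpha> \<in> \<sigma>\<close> of \<open>2 \<lambda>\<^sub>\<sigma>\<close> times the integral of the squared \<open>A\<^sub>\<alpha>\<close>- and \<open>S\<^sub>\<alpha>\<close>-coordinates of \<open>W\<close>
(\<open>energy_variation\<close>). Here only the factor \<open>\<lambda>\<^sub>\<sigma>\<close> depends on the metric.

Differentiating twice at \<open>s = 0\<close>, where \<open>W = X\<close> and \<open>\<partial>\<^sub>s W = Ad(exp(-tX)) q'(t)\<close>, each summand becomes the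
integral of twice (square of the coordinate of \<open>\<partial>\<^sub>s W\<close>) + (coordinate of \<open>X\<close>)(coordinate of \<open>\<partial>\<^sub>s\<^sup>2 W\<close>)
(\<open>second_variation_formula\<close>). The coordinates of \<open>\<partial>\<^sub>s W\<close> are the functions \<open>f~\<^sub>\<alpha>\<close>, \<open>g~\<^sub>\<alpha>\<close> of the theorem
(\<open>component_functions_iff\<close>). Passing from \<open>\<lambda>\<close> to its perturbation changes only the summands with \<open>\<sigma> \<notin> \<P>\<close>,
and there the second term vanishes, because subordination says that \<open>X\<close> has no coordinates outside \<open>\<P>\<close>
(\<open>subordinated_coordinates\<close>). What remains is \<open>\<xi>\<^sub>\<sigma>\<close> times \<open>2 \<cdot> 2\<close> times the integral of the two squares.

Most of the work makes the objects of this argument behave as they should, starting from the axioms of a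
simple Lie algebra with a Weyl basis and of a Lie group with an exponential map:

  \<^item> The root values \<open>\<beta>(H\<^sub>\<alpha>)\<close> are real (\<open>real_root_value\<close>), so that \<open>\<u>\<close> is closed under the bracket, and \<open>\<u>\<close>
    splits into \<open>\<m>\<close> and the Levi part, which lies in the Lie algebra of \<open>K\<close>.

  \<^item> \<open>Ad(g)\<close> exists, and \<open>Ad(exp X)\<close> is the exponential series of \<open>ad X\<close> (\<open>Ad_E\<close>).

  \<^item> Tangent vectors, which are derivations of the smooth functions, are separated by matrix coefficients
    of the conjugates of the projection to the complexification of \<open>\<m>\<close> (\<open>TV_injective\<close>). The projection
    commutes with \<open>Ad(K)\<close>, which makes these functions well defined on the flag manifold, and only
    \<open>0 \<in> \<m>\<close> commutes with it, which makes them separate. Hence the metric is well defined (\<open>metric_eq\<close>).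

  \<^item> The curve \<open>h\<close> has to be compared with a curve \<open>h(t\<^sub>0) exp Z(t)\<close> with \<open>Z\<close> in \<open>\<u>\<close>. A logarithm exists near
    the unit of the group, it lies in \<open>\<u>\<close> because \<open>\<u>\<close> is the fixed space of a conjugation (\<open>log_in_u\<close>), and
    it is differentiable because \<open>ad\<close> is injective (\<open>logarithmic_curve\<close>).\<close>

section \<open>Calculus of smooth maps\<close>

text \<open>A condition that makes derivatives within the set unique and holds for open sets and for nondegenerate
intervals alike, the two kinds of domain on which smoothness is considered.\<close>

definition accessible :: "'a::euclidean_space set \<Rightarrow> bool" where
  "accessible S \<longleftrightarrow> (\<forall>x\<in>S. \<forall>i\<in>Basis. \<forall>e>0. \<exists>d. 0 < \<bar>d\<bar> \<and> \<bar>d\<bar> < e \<and> x + d *\<^sub>R i \<in> S)"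

lemma accessible_open:
  assumes "open S" shows "accessible S"
  unfolding accessible_def
proof (intro ballI allI impI)
  fix x i :: 'a and e :: real
  assume x: "x \<in> S" and i: "i \<in> Basis" and e: "0 < e"
  obtain r where r: "r > 0" "ball x r \<subseteq> S" using assms x open_contains_ball by blast
  show "\<exists>d. 0 < \<bar>d\<bar> \<and> \<bar>d\<bar> < e \<and> x + d *\<^sub>R i \<in> S"
  proof (intro exI conjI)
    show "0 < \<bar>min e r / 2\<bar>" "\<bar>min e r / 2\<bar> < e" using r e by auto
    have "x + (min e r / 2) *\<^sub>R i \<in> ball x r" using r e i by (auto simp: dist_norm)
    then show "x + (min e r / 2) *\<^sub>R i \<in> S" using r by blast
  qed
qed

lemma accessible_interval:
  assumes "a < b" shows "accessible {a..b::real}"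
  unfolding accessible_def
proof (intro ballI allI impI)
  fix x i e :: real
  assume x: "x \<in> {a..b}" and i: "i \<in> Basis" and e: "0 < e"
  show "\<exists>d. 0 < \<bar>d\<bar> \<and> \<bar>d\<bar> < e \<and> x + d *\<^sub>R i \<in> {a..b}"
  proof (cases "x < b")
    case True
    with i x e show ?thesis by (intro exI[of _ "min e (b - x) / 2"]) (auto simp: min_def field_simps)
  next
    case False
    with i x e assms show ?thesis by (intro exI[of _ "- (min e (b - a) / 2)"]) (auto simp: min_def field_simps)
  qed
qed

lemma accessible_UNIV [simp]: "accessible UNIV"
  by (simp add: accessible_open)

lemma frechet_derivative_within_eq:
  assumes "accessible S" "x \<in> S" "(f has_derivative f') (at x within S)"
  shows "frechet_derivative f (at x within S) = f'"
proof -
  have "(f has_derivative frechet_derivative f (at x within S)) (at x within S)"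
    using assms(3) frechet_derivative_works differentiable_def by blast
  from frechet_derivative_unique_within[OF this assms(3)] show ?thesis
    using assms unfolding accessible_def by blast
qed

lemma frechet_derivative_within_cong:
  assumes "x \<in> S" "\<And>y. y \<in> S \<Longrightarrow> f y = g y"
  shows "frechet_derivative f (at x within S) = frechet_derivative g (at x within S)"
proof -
  have "(f has_derivative D) (at x within S) \<longleftrightarrow> (g has_derivative D) (at x within S)" for D
    using assms has_derivative_transform[of x S g f D] has_derivative_transform[of x S f g D] by metis
  then show ?thesis by (simp add: frechet_derivative_def)
qed

lemma Ck_on_cong:
  assumes "\<And>x. x \<in> S \<Longrightarrow> f x = g x"
  shows "Ck_on k f S \<longleftrightarrow> Ck_on k g S"
  using assms
proof (induction k arbitrary: f g)
  case 0
  then show ?case by (simp cong: continuous_on_cong)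
next
  case (Suc k)
  have "f differentiable_on S \<longleftrightarrow> g differentiable_on S"
    using Suc.prems by (metis differentiable_on_def differentiable_transform_within zero_less_one)
  moreover have "Ck_on k (\<lambda>x. frechet_derivative f (at x within S) v) S \<longleftrightarrow>
      Ck_on k (\<lambda>x. frechet_derivative g (at x within S) v) S" for v
    by (rule Suc.IH) (metis frechet_derivative_within_cong Suc.prems)
  ultimately show ?case by simp
qed

lemma Ck_on_SucI:
  assumes "accessible S" "\<And>x. x \<in> S \<Longrightarrow> (f has_derivative f' x) (at x within S)"
    and "\<And>v. Ck_on k (\<lambda>x. f' x v) S"
  shows "Ck_on (Suc k) f S"
proof -
  have "Ck_on k (\<lambda>x. frechet_derivative f (at x within S) v) S" for v
    using Ck_on_cong[of S "\<lambda>x. frechet_derivative f (at x within S) v" "\<lambda>x. f' x v"]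
      frechet_derivative_within_eq[OF assms(1)] assms(2,3) by metis
  then show ?thesis
    using assms(2) by (auto simp: differentiable_on_def differentiable_def)
qed

lemma Ck_on_SucD:
  assumes "Ck_on (Suc k) f S" "x \<in> S"
  shows "(f has_derivative frechet_derivative f (at x within S)) (at x within S)"
  using assms by (simp add: differentiable_on_def frechet_derivative_works)

lemma Ck_on_continuous: "Ck_on k f S \<Longrightarrow> continuous_on S f"
  by (cases k) (auto intro: differentiable_imp_continuous_on)

lemma Ck_on_Suc_mono: "Ck_on (Suc k) f S \<Longrightarrow> Ck_on k f S"
proof (induction k arbitrary: f)
  case 0
  then show ?case by (auto intro: differentiable_imp_continuous_on)
next
  case (Suc k)
  then show ?case by (metis Ck_on.simps(2))
qed

lemma Ck_on_const: "accessible S \<Longrightarrow> Ck_on k (\<lambda>x. c) S"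
proof (induction k arbitrary: c)
  case (Suc k)
  then show ?case by (intro Ck_on_SucI[where f'="\<lambda>x v. 0"]) auto
qed auto

lemma Ck_on_add:
  assumes S: "accessible S"
  shows "Ck_on k f S \<Longrightarrow> Ck_on k g S \<Longrightarrow> Ck_on k (\<lambda>x. f x + g x) S"
proof (induction k arbitrary: f g)
  case (Suc k)
  show ?case
  proof (rule Ck_on_SucI[OF S])
    fix x assume "x \<in> S"
    then show "((\<lambda>x. f x + g x) has_derivative (\<lambda>v. frechet_derivative f (at x within S) v
          + frechet_derivative g (at x within S) v)) (at x within S)"
      by (intro has_derivative_add Ck_on_SucD[OF Suc.prems(1)] Ck_on_SucD[OF Suc.prems(2)])
  next
    fix v
    show "Ck_on k (\<lambda>x. frechet_derivative f (at x within S) v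
          + frechet_derivative g (at x within S) v) S"
      using Suc.prems by (intro Suc.IH) auto
  qed
qed (auto intro: continuous_intros)

lemma Ck_on_sum:
  "accessible S \<Longrightarrow> (\<And>i. i \<in> I \<Longrightarrow> Ck_on k (f i) S) \<Longrightarrow> Ck_on k (\<lambda>x. \<Sum>i\<in>I. f i x) S"
  by (induction I rule: infinite_finite_induct) (auto intro: Ck_on_const Ck_on_add)

lemma Ck_on_linear:
  assumes L: "bounded_linear L" and S: "accessible S"
  shows "Ck_on k f S \<Longrightarrow> Ck_on k (\<lambda>x. L (f x)) S"
proof (induction k arbitrary: f)
  case 0
  then show ?case using bounded_linear.continuous_on[OF L] by simp
next
  case (Suc k)
  show ?case
  proof (rule Ck_on_SucI[OF S])
    fix x assume "x \<in> S"
    then show "((\<lambda>x. L (f x)) has_derivative (\<lambda>v. L (frechet_derivative f (at x within S) v))) (at x within S)"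
      by (intro bounded_linear.has_derivative[OF L] Ck_on_SucD[OF Suc.prems])
  next
    fix v
    show "Ck_on k (\<lambda>x. L (frechet_derivative f (at x within S) v)) S"
      using Suc.prems by (intro Suc.IH) auto
  qed
qed

lemma Ck_on_bilinear:
  assumes h: "bounded_bilinear h"
  shows "accessible S \<Longrightarrow> Ck_on k f S \<Longrightarrow> Ck_on k g S \<Longrightarrow> Ck_on k (\<lambda>x. h (f x) (g x)) S"
proof (induction k arbitrary: f g)
  case 0
  then show ?case by (auto intro: bounded_bilinear.continuous_on[OF h])
next
  case (Suc k)
  show ?case
  proof (rule Ck_on_SucI[where f'="\<lambda>x v. h (f x) (frechet_derivative g (at x within S) v)
          + h (frechet_derivative f (at x within S) v) (g x)"])
    fix x assume "x \<in> S"
    then show "((\<lambda>x. h (f x) (g x)) has_derivative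
         (\<lambda>v. h (f x) (frechet_derivative g (at x within S) v) +
              h (frechet_derivative f (at x within S) v) (g x))) (at x within S)"
      by (intro bounded_bilinear.FDERIV[OF h] Ck_on_SucD[OF Suc.prems(2)] Ck_on_SucD[OF Suc.prems(3)])
  next
    fix v
    show "Ck_on k (\<lambda>x. h (f x) (frechet_derivative g (at x within S) v) +
              h (frechet_derivative f (at x within S) v) (g x)) S"
      using Suc by (intro Ck_on_add Suc.IH) (auto intro: Ck_on_Suc_mono)
  qed (use Suc in auto)
qed

lemma Ck_on_compose_linear:
  assumes "linear L" "accessible S" "accessible T" "L ` T \<subseteq> S"
  shows "Ck_on k f S \<Longrightarrow> Ck_on k (\<lambda>x. f (L x)) T"
proof (induction k arbitrary: f)
  case 0
  have "continuous_on T L" using assms(1) by (simp add: linear_continuous_on linear_linear)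
  then show ?case using 0 assms(4) by (auto intro: continuous_on_compose2)
next
  case (Suc k)
  have L: "bounded_linear L" using assms(1) by (rule linear_linear[THEN iffD2])
  show ?case
  proof (rule Ck_on_SucI[where f'="\<lambda>x v. frechet_derivative f (at (L x) within S) (L v)"])
    fix x assume x: "x \<in> T"
    have f: "(f has_derivative frechet_derivative f (at y within S)) (at y within S)" if "y \<in> S" for y
      using Ck_on_SucD[OF Suc.prems that] .
    show "((\<lambda>x. f (L x)) has_derivative (\<lambda>v. frechet_derivative f (at (L x) within S) (L v))) (at x within T)"
      using f assms(4) x bounded_linear_imp_has_derivative[OF L]
      by (intro has_derivative_in_compose2[of S f "\<lambda>y. frechet_derivative f (at y within S)" L T x L]) auto
  next
    fix v
    show "Ck_on k (\<lambda>x. frechet_derivative f (at (L x) within S) (L v)) T"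
      using Suc.IH[of "\<lambda>y. frechet_derivative f (at y within S) (L v)"] Suc.prems by simp
  qed (use assms in auto)
qed

lemma smooth_on_vector_derivative:
  fixes q :: "real \<Rightarrow> 'b::euclidean_space"
  assumes "smooth_on q S" "accessible S"
  shows "smooth_on (\<lambda>t. vector_derivative q (at t within S)) S"
    and "\<And>t. t \<in> S \<Longrightarrow> (q has_vector_derivative vector_derivative q (at t within S)) (at t within S)"
proof -
  have 1: "vector_derivative q (at t within S) = frechet_derivative q (at t within S) 1 \<and>
     (q has_vector_derivative vector_derivative q (at t within S)) (at t within S)" if "t \<in> S" for t
  proof -
    have "(q has_derivative frechet_derivative q (at t within S)) (at t within S)"
      using assms(1) that Ck_on_SucD unfolding smooth_on_def by blast
    moreover then have "frechet_derivative q (at t within S) = (\<lambda>x. x *\<^sub>R frechet_derivative q (at t within S) 1)"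
      by (metis bounded_linear.linear has_derivative_bounded_linear linear_cmul mult.right_neutral real_scaleR_def)
    ultimately have "(q has_vector_derivative frechet_derivative q (at t within S) 1) (at t within S)"
      unfolding has_vector_derivative_def by simp
    moreover then have "vector_derivative q (at t within S) = frechet_derivative q (at t within S) 1"
    proof -
      have "q differentiable (at t within S)"
        using \<open>(q has_derivative _) _\<close> differentiableI by blast
      then have "(q has_vector_derivative vector_derivative q (at t within S)) (at t within S)"
        using vector_derivative_works by blast
      then show ?thesis
        using frechet_derivative_within_eq[OF assms(2) that]
          \<open>(q has_vector_derivative frechet_derivative q (at t within S) 1) (at t within S)\<close>
        unfolding has_vector_derivative_def by (metis scaleR_one)
    qed
    ultimately show ?thesis by simp
  qed
  then show "\<And>t. t \<in> S \<Longrightarrow> (q has_vector_derivative vector_derivative q (at t within S)) (at t within S)" by blast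
  have "Ck_on k (\<lambda>t. frechet_derivative q (at t within S) 1) S" for k
    using assms(1) Ck_on.simps(2)[of k q S] unfolding smooth_on_def by blast
  then show "smooth_on (\<lambda>t. vector_derivative q (at t within S)) S"
    unfolding smooth_on_def using 1 Ck_on_cong[of S "\<lambda>t. vector_derivative q (at t within S)"] by metis
qed

text \<open>The differential depends continuously on the point, in operator norm because the space has finite
dimension, and an injective differential has a left inverse. So near the point the map differs from an
injective linear map by one with small Lipschitz constant.\<close>

lemma C1_locally_injective:
  fixes f :: "'a::euclidean_space \<Rightarrow> 'b::euclidean_space"
  assumes "open S" "a \<in> S" and f: "Ck_on 1 f S" and inj: "inj (frechet_derivative f (at a))"
  obtains r where "r > 0" "ball a r \<subseteq> S" "inj_on f (ball a r)"
proof -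
  define f' where "f' x = frechet_derivative f (at x)" for x
  have f1: "Ck_on (Suc 0) f S" using f by simp
  have der: "(f has_derivative f' x) (at x)" if "x \<in> S" for x
    using Ck_on_SucD[OF f1 that] at_within_open[OF that \<open>open S\<close>] by (simp add: f'_def)
  have lin: "linear (f' x)" if "x \<in> S" for x
    using der[OF that] has_derivative_linear by blast
  obtain g' where g': "linear g'" "g' \<circ> f' a = id"
    using linear_injective_left_inverse[OF lin[OF assms(2)]] inj unfolding f'_def by blast
  have cont: "continuous_on S (\<lambda>x. f' x v)" for v
  proof -
    have "continuous_on S (\<lambda>x. frechet_derivative f (at x within S) v)" using f1 by simp
    then show ?thesis
      using at_within_open[OF _ \<open>open S\<close>] unfolding f'_def by (auto cong: continuous_on_cong)
  qed
  have small: "\<exists>d>0. \<forall>x. dist a x < d \<longrightarrow> onorm (\<lambda>v. f' x v - f' a v) < e" if e: "e > 0" for e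
  proof -
    have "continuous_on S (\<lambda>x. \<Sum>b\<in>Basis. norm (f' x b - f' a b))"
      by (intro continuous_intros cont)
    then have "isCont (\<lambda>x. \<Sum>b\<in>Basis. norm (f' x b - f' a b)) a"
      using assms(1,2) continuous_on_eq_continuous_at by blast
    from this[unfolded continuous_at_eps_delta, rule_format, OF half_gt_zero[OF e]]
    obtain d where d: "d > 0" and near: "\<And>x. dist x a < d \<Longrightarrow>
        dist (\<Sum>b\<in>Basis. norm (f' x b - f' a b)) (\<Sum>b\<in>Basis. norm (f' a b - f' a b)) < e / 2"
      by blast
    have close: "(\<Sum>b\<in>Basis. norm (f' x b - f' a b)) < e / 2" if "dist x a < d" for x
      using near[OF that] by (auto simp: dist_real_def intro: le_less_trans[OF abs_ge_self])
    obtain d' where d': "d' > 0" "ball a d' \<subseteq> S" using assms(1,2) open_contains_ball by blast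
    have "onorm (\<lambda>v. f' x v - f' a v) < e" if x: "dist a x < min d d'" for x
    proof -
      have xS: "x \<in> S" using d' x by (auto simp: subset_eq)
      have "norm (f' x v - f' a v) \<le> (e / 2) * norm v" for v
      proof -
        have l: "linear (\<lambda>v. f' x v - f' a v)" by (intro linear_compose_sub lin xS assms)
        have "f' x v - f' a v = (\<Sum>b\<in>Basis. (v \<bullet> b) *\<^sub>R (f' x b - f' a b))"
          using linear_sum[OF l, of "\<lambda>b. (v \<bullet> b) *\<^sub>R b" Basis] linear_cmul[OF l]
          by (simp add: euclidean_representation)
        then have "norm (f' x v - f' a v) \<le> (\<Sum>b\<in>Basis. norm ((v \<bullet> b) *\<^sub>R (f' x b - f' a b)))"
          by (simp only: norm_sum)
        also have "\<dots> \<le> (\<Sum>b\<in>Basis. norm v * norm (f' x b - f' a b))"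
          by (intro sum_mono) (auto simp: Basis_le_norm intro!: mult_right_mono)
        also have "\<dots> = norm v * (\<Sum>b\<in>Basis. norm (f' x b - f' a b))" by (simp add: sum_distrib_left)
        also have "\<dots> \<le> norm v * (e / 2)"
          using close[of x] x by (intro mult_left_mono) (auto simp: dist_commute)
        finally show ?thesis by (simp add: mult.commute)
      qed
      then have "onorm (\<lambda>v. f' x v - f' a v) \<le> e / 2" using e by (intro onorm_bound) auto
      then show ?thesis using e by linarith
    qed
    then show ?thesis using d d' by (intro exI[of _ "min d d'"]) auto
  qed
  show ?thesis
    using has_derivative_locally_injective[OF assms(2,1) _ g'(2) der small] g'(1) that
    by (metis linear_linear)
qed

text \<open>A product rule for the application of a time dependent linear map, which follows by expanding the
argument in a basis.\<close>

lemma moving_linear_derivative: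
  fixes M :: "real \<Rightarrow> 'v::euclidean_space \<Rightarrow> 'w::real_normed_vector"
  assumes lin: "\<And>\<tau>. linear (M \<tau>)" and M: "\<And>z. ((\<lambda>\<tau>. M \<tau> z) has_vector_derivative M' z) (at t within S)"
    and M': "linear M'" and y: "(y has_vector_derivative y') (at t within S)"
  shows "((\<lambda>\<tau>. M \<tau> (y \<tau>)) has_vector_derivative M' (y t) + M t y') (at t within S)"
proof -
  have e: "N z = (\<Sum>i\<in>Basis. (z \<bullet> i) *\<^sub>R N i)" if "linear N" for N :: "'v \<Rightarrow> 'w" and z
    using linear_sum[OF that, of "\<lambda>i. (z \<bullet> i) *\<^sub>R i" Basis] linear_cmul[OF that]
    by (simp add: euclidean_representation)
  have yi: "((\<lambda>\<tau>. y \<tau> \<bullet> i) has_real_derivative y' \<bullet> i) (at t within S)" for i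
    using bounded_linear.has_vector_derivative[OF bounded_linear_inner_left y]
    by (simp add: has_real_derivative_iff_has_vector_derivative)
  have "((\<lambda>\<tau>. \<Sum>i\<in>Basis. (y \<tau> \<bullet> i) *\<^sub>R M \<tau> i) has_vector_derivative
     (\<Sum>i\<in>Basis. (y t \<bullet> i) *\<^sub>R M' i + (y' \<bullet> i) *\<^sub>R M t i)) (at t within S)"
    by (intro has_vector_derivative_sum has_vector_derivative_scaleR[OF yi M])
  moreover have "(\<Sum>i\<in>Basis. (y t \<bullet> i) *\<^sub>R M' i + (y' \<bullet> i) *\<^sub>R M t i) = M' (y t) + M t y'"
    unfolding sum.distrib e[OF M', symmetric] e[OF lin, symmetric] ..
  ultimately show ?thesis unfolding e[OF lin, symmetric] by simp
qed

text \<open>Differentiation under the integral sign, applied twice.\<close>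

lemma integral_square_derivatives:
  fixes u :: "real \<Rightarrow> real \<Rightarrow> real"
  assumes u: "\<And>s t. t \<in> {0..a} \<Longrightarrow> ((\<lambda>s. u s t) has_real_derivative u1 s t) (at s)"
    and u1: "\<And>s t. t \<in> {0..a} \<Longrightarrow> ((\<lambda>s. u1 s t) has_real_derivative u2 s t) (at s)"
    and c: "continuous_on (UNIV \<times> {0..a}) (\<lambda>(s, t). u s t)" "continuous_on (UNIV \<times> {0..a}) (\<lambda>(s, t). u1 s t)"
      "continuous_on (UNIV \<times> {0..a}) (\<lambda>(s, t). u2 s t)"
  shows "((\<lambda>s. integral {0..a} (\<lambda>t. (u s t)\<^sup>2)) has_real_derivative integral {0..a} (\<lambda>t. 2 * u s t * u1 s t)) (at s)"
    and "((\<lambda>s. integral {0..a} (\<lambda>t. 2 * u s t * u1 s t)) has_real_derivative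
           integral {0..a} (\<lambda>t. 2 * ((u1 s t)\<^sup>2 + u s t * u2 s t))) (at s)"
proof -
  have slice: "continuous_on {0..a} (v s)" if "continuous_on (UNIV \<times> {0..a}) (\<lambda>(s, t). v s t)" for v :: "real \<Rightarrow> real \<Rightarrow> real" and s
  proof -
    have p: "continuous_on {0..a} (\<lambda>t. (s, t))" by (intro continuous_intros)
    have "(\<lambda>t. (s, t)) ` {0..a} \<subseteq> UNIV \<times> {0..a}" by auto
    from continuous_on_compose2[OF that p this] show ?thesis by simp
  qed
  have c': "continuous_on (UNIV \<times> {0..a}) (\<lambda>x. u (fst x) (snd x))" "continuous_on (UNIV \<times> {0..a}) (\<lambda>x. u1 (fst x) (snd x))"
      "continuous_on (UNIV \<times> {0..a}) (\<lambda>x. u2 (fst x) (snd x))"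
    using c by (simp_all add: case_prod_unfold)
  have d1: "((\<lambda>s. (u s t)\<^sup>2) has_real_derivative 2 * u s t * u1 s t) (at s)" if "t \<in> {0..a}" for s t
    by (auto intro!: derivative_eq_intros u[OF that])
  have d2: "((\<lambda>s. 2 * u s t * u1 s t) has_real_derivative 2 * ((u1 s t)\<^sup>2 + u s t * u2 s t)) (at s)" if "t \<in> {0..a}" for s t
    by (auto intro!: derivative_eq_intros u[OF that] u1[OF that] simp: power2_eq_square algebra_simps)
  have i1: "(\<lambda>t. (u s t)\<^sup>2) integrable_on cbox 0 a" for s
    unfolding cbox_interval by (intro integrable_continuous_interval continuous_intros slice[OF c(1)])
  have i2: "(\<lambda>t. 2 * u s t * u1 s t) integrable_on cbox 0 a" for s
    unfolding cbox_interval by (intro integrable_continuous_interval continuous_intros slice[OF c(1)] slice[OF c(2)])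
  have k1: "continuous_on (UNIV \<times> cbox 0 a) (\<lambda>(s, t). 2 * u s t * u1 s t)"
    unfolding case_prod_unfold cbox_interval by (intro continuous_intros c')
  have k2: "continuous_on (UNIV \<times> cbox 0 a) (\<lambda>(s, t). 2 * ((u1 s t)\<^sup>2 + u s t * u2 s t))"
    unfolding case_prod_unfold cbox_interval by (intro continuous_intros c')
  show "((\<lambda>s. integral {0..a} (\<lambda>t. (u s t)\<^sup>2)) has_real_derivative integral {0..a} (\<lambda>t. 2 * u s t * u1 s t)) (at s)"
    using leibniz_rule_field_derivative[of UNIV 0 a "\<lambda>s t. (u s t)\<^sup>2" "\<lambda>s t. 2 * u s t * u1 s t" s, OF _ i1 k1] d1
    by (simp add: cbox_interval)
  show "((\<lambda>s. integral {0..a} (\<lambda>t. 2 * u s t * u1 s t)) has_real_derivative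
           integral {0..a} (\<lambda>t. 2 * ((u1 s t)\<^sup>2 + u s t * u2 s t))) (at s)"
    using leibniz_rule_field_derivative[of UNIV 0 a "\<lambda>s t. 2 * u s t * u1 s t" "\<lambda>s t. 2 * ((u1 s t)\<^sup>2 + u s t * u2 s t)" s, OF _ i2 k2] d2
    by (simp add: cbox_interval)
qed

section \<open>The exponential series of a bilinear action\<close>

text \<open>The series \<open>e\<^bsup>b(Y)\<^esup> w\<close> is to be differentiated any number of times in \<open>Y\<close>. The term for \<open>n\<close> is the
iterated derivative of \<open>b(Y)\<^sup>n w\<close> along the directions \<open>vs\<close>, computed by the Leibniz rule from
\<open>b(Y)\<^sup>n\<^sup>+\<^sup>1 w = b(Y) (b(Y)\<^sup>n w)\<close>. Carrying the directions along makes the family closed under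
differentiation: a further derivative puts one more vector into the list.\<close>

fun exp_term :: "('v::real_vector \<Rightarrow> 'w::real_vector \<Rightarrow> 'w) \<Rightarrow> 'w \<Rightarrow> nat \<Rightarrow> 'v list \<Rightarrow> 'v \<Rightarrow> 'w" where
  "exp_term b w 0 vs Y = (if vs = [] then w else 0)"
| "exp_term b w (Suc n) vs Y = b Y (exp_term b w n vs Y) +
     (\<Sum>i<length vs. b (vs ! i) (exp_term b w n (take i vs @ drop (Suc i) vs) Y))"

text \<open>For \<open>vs = []\<close> this is \<open>e\<^bsup>b(Y)\<^esup> w\<close>, otherwise its iterated derivative in \<open>Y\<close> along \<open>vs\<close>.\<close>

definition exp_act :: "('v::real_vector \<Rightarrow> 'w::real_normed_vector \<Rightarrow> 'w) \<Rightarrow> 'w \<Rightarrow> 'v list \<Rightarrow> 'v \<Rightarrow> 'w" where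
  "exp_act b w vs Y = (\<Sum>n. (1 / fact n) *\<^sub>R exp_term b w n vs Y)"

text \<open>The coordinates are power series with infinite radius of convergence, which may be differentiated
term by term.\<close>

lemma vector_power_series_derivative:
  fixes a :: "nat \<Rightarrow> 'w::euclidean_space"
  assumes "\<And>n. norm (a n) \<le> M * C ^ n"
  shows "summable (\<lambda>n. (s ^ n / fact n) *\<^sub>R a n)"
    and "((\<lambda>s. \<Sum>n. (s ^ n / fact n) *\<^sub>R a n) has_vector_derivative
           (\<Sum>n. (s ^ n / fact n) *\<^sub>R a (Suc n))) (at s)"
proof -
  have M: "M \<ge> 0" using order_trans[OF norm_ge_zero assms[of 0]] by simp
  have C: "norm (a n) \<le> M * \<bar>C\<bar> ^ n" for n
    using order_trans[OF assms[of n] mult_left_mono[OF _ M]] abs_ge_self[of "C ^ n"] by (simp add: power_abs)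
  have sm: "summable (\<lambda>n. (s ^ n / fact n) *\<^sub>R a n)" for s
  proof (rule summable_comparison_test'[of "\<lambda>n. M * ((\<bar>s\<bar> * \<bar>C\<bar>) ^ n /\<^sub>R fact n)" 0])
    show "summable (\<lambda>n. M * ((\<bar>s\<bar> * \<bar>C\<bar>) ^ n /\<^sub>R fact n))"
      by (intro summable_mult summable_exp_generic)
    fix n :: nat
    have "norm ((s ^ n / fact n) *\<^sub>R a n) = \<bar>s\<bar> ^ n / fact n * norm (a n)"
      by (simp add: power_abs)
    also have "\<dots> \<le> \<bar>s\<bar> ^ n / fact n * (M * \<bar>C\<bar> ^ n)"
      by (intro mult_left_mono C) auto
    finally show "norm ((s ^ n / fact n) *\<^sub>R a n) \<le> M * ((\<bar>s\<bar> * \<bar>C\<bar>) ^ n /\<^sub>R fact n)"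
      by (simp add: field_simps power_mult_distrib)
  qed
  then show "summable (\<lambda>n. (s ^ n / fact n) *\<^sub>R a n)" .
  have sm': "summable (\<lambda>n. (s ^ n / fact n) *\<^sub>R a (Suc n))" for s
  proof (rule summable_comparison_test'[of "\<lambda>n. (M * \<bar>C\<bar>) * ((\<bar>s\<bar> * \<bar>C\<bar>) ^ n /\<^sub>R fact n)" 0])
    show "summable (\<lambda>n. (M * \<bar>C\<bar>) * ((\<bar>s\<bar> * \<bar>C\<bar>) ^ n /\<^sub>R fact n))"
      by (intro summable_mult summable_exp_generic)
    fix n :: nat
    have "norm ((s ^ n / fact n) *\<^sub>R a (Suc n)) = \<bar>s\<bar> ^ n / fact n * norm (a (Suc n))"
      by (simp add: power_abs)
    also have "\<dots> \<le> \<bar>s\<bar> ^ n / fact n * (M * \<bar>C\<bar> ^ Suc n)"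
      by (intro mult_left_mono C) auto
    finally show "norm ((s ^ n / fact n) *\<^sub>R a (Suc n)) \<le> (M * \<bar>C\<bar>) * ((\<bar>s\<bar> * \<bar>C\<bar>) ^ n /\<^sub>R fact n)"
      by (simp add: field_simps power_mult_distrib)
  qed
  show "((\<lambda>s. \<Sum>n. (s ^ n / fact n) *\<^sub>R a n) has_vector_derivative
           (\<Sum>n. (s ^ n / fact n) *\<^sub>R a (Suc n))) (at s)"
    unfolding has_vector_derivative_def
  proof (subst has_derivative_componentwise_within, rule ballI)
    fix i :: 'w assume "i \<in> Basis"
    define c where "c n = (a n \<bullet> i) / fact n" for n
    have sc: "summable (\<lambda>n. c n * x ^ n)" for x
      using bounded_linear.summable[OF bounded_linear_inner_left sm[of x], of i]
      by (simp add: c_def mult.commute)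
    have d: "diffs c n = (a (Suc n) \<bullet> i) / fact n" for n
      by (simp add: diffs_def c_def)
    have "((\<lambda>x. \<Sum>n. c n * x ^ n) has_real_derivative (\<Sum>n. diffs c n * s ^ n)) (at s)"
      by (rule termdiffs_strong'[where K="\<bar>s\<bar> + 1"]) (use sc in auto)
    moreover have "(\<Sum>n. c n * x ^ n) = (\<Sum>n. (x ^ n / fact n) *\<^sub>R a n) \<bullet> i" for x
      using bounded_linear.suminf[OF bounded_linear_inner_left sm[of x], of i]
      by (simp add: c_def mult.commute)
    moreover have "(\<Sum>n. diffs c n * s ^ n) = (\<Sum>n. (s ^ n / fact n) *\<^sub>R a (Suc n)) \<bullet> i"
      using bounded_linear.suminf[OF bounded_linear_inner_left sm'[of s], of i]
      by (simp add: d mult.commute)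
    ultimately show "((\<lambda>x. (\<Sum>n. (x ^ n / fact n) *\<^sub>R a n) \<bullet> i) has_derivative
          (\<lambda>x. (x *\<^sub>R (\<Sum>n. (s ^ n / fact n) *\<^sub>R a (Suc n))) \<bullet> i)) (at s)"
      by (auto simp: has_field_derivative_def fun_eq_iff elim!: has_derivative_eq_rhs)
  qed
qed

locale bilinear_action =
  fixes b :: "'v::euclidean_space \<Rightarrow> 'w::euclidean_space \<Rightarrow> 'w"
  assumes bil: "bounded_bilinear b"
begin

interpretation b: bounded_bilinear b by (rule bil)

lemma exp_term_scale:
  "exp_term b w n (map (\<lambda>v. s *\<^sub>R v) vs) (s *\<^sub>R Y) = s ^ n *\<^sub>R exp_term b w n vs Y"
proof (induction n arbitrary: vs)
  case (Suc n)
  have "b (map (\<lambda>v. s *\<^sub>R v) vs ! i) (exp_term b w n (take i (map (\<lambda>v. s *\<^sub>R v) vs) @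
            drop (Suc i) (map (\<lambda>v. s *\<^sub>R v) vs)) (s *\<^sub>R Y)) =
        s ^ Suc n *\<^sub>R b (vs ! i) (exp_term b w n (take i vs @ drop (Suc i) vs) Y)" if "i < length vs" for i
    using Suc[of "take i vs @ drop (Suc i) vs"] that
    by (simp add: take_map drop_map b.scaleR_left b.scaleR_right)
  then show ?case
    by (simp add: Suc b.scaleR_left b.scaleR_right scaleR_add_right scaleR_sum_right)
qed auto

lemma linear_exp_term: "linear (\<lambda>w. exp_term b w n vs Y)"
proof (induction n arbitrary: vs)
  case 0
  then show ?case by (cases "vs = []") (auto simp: linear_iff)
next
  case (Suc n)
  have "linear (\<lambda>w. b y (exp_term b w n us Y))" for y us
    using linear_compose[OF Suc[of us] bounded_linear.linear[OF b.bounded_linear_right[of y]]]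
    by (simp add: o_def)
  then show ?case by (auto intro!: linear_compose_add linear_compose_sum)
qed

lemma exp_term_commute: "exp_term b (b Y w) n [] Y = b Y (exp_term b w n [] Y)"
  by (induction n) auto

text \<open>Of the \<open>1 + length vs\<close> summands of the Leibniz rule each costs a factor \<open>c\<close>.\<close>

lemma exp_term_bound:
  assumes K: "\<And>y z. norm (b y z) \<le> norm y * norm z * K" and "K \<ge> 0"
    and c: "norm Y * K \<le> c" "\<And>v. v \<in> set vs \<Longrightarrow> norm v * K \<le> c"
  shows "norm (exp_term b w n vs Y) \<le> norm w * (c * (1 + length vs)) ^ n"
  using c
proof (induction n arbitrary: vs)
  case (Suc n)
  have c0: "c \<ge> 0" using Suc.prems(1) \<open>K \<ge> 0\<close> by (meson mult_nonneg_nonneg norm_ge_zero order_trans)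
  let ?k = "length vs"
  let ?B = "norm w * (c * (1 + ?k)) ^ n"
  have 0: "norm (b y z) \<le> c * B" if "norm y * K \<le> c" "norm z \<le> B" for y z B
  proof -
    have "norm (b y z) \<le> (norm y * K) * norm z" using K[of y z] by (simp add: mult_ac)
    also have "\<dots> \<le> c * B" using that c0 by (intro mult_mono) auto
    finally show ?thesis .
  qed
  have 1: "norm (b Y (exp_term b w n vs Y)) \<le> c * ?B"
    using Suc.IH[OF Suc.prems] Suc.prems(1) by (rule_tac 0) auto
  have 2: "norm (b (vs ! i) (exp_term b w n (take i vs @ drop (Suc i) vs) Y)) \<le> c * ?B" if i: "i < ?k" for i
  proof (rule 0)
    show "norm (vs ! i) * K \<le> c" using Suc.prems(2) i by auto
    have "norm (exp_term b w n (take i vs @ drop (Suc i) vs) Y) \<le>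
       norm w * (c * (1 + length (take i vs @ drop (Suc i) vs))) ^ n"
      by (rule Suc.IH[OF Suc.prems(1)]) (auto dest: in_set_takeD in_set_dropD intro: Suc.prems(2))
    also have "\<dots> \<le> ?B"
      using c0 i by (intro mult_left_mono power_mono) auto
    finally show "norm (exp_term b w n (take i vs @ drop (Suc i) vs) Y) \<le> ?B" .
  qed
  have "norm (exp_term b w (Suc n) vs Y) \<le> c * ?B + (\<Sum>i<?k. c * ?B)"
    unfolding exp_term.simps by (rule norm_triangle_le, rule add_mono[OF 1], rule sum_norm_le, rule 2) auto
  also have "\<dots> = norm w * (c * (1 + ?k)) ^ Suc n" by (simp add: algebra_simps)
  finally show ?case .
qed auto

text \<open>A geometric bound that is uniform on balls, also after one more differentiation, as needed to
differentiate the series term by term.\<close>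

lemma exp_term_bounded_ex:
  "\<exists>C\<ge>0. (\<forall>n Y. norm Y \<le> R \<longrightarrow> norm (exp_term b w n vs Y) \<le> norm w * C ^ n) \<and>
    (\<forall>n Y h. norm Y \<le> R \<longrightarrow> norm h \<le> 1 \<longrightarrow> norm (exp_term b w n (h # vs) Y) \<le> norm w * C ^ n)"
proof -
  obtain K where K: "K > 0" "\<And>y z. norm (b y z) \<le> norm y * norm z * K"
    using b.pos_bounded by auto
  define c where "c = (\<bar>R\<bar> + 1 + sum_list (map norm vs)) * K"
  have s0: "sum_list (map norm vs) \<ge> 0" by (rule sum_list_nonneg) auto
  have v: "norm v \<le> sum_list (map norm vs)" if "v \<in> set vs" for v
    by (rule member_le_sum_list) (use that in auto)
  have c0: "c \<ge> 0" using K s0 by (simp add: c_def)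
  have c1: "norm h * K \<le> c" if "h \<in> set vs \<or> norm h \<le> 1 \<or> norm h \<le> R" for h
  proof -
    have "norm h \<le> \<bar>R\<bar> + 1 + sum_list (map norm vs)"
      using that
    proof (elim disjE)
      assume "h \<in> set vs" then show ?thesis using v[of h] by linarith
    qed (use s0 in linarith)+
    then show ?thesis unfolding c_def using K by (intro mult_right_mono) auto
  qed
  show ?thesis
  proof (intro exI[of _ "c * (1 + Suc (length vs))"] conjI allI impI)
    show "c * (1 + Suc (length vs)) \<ge> 0" using c0 by simp
  next
    fix n :: nat and Y :: 'v assume Y: "norm Y \<le> R"
    have "norm (exp_term b w n vs Y) \<le> norm w * (c * (1 + length vs)) ^ n"
      by (rule exp_term_bound[of K]) (use K c1 Y in auto)
    also have "\<dots> \<le> norm w * (c * (1 + Suc (length vs))) ^ n"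
      using c0 by (intro mult_left_mono power_mono) auto
    finally show "norm (exp_term b w n vs Y) \<le> norm w * (c * (1 + Suc (length vs))) ^ n" .
  next
    fix n :: nat and Y h :: 'v assume Y: "norm Y \<le> R" and h: "norm h \<le> 1"
    have "norm (exp_term b w n (h # vs) Y) \<le> norm w * (c * (1 + length (h # vs))) ^ n"
      by (rule exp_term_bound[of K]) (use K c1 Y h in auto)
    then show "norm (exp_term b w n (h # vs) Y) \<le> norm w * (c * (1 + Suc (length vs))) ^ n" by simp
  qed
qed

lemma summable_exp_act: "summable (\<lambda>n. (1 / fact n) *\<^sub>R exp_term b w n vs Y)"
proof -
  obtain C where "\<And>n. norm (exp_term b w n vs Y) \<le> norm w * C ^ n"
    using exp_term_bounded_ex[of "norm Y" w vs] by blast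
  from vector_power_series_derivative(1)[OF this, where s=1] show ?thesis by simp
qed

lemma exp_term_derivative:
  "((\<lambda>Y. exp_term b w n vs Y) has_derivative (\<lambda>h. exp_term b w n (h # vs) Y)) (at Y)"
proof (induction n arbitrary: vs)
  case 0
  have "exp_term b w 0 vs = (\<lambda>Y. if vs = [] then w else 0)" by auto
  then show ?case by (simp only: exp_term.simps list.distinct(2) if_False has_derivative_const)
next
  case (Suc n)
  let ?r = "\<lambda>i. take i vs @ drop (Suc i) vs"
  have 1: "((\<lambda>Y. b Y (exp_term b w n vs Y)) has_derivative
     (\<lambda>h. b Y (exp_term b w n (h # vs) Y) + b h (exp_term b w n vs Y))) (at Y)"
    by (rule b.FDERIV[OF has_derivative_ident Suc])
  have 2: "((\<lambda>Y. b (vs ! i) (exp_term b w n (?r i) Y)) has_derivative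
     (\<lambda>h. b (vs ! i) (exp_term b w n (h # ?r i) Y))) (at Y)" for i
    by (rule bounded_linear.has_derivative[OF b.bounded_linear_right Suc])
  have 3: "((\<lambda>Y. exp_term b w (Suc n) vs Y) has_derivative
     (\<lambda>h. (b Y (exp_term b w n (h # vs) Y) + b h (exp_term b w n vs Y)) +
      (\<Sum>i<length vs. b (vs ! i) (exp_term b w n (h # ?r i) Y)))) (at Y)"
    unfolding exp_term.simps by (rule has_derivative_add[OF 1 has_derivative_sum[OF 2]])
  have 4: "exp_term b w (Suc n) (h # vs) Y = (b Y (exp_term b w n (h # vs) Y) + b h (exp_term b w n vs Y)) +
      (\<Sum>i<length vs. b (vs ! i) (exp_term b w n (h # ?r i) Y))" for h
    unfolding exp_term.simps(2) list.size(4) add_Suc_right add_0_right sum.lessThan_Suc_shift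
    by (simp del: exp_term.simps)
  show ?case unfolding 4 by (rule 3)
qed

text \<open>The derivatives of the partial sums converge uniformly on balls, by the remainder of an
exponential series.\<close>

lemma exp_act_derivative:
  "((\<lambda>Y. exp_act b w vs Y) has_derivative (\<lambda>h. exp_act b w (h # vs) Y)) (at Y)"
proof -
  define R where "R = norm Y + 1"
  obtain C where C: "C \<ge> 0" "\<And>n Y h. norm Y \<le> R \<Longrightarrow> norm h \<le> 1 \<Longrightarrow> norm (exp_term b w n (h # vs) Y) \<le> norm w * C ^ n"
    using exp_term_bounded_ex[of R w vs] by blast
  have C': "norm (exp_term b w n (h # vs) Z) \<le> norm h * (norm w * C ^ n)" if Z: "norm Z \<le> R" for n h Z
  proof (cases "h = 0")
    case True
    then show ?thesis using has_derivative_linear[OF exp_term_derivative[of w n vs Z]] linear_0 by fastforce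
  next
    case False
    define u where "u = h /\<^sub>R norm h"
    have h: "h = norm h *\<^sub>R u" using False by (simp add: u_def)
    have "exp_term b w n (h # vs) Z = norm h *\<^sub>R exp_term b w n (u # vs) Z"
      using linear_cmul[OF has_derivative_linear[OF exp_term_derivative[of w n vs Z]], of "norm h" u] h by simp
    moreover have "norm (exp_term b w n (u # vs) Z) \<le> norm w * C ^ n"
      using C(2)[OF Z, of u n] False by (simp add: u_def)
    ultimately show ?thesis by (simp add: mult_left_mono)
  qed
  let ?f = "\<lambda>n Y. (1 / fact n) *\<^sub>R exp_term b w n vs Y"
  let ?f' = "\<lambda>n Y h. (1 / fact n) *\<^sub>R exp_term b w n (h # vs) Y"
  have se: "summable (\<lambda>n. C ^ n / fact n)"
    using summable_exp_generic[of C] by (simp add: divide_inverse mult.commute)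
  have "\<exists>g. \<forall>x\<in>ball 0 R. (\<lambda>n. ?f n x) sums g x \<and> (g has_derivative (\<lambda>h. exp_act b w (h # vs) x)) (at x within ball 0 R)"
  proof (rule has_derivative_series[where f' = ?f' and l = "exp_act b w vs 0" and x = 0])
    show "convex (ball (0::'v) R)" by simp
    show "((\<lambda>Y. (1 / fact n) *\<^sub>R exp_term b w n vs Y) has_derivative ?f' n x) (at x within ball 0 R)" for n x
      by (rule has_derivative_scaleR_right[OF has_derivative_at_withinI[OF exp_term_derivative]])
    show "(0::'v) \<in> ball 0 R" by (simp add: R_def add_nonneg_pos)
    show "(\<lambda>n. ?f n 0) sums exp_act b w vs 0"
      unfolding exp_act_def by (rule summable_sums[OF summable_exp_act])
    fix e :: real assume e: "e > 0"
    define T where "T n = norm w * (\<Sum>i. C ^ (i + n) / fact (i + n))" for n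
    have "(\<lambda>n. norm w * (\<Sum>i. C ^ (i + n) / fact (i + n))) \<longlonglongrightarrow> norm w * 0"
      by (intro tendsto_mult tendsto_const suminf_exist_split2[OF se])
    then have "\<forall>\<^sub>F n in sequentially. T n < e"
      unfolding T_def using e by (auto dest: order_tendstoD(2))
    then show "\<forall>\<^sub>F n in sequentially. \<forall>x\<in>ball 0 R. \<forall>h.
        norm ((\<Sum>i<n. ?f' i x h) - exp_act b w (h # vs) x) \<le> e * norm h"
    proof eventually_elim
      case (elim n)
      show ?case
      proof (intro ballI allI)
        fix x h :: 'v assume x: "x \<in> ball 0 R"
        have sf: "summable (\<lambda>n. ?f' n x h)" by (rule summable_exp_act)
        have "exp_act b w (h # vs) x = (\<Sum>i. ?f' (i + n) x h) + (\<Sum>i<n. ?f' i x h)"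
          unfolding exp_act_def using suminf_split_initial_segment[OF sf, of n] by simp
        then have "norm ((\<Sum>i<n. ?f' i x h) - exp_act b w (h # vs) x) = norm (\<Sum>i. ?f' (i + n) x h)"
          by simp
        also have "\<dots> \<le> (\<Sum>i. (norm h * norm w) * (C ^ (i + n) / fact (i + n)))"
        proof (rule norm_suminf_le)
          show "norm (?f' (i + n) x h) \<le> (norm h * norm w) * (C ^ (i + n) / fact (i + n))" for i
            using divide_right_mono[OF C'[of x "i + n" h], of "fact (i + n)"] x by (simp add: mult_ac)
          show "summable (\<lambda>i. (norm h * norm w) * (C ^ (i + n) / fact (i + n)))"
            by (intro summable_mult summable_ignore_initial_segment se)
        qed
        also have "\<dots> = T n * norm h"
          by (subst suminf_mult) (auto simp: T_def intro: summable_ignore_initial_segment se)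
        also have "\<dots> \<le> e * norm h" using elim by (intro mult_right_mono) auto
        finally show "norm ((\<Sum>i<n. ?f' i x h) - exp_act b w (h # vs) x) \<le> e * norm h" .
      qed
    qed
  qed
  then obtain g where g: "\<And>x. x \<in> ball 0 R \<Longrightarrow> (\<lambda>n. ?f n x) sums g x"
    "\<And>x. x \<in> ball 0 R \<Longrightarrow> (g has_derivative (\<lambda>h. exp_act b w (h # vs) x)) (at x within ball 0 R)" by blast
  have Y: "Y \<in> ball 0 R" by (simp add: R_def)
  have "(g has_derivative (\<lambda>h. exp_act b w (h # vs) Y)) (at Y)"
    using g(2)[OF Y] at_within_open[OF Y] by simp
  then show ?thesis
    by (rule has_derivative_transform_within_open[where s="ball 0 R"])
       (use Y g(1) in \<open>auto simp: exp_act_def sums_iff\<close>)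
qed

lemma smooth_exp_act: "smooth_on (exp_act b w vs) UNIV"
proof -
  have "Ck_on k (exp_act b w vs) UNIV" for k
  proof (induction k arbitrary: vs)
    case 0
    have "isCont (exp_act b w vs) Y" for Y
      using has_derivative_continuous[OF exp_act_derivative] .
    then show ?case by (simp add: continuous_at_imp_continuous_on)
  next
    case (Suc k)
    then show ?case
      by (intro Ck_on_SucI[where f'="\<lambda>Y h. exp_act b w (h # vs) Y"]) (auto intro: exp_act_derivative)
  qed
  then show ?thesis by (simp add: smooth_on_def)
qed

lemma linear_exp_act: "linear (\<lambda>w. exp_act b w vs Y)"
proof (rule linearI)
  fix w1 w2 :: 'w and c :: real
  show "exp_act b (w1 + w2) vs Y = exp_act b w1 vs Y + exp_act b w2 vs Y"
    unfolding exp_act_def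
    by (simp add: linear_add[OF linear_exp_term] scaleR_add_right suminf_add[OF summable_exp_act summable_exp_act])
  show "exp_act b (c *\<^sub>R w1) vs Y = c *\<^sub>R exp_act b w1 vs Y"
    unfolding exp_act_def using suminf_scaleR_right[OF summable_exp_act[of w1 vs Y], of c]
    by (simp add: linear_cmul[OF linear_exp_term] mult.commute)
qed

lemma exp_act_commute: "exp_act b (b Y w) [] (s *\<^sub>R Y) = b Y (exp_act b w [] (s *\<^sub>R Y))"
proof -
  have t: "exp_term b u n [] (s *\<^sub>R Y) = s ^ n *\<^sub>R exp_term b u n [] Y" for u n
    using exp_term_scale[of u n s "[]" Y] by simp
  have "exp_term b (b Y w) n [] (s *\<^sub>R Y) = b Y (exp_term b w n [] (s *\<^sub>R Y))" for n
    by (simp add: t exp_term_commute b.scaleR_right)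
  then show ?thesis
    using bounded_linear.suminf[OF b.bounded_linear_right summable_exp_act[of w "[]" "s *\<^sub>R Y"], of Y]
    by (simp add: exp_act_def b.scaleR_right)
qed

lemma exp_term_zero: "exp_term b w n [] 0 = (if n = 0 then w else 0)"
  by (cases n) (simp_all add: b.zero_left)

lemma exp_act_zero: "exp_act b w [] 0 = w"
proof -
  have "(\<Sum>n. (1 / fact n) *\<^sub>R exp_term b w n [] 0) = (\<Sum>n\<in>{0}. (1 / fact n) *\<^sub>R exp_term b w n [] 0)"
    by (rule suminf_finite) (auto simp: exp_term_zero)
  then show ?thesis by (simp add: exp_act_def)
qed

lemma exp_act_zero_direction: "exp_act b w [v] 0 = b v w"
proof -
  have "exp_term b w (Suc n) [v] 0 = (if n = 0 then b v w else 0)" for n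
    by (simp add: b.zero_left b.zero_right exp_term_zero)
  then have "exp_term b w n [v] 0 = (if n = 1 then b v w else 0)" for n
    by (cases n) (auto simp del: exp_term.simps(2))
  moreover have "(\<Sum>n. (1 / fact n) *\<^sub>R exp_term b w n [v] 0) = (\<Sum>n\<in>{1}. (1 / fact n) *\<^sub>R exp_term b w n [v] 0)"
    by (rule suminf_finite) (auto simp: calculation simp del: exp_term.simps)
  ultimately show ?thesis by (simp add: exp_act_def b.zero_left)
qed

text \<open>Along the ray \<open>s Y\<close>, with directions scaled by \<open>s\<close> as well, the series is a power series in \<open>s\<close>. For
\<open>vs = []\<close> this is the differential equation of the flow, for one direction it is the equation from
which the derivative of the exponential map is computed.\<close>

lemma exp_act_time_derivative:
  "((\<lambda>s. exp_act b w (map (\<lambda>v. s *\<^sub>R v) vs) (s *\<^sub>R Y)) has_vector_derivative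
     b Y (exp_act b w (map (\<lambda>v. s *\<^sub>R v) vs) (s *\<^sub>R Y)) +
     (\<Sum>i<length vs. b (vs ! i) (exp_act b w (map (\<lambda>v. s *\<^sub>R v) (take i vs @ drop (Suc i) vs)) (s *\<^sub>R Y)))) (at s)"
proof -
  have e: "exp_act b w (map (\<lambda>v. s *\<^sub>R v) us) (s *\<^sub>R Y) = (\<Sum>n. (s ^ n / fact n) *\<^sub>R exp_term b w n us Y)" for s us
    unfolding exp_act_def exp_term_scale by simp
  have sm: "summable (\<lambda>n. (s ^ n / fact n) *\<^sub>R exp_term b w n us Y)" for us
    using summable_exp_act[of w "map (\<lambda>v. s *\<^sub>R v) us" "s *\<^sub>R Y"] unfolding exp_term_scale by simp
  obtain C where C: "\<And>n. norm (exp_term b w n vs Y) \<le> norm w * C ^ n"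
    using exp_term_bounded_ex[of "norm Y" w vs] by blast
  have bs: "summable (\<lambda>n. b y ((s ^ n / fact n) *\<^sub>R exp_term b w n us Y))"
    "(\<Sum>n. b y ((s ^ n / fact n) *\<^sub>R exp_term b w n us Y)) = b y (\<Sum>n. (s ^ n / fact n) *\<^sub>R exp_term b w n us Y)" for y us
    using bounded_linear.summable[OF b.bounded_linear_right sm] bounded_linear.suminf[OF b.bounded_linear_right sm]
    by auto
  have "(\<Sum>n. (s ^ n / fact n) *\<^sub>R exp_term b w (Suc n) vs Y) =
     (\<Sum>n. b Y ((s ^ n / fact n) *\<^sub>R exp_term b w n vs Y) +
       (\<Sum>i<length vs. b (vs ! i) ((s ^ n / fact n) *\<^sub>R exp_term b w n (take i vs @ drop (Suc i) vs) Y)))"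
    by (simp add: scaleR_add_right scaleR_sum_right b.scaleR_right)
  also have "\<dots> = b Y (\<Sum>n. (s ^ n / fact n) *\<^sub>R exp_term b w n vs Y) +
       (\<Sum>i<length vs. b (vs ! i) (\<Sum>n. (s ^ n / fact n) *\<^sub>R exp_term b w n (take i vs @ drop (Suc i) vs) Y))"
    by (subst suminf_add[symmetric]) (auto intro!: bs summable_sum simp: suminf_sum[OF bs(1)] bs(2))
  finally show ?thesis
    unfolding e using vector_power_series_derivative(2)[OF C, of s] by simp
qed

lemma exp_act_flow:
  "((\<lambda>s. exp_act b w [] (s *\<^sub>R Y)) has_vector_derivative b Y (exp_act b w [] (s *\<^sub>R Y))) (at s)"
  using exp_act_time_derivative[of w "[]" Y s] by simp

lemma exp_act_varying:
  assumes "(y has_vector_derivative y') (at t within S)"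
  shows "((\<lambda>s. exp_act b (y s) [] (s *\<^sub>R Y)) has_vector_derivative
     exp_act b y' [] (t *\<^sub>R Y) + b Y (exp_act b (y t) [] (t *\<^sub>R Y))) (at t within S)"
proof -
  have lin: "exp_act b z [] X = (\<Sum>i\<in>Basis. (z \<bullet> i) *\<^sub>R exp_act b i [] X)" for z X
    using linear_sum[OF linear_exp_act, of "\<lambda>i. (z \<bullet> i) *\<^sub>R i" Basis "[]" X] linear_cmul[OF linear_exp_act]
    by (simp add: euclidean_representation)
  have "((\<lambda>s. \<Sum>i\<in>Basis. (y s \<bullet> i) *\<^sub>R exp_act b i [] (s *\<^sub>R Y)) has_vector_derivative
     (\<Sum>i\<in>Basis. (y t \<bullet> i) *\<^sub>R b Y (exp_act b i [] (t *\<^sub>R Y)) + (y' \<bullet> i) *\<^sub>R exp_act b i [] (t *\<^sub>R Y))) (at t within S)"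
    by (intro has_vector_derivative_sum has_vector_derivative_scaleR
        has_vector_derivative_at_within[OF exp_act_flow])
      (use bounded_linear.has_vector_derivative[OF bounded_linear_inner_left assms]
        in \<open>simp add: has_real_derivative_iff_has_vector_derivative\<close>)
  moreover have "(\<Sum>i\<in>Basis. (y t \<bullet> i) *\<^sub>R b Y (exp_act b i [] (t *\<^sub>R Y))) = b Y (exp_act b (y t) [] (t *\<^sub>R Y))"
    by (subst (2) lin) (simp add: b.sum_right b.scaleR_right)
  ultimately show ?thesis
    by (subst lin, subst (2) lin) (simp add: sum.distrib add.commute)
qed

lemma exp_act_inverse: "exp_act b (exp_act b w [] (t *\<^sub>R Y)) [] (- t *\<^sub>R Y) = w"
proof -
  have "((\<lambda>s. exp_act b (exp_act b w [] (s *\<^sub>R Y)) [] (s *\<^sub>R (- Y))) has_vector_derivative 0) (at s)" for s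
    using exp_act_varying[OF exp_act_flow[of w Y s], of "- Y"] exp_act_commute[of "- Y" _ s]
      exp_act_commute[of Y _ "- s"] by (simp add: b.minus_left)
  from has_vector_derivative_zero_constant[OF convex_UNIV, of "\<lambda>s. exp_act b (exp_act b w [] (s *\<^sub>R Y)) [] (s *\<^sub>R (- Y))"] this
  obtain c where "\<And>s. exp_act b (exp_act b w [] (s *\<^sub>R Y)) [] (s *\<^sub>R (- Y)) = c" by auto
  from this[of t] this[of 0] show ?thesis by (simp add: exp_act_zero)
qed

lemma exp_act_in_subspace:
  assumes S: "subspace S" and b: "\<And>z. z \<in> S \<Longrightarrow> b Y z \<in> S" and w: "w \<in> S"
  shows "exp_act b w [] Y \<in> S"
proof -
  have t: "exp_term b w n [] Y \<in> S" for n by (induction n) (simp_all add: b w)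
  have "(\<lambda>n. \<Sum>i<n. (1 / fact i) *\<^sub>R exp_term b w i [] Y) \<longlonglongrightarrow> exp_act b w [] Y"
    using summable_exp_act[of w "[]" Y] unfolding exp_act_def by (rule summable_LIMSEQ)
  moreover have "(\<Sum>i<n. (1 / fact i) *\<^sub>R exp_term b w i [] Y) \<in> S" for n
    by (rule subspace_sum[OF S]) (rule subspace_scale[OF S t])
  ultimately show ?thesis
    by (rule closed_sequentially[OF closed_subspace[OF S], rotated])
qed

text \<open>Applying the inverse flow to a solution gives a curve with derivative 0. This uniqueness replaces most
manipulations of series below.\<close>

lemma linear_ode_unique:
  assumes "\<And>t. (y has_vector_derivative b Y (y t)) (at t)"
  shows "y t = exp_act b (y 0) [] (t *\<^sub>R Y)"
proof -
  have "((\<lambda>s. exp_act b (y s) [] (s *\<^sub>R (- Y))) has_vector_derivative 0) (at s)" for s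
    using exp_act_varying[OF assms, where t=s and Y="- Y"] exp_act_commute[of Y _ "- s"] by (simp add: b.minus_left)
  from has_vector_derivative_zero_constant[OF convex_UNIV, of "\<lambda>s. exp_act b (y s) [] (s *\<^sub>R (- Y))"] this
  obtain c where c: "\<And>s. exp_act b (y s) [] (s *\<^sub>R (- Y)) = c" by auto
  have "exp_act b (y t) [] (t *\<^sub>R (- Y)) = y 0" using c[of t] c[of 0] by (simp add: exp_act_zero)
  then show ?thesis using exp_act_inverse[of "y t" "- t" Y] by simp
qed

end

section \<open>The structure of the complex simple Lie algebra\<close>

lemma scaleR_eq_smult: "r *\<^sub>R (x :: complex ^ 'n) = complex_of_real r *s x"
  unfolding vec_eq_iff vector_scaleR_component vector_smult_component by (simp add: scaleR_conv_of_real)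

lemma linear_smult_real:
  assumes "Vector_Spaces.linear (*s) (*s) (f :: complex ^ 'n \<Rightarrow> complex ^ 'm)"
  shows "linear f"
  using assms by (intro linearI) (simp_all add: vec.linear_add vec.linear_scale scaleR_eq_smult)

text \<open>Applying \<open>f - c\<close> removes the component for the eigenvalue \<open>c\<close> and scales the others by nonzero
factors, so induction on the number of eigenvalues applies.\<close>

lemma eigenvector_sum_components:
  assumes f: "Vector_Spaces.linear (*s) (*s) (f :: complex ^ 'n \<Rightarrow> complex ^ 'n)"
    and M: "vec.subspace M" "\<And>x. x \<in> M \<Longrightarrow> f x \<in> M"
    and "finite C" "\<And>c. c \<in> C \<Longrightarrow> f (w c) = c *s w c" "(\<Sum>c\<in>C. w c) \<in> M"
  shows "\<forall>c\<in>C. w c \<in> M"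
  using assms(4-)
proof (induction C arbitrary: w rule: finite_induct)
  case (insert c0 C)
  let ?v = "\<Sum>c\<in>insert c0 C. w c"
  \<comment> \<open>the eigenvalue \<open>c0\<close> of the new component is subtracted, which leaves a sum over the old ones\<close>
  have "f ?v - c0 *s ?v \<in> M"
    using insert.prems M by (intro vec.subspace_diff vec.subspace_scale) auto
  moreover have "f ?v - c0 *s ?v = (\<Sum>c\<in>C. (c - c0) *s w c)"
  proof -
    have "f ?v = (\<Sum>c\<in>insert c0 C. c *s w c)"
      using vec.linear_sum[OF f, of w "insert c0 C"] insert.prems(1) by simp
    then have "f ?v - c0 *s ?v = (\<Sum>c\<in>insert c0 C. c *s w c - c0 *s w c)"
      by (simp only: sum_subtractf vec.scale_sum_right)
    also have "\<dots> = (\<Sum>c\<in>insert c0 C. (c - c0) *s w c)"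
      by (simp only: vec.scale_left_diff_distrib)
    finally show ?thesis using insert.hyps by simp
  qed
  ultimately have *: "(\<Sum>c\<in>C. (c - c0) *s w c) \<in> M" by simp
  have "\<forall>c\<in>C. (c - c0) *s w c \<in> M"
  proof (rule insert.IH[OF _ *])
    fix c assume "c \<in> C"
    then show "f ((c - c0) *s w c) = c *s ((c - c0) *s w c)"
      using insert.prems(1)[of c] by (simp only: vec.linear_scale[OF f] vec.scale_scale mult.commute insertI2)
  qed
  then have C: "w c \<in> M" if "c \<in> C" for c
  proof -
    have "c \<noteq> c0" using that insert.hyps by auto
    then have "w c = inverse (c - c0) *s ((c - c0) *s w c)"
      by (simp only: vec.scale_scale left_inverse right_minus_eq vec.scale_one not_False_eq_True)
    moreover have "inverse (c - c0) *s ((c - c0) *s w c) \<in> M"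
      by (rule vec.subspace_scale[OF M(1)]) (use \<open>\<forall>c\<in>C. _\<close> that in blast)
    ultimately show ?thesis by simp
  qed
  have "?v - (\<Sum>c\<in>C. w c) \<in> M"
    by (rule vec.subspace_diff[OF M(1) insert.prems(2) vec.subspace_sum[OF M(1) C]])
  then show ?case using C insert.hyps by simp
qed auto

text \<open>An element of the invariant subspace is a sum of eigenvectors for distinct eigenvalues, and these lie
in the subspace again.\<close>

lemma diagonalizable_restrict:
  assumes f: "Vector_Spaces.linear (*s) (*s) (f :: complex ^ 'n \<Rightarrow> complex ^ 'n)"
    and diag: "vec.span {x. \<exists>c. f x = c *s x} = UNIV"
    and M: "vec.subspace M" "\<And>x. x \<in> M \<Longrightarrow> f x \<in> M" and v: "v \<in> M"
  shows "v \<in> vec.span {x \<in> M. \<exists>c. f x = c *s x}"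
proof -
  have "\<exists>C w. finite C \<and> (\<forall>c\<in>C. f (w c) = c *s w c) \<and> v = (\<Sum>c\<in>C. w c)" if "v \<in> vec.span {x. \<exists>c. f x = c *s x}" for v
    using that
  proof (induction rule: vec.span_induct_alt)
    case base
    then show ?case by (intro exI[of _ "{}"]) auto
  next
    case (step a x y)
    then obtain C w d where C: "finite C" "\<forall>c\<in>C. f (w c) = c *s w c" "y = (\<Sum>c\<in>C. w c)"
      and d: "f x = d *s x" by blast
    \<comment> \<open>\<open>w c\<close> may be arbitrary for \<open>c\<close> outside of \<open>C\<close>; it is set to 0 before the new eigenvector is added\<close>
    define w0 where "w0 c = (if c \<in> C then w c else 0)" for c
    define w' where "w' = w0(d := w0 d + a *s x)"
    have w0: "f (w0 c) = c *s w0 c" for c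
      using C(2) by (simp add: w0_def vec.linear_0[OF f])
    have "f (w' c) = c *s w' c" for c
      using w0 d by (simp add: w'_def vec.linear_add[OF f] vec.linear_scale[OF f] vec.scale_right_distrib mult.commute)
    moreover have "(\<Sum>c\<in>insert d C. w' c) = a *s x + y"
    proof -
      have "(\<Sum>c\<in>insert d C. w' c) = (\<Sum>c\<in>insert d C. w0 c + (if c = d then a *s x else 0))"
        by (rule sum.cong) (auto simp: w'_def)
      also have "\<dots> = (\<Sum>c\<in>insert d C. w0 c) + a *s x"
        using C(1) by (simp add: sum.distrib)
      also have "(\<Sum>c\<in>insert d C. w0 c) = (\<Sum>c\<in>C. w c)"
        by (rule sum.mono_neutral_cong_right) (use C(1) in \<open>auto simp: w0_def\<close>)
      finally show ?thesis using C(3) by (simp add: add.commute)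
    qed
    ultimately show ?case using C(1) by (intro exI[of _ "insert d C"] exI[of _ w']) auto
  qed
  from this[of v] diag obtain C w where C: "finite C" "\<And>c. c \<in> C \<Longrightarrow> f (w c) = c *s w c" "v = (\<Sum>c\<in>C. w c)"
    by auto
  have "\<forall>c\<in>C. w c \<in> M"
    using eigenvector_sum_components[OF f M C(1,2)] C(3) v by simp
  then show ?thesis unfolding C(3) using C(2) by (intro vec.span_sum vec.span_base) auto
qed

locale flag_manifold =
  fixes D :: "('n::finite, 'a) flag_data"
  assumes flag: "generalized_flag_manifold D"
begin

abbreviation br where "br \<equiv> brk D"
abbreviation kil where "kil \<equiv> killing (brk D)"
abbreviation \<h> where "\<h> \<equiv> cartan D"
abbreviation rs where "rs \<equiv> root_space D"
abbreviation Xv where "Xv \<equiv> rootvec D"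
abbreviation Hv where "Hv \<equiv> H_vec D"

lemma simple: "simple_lie_algebra br" and cartan: "cartan_subalgebra br \<h>"
  and weyl: "weyl_basis D" and simple_system: "simple_system D (simples D)"
  and Theta_subset: "Theta D \<subseteq> simples D" and isotropy: "isotropy_decomposition D"
  and group_algebra: "lie_group_with_algebra (grp D) (gtop D) (gcharts D) (gexp D) br"
  using flag by (auto simp: generalized_flag_manifold_def)

lemma br_linear: "Vector_Spaces.linear (*s) (*s) (br x)" "Vector_Spaces.linear (*s) (*s) (\<lambda>x. br x y)"
  using simple by (auto simp: simple_lie_algebra_def complex_lie_algebra_def)

lemma br_add_right: "br x (y + z) = br x y + br x z" and br_scale_right: "br x (c *s y) = c *s br x y"
  and br_zero_right: "br x 0 = 0" and br_diff_right: "br x (y - z) = br x y - br x z"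
  and br_minus_right: "br x (- y) = - br x y"
  using vec.linear_add[OF br_linear(1)] vec.linear_scale[OF br_linear(1)] vec.linear_0[OF br_linear(1)]
    vec.linear_diff[OF br_linear(1)] vec.linear_neg[OF br_linear(1)] by auto

lemma br_add_left: "br (x + z) y = br x y + br z y" and br_scale_left: "br (c *s x) y = c *s br x y"
  and br_zero_left: "br 0 y = 0" and br_diff_left: "br (x - z) y = br x y - br z y"
  and br_minus_left: "br (- x) y = - br x y"
  using vec.linear_add[OF br_linear(2)] vec.linear_scale[OF br_linear(2)] vec.linear_0[OF br_linear(2)]
    vec.linear_diff[OF br_linear(2)] vec.linear_neg[OF br_linear(2)] by auto

lemmas br_simps = br_add_right br_scale_right br_zero_right br_diff_right br_minus_right
  br_add_left br_scale_left br_zero_left br_diff_left br_minus_left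

lemma br_self: "br x x = 0"
  using simple by (auto simp: simple_lie_algebra_def complex_lie_algebra_def)

lemma br_antisym: "br x y = - br y x"
proof -
  have "br x y + br y x = 0"
    using br_self[of "x + y", unfolded br_add_left br_add_right] by (simp only: br_self add_0_left add_0_right add.commute)
  then show ?thesis by (simp only: eq_neg_iff_add_eq_0)
qed

lemma jacobi: "br x (br y z) = br (br x y) z + br y (br x z)"
proof -
  have "br x (br y z) + br y (br z x) + br z (br x y) = 0"
    using simple by (auto simp: simple_lie_algebra_def complex_lie_algebra_def)
  moreover have "br y (br z x) = - br y (br x z)"
    using br_antisym[of z x] by (simp add: br_simps)
  moreover have "br z (br x y) = - br (br x y) z" by (rule br_antisym)
  ultimately have "br x (br y z) - br y (br x z) - br (br x y) z = 0" by (simp only: diff_conv_add_uminus)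
  moreover have "a - b - c = 0 \<Longrightarrow> a = c + b" for a b c :: "complex ^ 'n" by (simp add: algebra_simps)
  ultimately show ?thesis by blast
qed

lemma bounded_bilinear_br: "bounded_bilinear br"
proof -
  have "bilinear br"
    unfolding bilinear_def using br_linear linear_smult_real by blast
  then show ?thesis by (simp add: bilinear_conv_bounded_bilinear)
qed

sublocale ad: bilinear_action br
  by (rule bilinear_action.intro[OF bounded_bilinear_br])

lemma kil_sum: "kil x y = (\<Sum>i\<in>UNIV. br x (br y (axis i 1)) $ i)"
  by (simp add: killing_def trace_def matrix_def)

lemma kil_matrix: "kil x y = trace (matrix (br x) ** matrix (br y))"
  using matrix_compose_gen[OF br_linear(1) br_linear(1), of x y] by (simp add: killing_def o_def)

lemma kil_sym: "kil x y = kil y x"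
  unfolding kil_matrix by (rule trace_mul_sym)

lemma kil_add_left: "kil (x + y) z = kil x z + kil y z" and kil_scale_left: "kil (c *s x) z = c * kil x z"
  by (simp_all add: kil_sum br_simps sum.distrib sum_distrib_left)

lemma kil_add_right: "kil z (x + y) = kil z x + kil z y" and kil_scale_right: "kil z (c *s x) = c * kil z x"
  using kil_add_left[of x y z] kil_scale_left[of c x z] by (simp_all only: kil_sym)

lemma kil_zero: "kil 0 z = 0" "kil z 0 = 0"
  using kil_scale_left[of 0 0 z] kil_scale_right[of z 0 0] by auto

lemma kil_minus: "kil (- x) z = - kil x z" "kil z (- x) = - kil z x"
  using kil_scale_left[of "-1" x z] kil_scale_right[of z "-1" x] by auto

lemma kil_diff: "kil (x - y) z = kil x z - kil y z" "kil z (x - y) = kil z x - kil z y"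
  using kil_add_left[of x "- y" z] kil_add_right[of z x "- y"] by (simp_all add: kil_minus)

lemma kil_scaleR: "kil (r *\<^sub>R x) z = of_real r * kil x z" "kil z (r *\<^sub>R x) = of_real r * kil z x"
  by (simp_all add: scaleR_eq_smult kil_scale_left kil_scale_right)

lemma kil_sum_left: "kil (\<Sum>i\<in>I. f i) z = (\<Sum>i\<in>I. kil (f i) z)"
  by (induction I rule: infinite_finite_induct) (auto simp: kil_zero kil_add_left)

lemmas kil_simps = kil_add_left kil_add_right kil_scale_left kil_scale_right kil_zero kil_minus kil_diff kil_scaleR

lemma trace_compose_commute:
  assumes "Vector_Spaces.linear (*s) (*s) (f :: complex ^ 'm \<Rightarrow> complex ^ 'm)"
    and "Vector_Spaces.linear (*s) (*s) (g :: complex ^ 'm \<Rightarrow> complex ^ 'm)"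
  shows "(\<Sum>i\<in>UNIV. f (g (axis i 1)) $ i) = (\<Sum>i\<in>UNIV. g (f (axis i 1)) $ i)"
proof -
  have "trace (matrix (f \<circ> g)) = trace (matrix (g \<circ> f))"
    unfolding matrix_compose_gen[OF assms(2,1)] matrix_compose_gen[OF assms] by (rule trace_mul_sym)
  then show ?thesis by (simp add: trace_def matrix_def)
qed

lemma kil_invariant: "kil (br x y) z = kil x (br y z)"
proof -
  have e: "br (br u v) w = br u (br v w) - br v (br u w)" for u v w using jacobi[of u v w] by simp
  have "(\<Sum>i\<in>UNIV. br y (br x (br z (axis i 1))) $ i) = (\<Sum>i\<in>UNIV. br x (br z (br y (axis i 1))) $ i)"
    using trace_compose_commute[OF br_linear(1)[of y] Vector_Spaces.linear_compose[OF br_linear(1)[of z] br_linear(1)[of x]]]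
    by simp
  then show ?thesis
    unfolding kil_sum e br_diff_right by (simp add: sum_subtractf)
qed

lemma ideal_trivial:
  assumes "vec.subspace I" "\<And>x y. y \<in> I \<Longrightarrow> br x y \<in> I" "z \<in> I" "z \<noteq> 0"
  shows "I = UNIV"
  using simple assms unfolding simple_lie_algebra_def by blast

lemma center_trivial:
  assumes "\<And>y. br x y = 0" shows "x = 0"
proof (rule ccontr)
  assume x: "x \<noteq> 0"
  let ?I = "{x. \<forall>y. br x y = 0}"
  have "?I = UNIV"
  proof (rule ideal_trivial[of _ x])
    show "vec.subspace ?I" by (auto simp: vec.subspace_def br_simps)
    fix y z assume "z \<in> ?I"
    then show "br y z \<in> ?I" using br_antisym[of y z] by (auto simp: br_simps)
  qed (use x assms in auto)
  then show False using simple unfolding simple_lie_algebra_def by auto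
qed

lemma cartan_subspace: "vec.subspace \<h>" and cartan_abelian: "x \<in> \<h> \<Longrightarrow> y \<in> \<h> \<Longrightarrow> br x y = 0"
  and cartan_diagonalizable: "H \<in> \<h> \<Longrightarrow> vec.span {x. \<exists>c. br H x = c *s x} = UNIV"
  using cartan by (auto simp: cartan_subalgebra_def abelian_subalgebra_def)

lemma cartan_maximal:
  assumes x: "\<And>H. H \<in> \<h> \<Longrightarrow> br H x = 0" shows "x \<in> \<h>"
proof -
  let ?h = "vec.span (insert x \<h>)"
  have "br y z = 0" if "y \<in> ?h" "z \<in> ?h" for y z
  proof -
    have 1: "br y z = 0" if "y \<in> insert x \<h>" "z \<in> ?h" for y z
      using that(2)
    proof (induction rule: vec.span_induct_alt)
      case (step c u v)
      have "br y u = 0"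
        using step.hyps that(1) x cartan_abelian br_self br_antisym[of y u] by auto
      then show ?case using step by (simp add: br_simps)
    qed (simp add: br_simps)
    show ?thesis
      using that(1)
    proof (induction rule: vec.span_induct_alt)
      case (step c u v)
      then show ?case using 1[of u z] that(2) by (simp add: br_simps)
    qed (simp add: br_simps)
  qed
  then have "abelian_subalgebra br ?h" by (auto simp: abelian_subalgebra_def vec.subspace_span)
  moreover have "\<h> \<subseteq> ?h" by (auto intro: vec.span_base)
  ultimately have "?h = \<h>" using cartan unfolding cartan_subalgebra_def by blast
  then show ?thesis using vec.span_base[of x "insert x \<h>"] by auto
qed

lemma rs_subspace: "vec.subspace (rs \<alpha>)"
  by (auto simp: vec.subspace_def root_space_def br_simps vec.scale_right_distrib mult.commute)

lemma rs_zero: "rs (\<lambda>x. 0) = \<h>"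
  using cartan_maximal cartan_abelian by (auto simp: root_space_def)

lemma rs_bracket:
  assumes "x \<in> rs \<alpha>" "y \<in> rs \<beta>" shows "br x y \<in> rs (\<lambda>H. \<alpha> H + \<beta> H)"
  using assms jacobi by (auto simp: root_space_def br_simps vec.scale_left_distrib)

lemma root_outside: "\<alpha> \<in> roots D \<Longrightarrow> x \<notin> \<h> \<Longrightarrow> \<alpha> x = 0"
  and root_nonzero: "\<alpha> \<in> roots D \<Longrightarrow> \<alpha> \<noteq> (\<lambda>x. 0)"
  by (auto simp: roots_def)

lemma rs_eq_zero_or_root:
  assumes "\<And>x. x \<notin> \<h> \<Longrightarrow> \<alpha> x = 0" "\<alpha> \<notin> roots D" "\<alpha> \<noteq> (\<lambda>x. 0)"
  shows "rs \<alpha> = {0}"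
  using assms by (auto simp: roots_def)

lemma rootI:
  assumes "\<And>x. x \<notin> \<h> \<Longrightarrow> \<alpha> x = 0" "v \<in> rs \<alpha>" "v \<noteq> 0" "\<alpha> \<noteq> (\<lambda>x. 0)"
  shows "\<alpha> \<in> roots D"
  using assms by (auto simp: roots_def)

text \<open>The commuting diagonalizable operators \<open>ad H\<close>, for \<open>H\<close> in a basis of the Cartan subalgebra, are
diagonalized one after the other. A joint eigenvector for the basis is one for the whole Cartan
subalgebra, and its eigenvalues form a root or vanish; in the latter case maximality puts it into the
Cartan subalgebra.\<close>

lemma root_space_decomposition: "vec.span (\<h> \<union> (\<Union>\<alpha>\<in>roots D. rs \<alpha>)) = UNIV"
proof -
  have joint: "vec.span {x. \<forall>H\<in>F. \<exists>c. br H x = c *s x} = UNIV" if "finite F" "F \<subseteq> \<h>" for F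
    using that
  proof (induction F rule: finite_induct)
    case (insert H F)
    have "v \<in> vec.span {x. \<forall>H\<in>insert H F. \<exists>c. br H x = c *s x}" if ev: "\<forall>H\<in>F. \<exists>c. br H v = c *s v" for v
    proof -
      obtain c where c: "\<And>H'. H' \<in> F \<Longrightarrow> br H' v = c H' *s v" using bchoice[OF ev] by blast
      \<comment> \<open>the joint eigenspace containing \<open>v\<close> is invariant under the next operator\<close>
      let ?M = "{x. \<forall>H'\<in>F. br H' x = c H' *s x}"
      have "v \<in> vec.span {x \<in> ?M. \<exists>d. br H x = d *s x}"
      proof (rule diagonalizable_restrict[OF br_linear(1)])
        show "vec.span {x. \<exists>c. br H x = c *s x} = UNIV" using cartan_diagonalizable insert.prems by auto
        show "vec.subspace ?M"
          by (auto simp: vec.subspace_def br_simps vec.scale_right_distrib mult.commute)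
        fix x assume x: "x \<in> ?M"
        show "br H x \<in> ?M"
        proof (intro CollectI ballI)
          fix H' assume H': "H' \<in> F"
          have "br H' (br H x) = br (br H' H) x + br H (br H' x)" by (rule jacobi)
          then show "br H' (br H x) = c H' *s br H x"
            using x H' insert.prems cartan_abelian[of H' H] by (auto simp: br_simps)
        qed
      qed (use c in auto)
      then show ?thesis by (rule rev_subsetD) (rule vec.span_mono, auto)
    qed
    then have "{x. \<forall>H\<in>F. \<exists>c. br H x = c *s x} \<subseteq> vec.span {x. \<forall>H\<in>insert H F. \<exists>c. br H x = c *s x}" by auto
    from vec.span_minimal[OF this vec.subspace_span] insert show ?case by auto
  qed (auto simp: vec.span_UNIV)
  obtain B where B: "B \<subseteq> \<h>" "vec.independent B" "\<h> \<subseteq> vec.span B"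
    using vec.basis_exists[of \<h>] by metis
  have fin: "finite B" using B(2) by (rule vec.finiteI_independent)
  have "{x. \<forall>H\<in>B. \<exists>c. br H x = c *s x} \<subseteq> \<h> \<union> (\<Union>\<alpha>\<in>roots D. rs \<alpha>)"
  proof safe
    fix x assume x: "\<forall>H\<in>B. \<exists>c. br H x = c *s x" and nr: "x \<notin> (\<Union>\<alpha>\<in>roots D. rs \<alpha>)"
    have "vec.subspace {H. \<exists>c. br H x = c *s x}"
      unfolding vec.subspace_def
    proof (intro conjI ballI allI)
      have "br 0 x = 0 *s x" by (simp add: br_simps)
      then show "0 \<in> {H. \<exists>c. br H x = c *s x}" by blast
    next
      fix H H' assume "H \<in> {H. \<exists>c. br H x = c *s x}" "H' \<in> {H. \<exists>c. br H x = c *s x}"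
      then obtain c c' where "br H x = c *s x" "br H' x = c' *s x" by blast
      then have "br (H + H') x = (c + c') *s x" by (simp only: br_add_left vec.scale_left_distrib)
      then show "H + H' \<in> {H. \<exists>c. br H x = c *s x}" by blast
    next
      fix d H assume "H \<in> {H. \<exists>c. br H x = c *s x}"
      then obtain c where "br H x = c *s x" by blast
      then have "br (d *s H) x = (d * c) *s x" by (simp only: br_scale_left vec.scale_scale)
      then show "d *s H \<in> {H. \<exists>c. br H x = c *s x}" by blast
    qed
    then have "vec.span B \<subseteq> {H. \<exists>c. br H x = c *s x}" using x by (intro vec.span_minimal) auto
    then have "\<forall>H\<in>\<h>. \<exists>c. br H x = c *s x" using B(3) by auto
    from bchoice[OF this] obtain c where c: "\<And>H. H \<in> \<h> \<Longrightarrow> br H x = c H *s x" by blast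
    define \<alpha> where "\<alpha> H = (if H \<in> \<h> then c H else 0)" for H
    have xa: "x \<in> rs \<alpha>" using c by (auto simp: root_space_def \<alpha>_def)
    show "x \<in> \<h>"
    proof (cases "\<alpha> = (\<lambda>x. 0)")
      case True
      then show ?thesis using xa rs_zero by auto
    next
      case False
      then have "x = 0" using rootI[of \<alpha> x] xa nr by (auto simp: \<alpha>_def)
      then show ?thesis using cartan_subspace vec.subspace_0 by auto
    qed
  qed
  from vec.span_mono[OF this] joint[OF fin B(1)] show ?thesis by auto
qed

lemma UNIV_induct:
  assumes "vec.subspace {x. Q x}" "\<And>x. x \<in> \<h> \<Longrightarrow> Q x" "\<And>\<alpha> x. \<alpha> \<in> roots D \<Longrightarrow> x \<in> rs \<alpha> \<Longrightarrow> Q x"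
  shows "Q x"
proof -
  have "vec.span (\<h> \<union> (\<Union>\<alpha>\<in>roots D. rs \<alpha>)) \<subseteq> {x. Q x}"
    by (rule vec.span_minimal) (use assms in auto)
  then show ?thesis using root_space_decomposition by auto
qed

text \<open>By invariance \<open>(\<alpha> + \<beta>)(H) (x, y) = ([H, x], y) + (x, [H, y]) = 0\<close>.\<close>

lemma kil_orthogonal:
  assumes "x \<in> rs \<alpha>" "y \<in> rs \<beta>" "H \<in> \<h>" "\<alpha> H + \<beta> H \<noteq> 0"
  shows "kil x y = 0"
proof -
  have "kil (br H x) y = \<alpha> H * kil x y" using assms by (simp add: root_space_def kil_simps)
  moreover have "kil (br H x) y = - kil (br x H) y" by (subst br_antisym) (simp add: kil_simps)
  moreover have "kil (br x H) y = \<beta> H * kil x y" using assms by (simp add: root_space_def kil_simps kil_invariant)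
  ultimately have "\<alpha> H * kil x y = - (\<beta> H * kil x y)" by simp
  then have "(\<alpha> H + \<beta> H) * kil x y = 0" by (simp add: distrib_right)
  then show ?thesis using assms(4) by simp
qed

lemma kil_orthogonal_root_spaces:
  assumes "\<alpha> \<in> roots D" "\<beta> \<in> roots D" "\<beta> \<noteq> - \<alpha>" "x \<in> rs \<alpha>" "y \<in> rs \<beta>"
  shows "kil x y = 0"
proof -
  obtain H where H: "\<beta> H \<noteq> - \<alpha> H" using assms(3) by (auto simp: fun_eq_iff)
  have "H \<in> \<h>" using H root_outside[OF assms(1)] root_outside[OF assms(2)] by (cases "H \<in> \<h>") auto
  moreover have "\<alpha> H + \<beta> H \<noteq> 0" using H by (metis add_eq_0_iff)
  ultimately show ?thesis by (rule kil_orthogonal[OF assms(4,5)])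
qed

lemma kil_orthogonal_cartan:
  assumes "\<alpha> \<in> roots D" "x \<in> rs \<alpha>" "H \<in> \<h>"
  shows "kil x H = 0"
proof -
  obtain H' where H': "\<alpha> H' \<noteq> 0" using root_nonzero[OF assms(1)] by auto
  have "H' \<in> \<h>" using H' root_outside[OF assms(1)] by auto
  moreover have "H \<in> rs (\<lambda>x. 0)" using assms(3) rs_zero by simp
  ultimately show ?thesis using H' by (intro kil_orthogonal[OF assms(2), of H "\<lambda>x. 0" H']) simp_all
qed

lemma Xv_in: "\<alpha> \<in> roots D \<Longrightarrow> Xv \<alpha> \<in> rs \<alpha>"
  and kil_Xv: "\<alpha> \<in> roots D \<Longrightarrow> kil (Xv \<alpha>) (Xv (- \<alpha>)) = 1"
  using weyl by (auto simp: weyl_basis_def)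

lemma Xv_nonzero: "\<alpha> \<in> roots D \<Longrightarrow> Xv \<alpha> \<noteq> 0"
  using kil_Xv[of \<alpha>] by (auto simp: kil_zero)

lemma kil_right_subspace: "vec.subspace {y. kil x y = 0}"
  by (auto simp: vec.subspace_def kil_simps)

text \<open>Otherwise \<open>X\<^sub>\<alpha>\<close> would be orthogonal to all root spaces and to the Cartan subalgebra, but its product
with the vector \<open>rootvec D (- \<alpha>)\<close> is 1.\<close>

lemma neg_root:
  assumes "\<alpha> \<in> roots D" shows "- \<alpha> \<in> roots D"
proof (rule ccontr)
  assume n: "- \<alpha> \<notin> roots D"
  have "kil (Xv \<alpha>) (Xv (- \<alpha>)) = 0"
  proof (rule UNIV_induct[of "\<lambda>y. kil (Xv \<alpha>) y = 0", OF kil_right_subspace])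
    show "kil (Xv \<alpha>) y = 0" if "y \<in> \<h>" for y
      by (rule kil_orthogonal_cartan[OF assms Xv_in[OF assms] that])
    show "kil (Xv \<alpha>) y = 0" if "\<beta> \<in> roots D" "y \<in> rs \<beta>" for \<beta> y
      using kil_orthogonal_root_spaces[OF assms that(1) _ Xv_in[OF assms] that(2)] that(1) n by auto
  qed
  then show False using kil_Xv[OF assms] by simp
qed

lemma neg_neg: "- (- \<alpha>) = (\<alpha> :: 'n functional)"
  by (auto simp: fun_eq_iff)

lemma root_neq_neg: "\<alpha> \<in> roots D \<Longrightarrow> \<alpha> \<noteq> - \<alpha>"
  using root_nonzero[of \<alpha>] by (auto simp: fun_eq_iff)

lemma kil_Xv_Xv:
  assumes "\<alpha> \<in> roots D" "\<beta> \<in> roots D"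
  shows "kil (Xv \<alpha>) (Xv \<beta>) = (if \<beta> = - \<alpha> then 1 else 0)"
  using assms kil_Xv kil_orthogonal_root_spaces[OF assms _ Xv_in Xv_in] by auto

text \<open>The vectors \<open>X\<^sub>-\<^sub>\<alpha>\<close> are dual to the \<open>X\<^sub>\<alpha>\<close>, so the latter are linearly independent.\<close>

lemma finite_roots: "finite (roots D)"
proof -
  have dual: "kil (Xv \<alpha>) (Xv (- \<beta>)) = (if \<alpha> = \<beta> then 1 else 0)" if "\<alpha> \<in> roots D" "\<beta> \<in> roots D" for \<alpha> \<beta>
    using kil_Xv_Xv[of \<alpha> "- \<beta>"] that neg_root by (auto simp: fun_eq_iff)
  have inj: "inj_on Xv (roots D)"
  proof (rule inj_onI)
    fix \<alpha> \<beta> assume "\<alpha> \<in> roots D" "\<beta> \<in> roots D" "Xv \<alpha> = Xv \<beta>"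
    then show "\<alpha> = \<beta>" using dual[of \<alpha> \<beta>] dual[of \<beta> \<beta>] by (auto split: if_splits)
  qed
  have "vec.independent (Xv ` roots D)"
    unfolding vec.dependent_explicit
  proof (rule notI, elim exE conjE bexE)
    fix t u v assume t: "finite t" "t \<subseteq> Xv ` roots D" "(\<Sum>v\<in>t. u v *s v) = 0" and v: "v \<in> t" "u v \<noteq> 0"
    show False
    proof -
      obtain \<beta> where \<beta>: "\<beta> \<in> roots D" "v = Xv \<beta>" using t v by auto
      have "0 = kil (\<Sum>v\<in>t. u v *s v) (Xv (- \<beta>))" using t by (simp add: kil_zero)
      also have "\<dots> = (\<Sum>v'\<in>t. if v' = v then u v else 0)"
        unfolding kil_sum_left
      proof (rule sum.cong)
        fix w assume "w \<in> t"
        then obtain \<alpha> where "\<alpha> \<in> roots D" "w = Xv \<alpha>" using t by auto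
        then show "kil (u w *s w) (Xv (- \<beta>)) = (if w = v then u v else 0)"
          using dual[of \<alpha> \<beta>] \<beta> inj by (auto simp: kil_simps dest: inj_onD)
      qed auto
      finally show ?thesis using t(1) v by simp
    qed
  qed
  then have "finite (Xv ` roots D)" by (rule vec.finiteI_independent)
  then show ?thesis using inj finite_imageD by blast
qed

lemma roots_nonempty: "roots D \<noteq> {}"
proof
  assume e: "roots D = {}"
  have "vec.span \<h> = UNIV" using root_space_decomposition e by simp
  then have "\<h> = UNIV" using cartan_subspace vec.span_eq_iff[of \<h>] by metis
  then show False using cartan_abelian simple by (auto simp: simple_lie_algebra_def)
qed

text \<open>The radical is an ideal, and it is not everything because \<open>(X\<^sub>\<alpha>, X\<^sub>-\<^sub>\<alpha>) = 1\<close>.\<close>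

lemma kil_nondegenerate:
  assumes "\<And>y. kil x y = 0" shows "x = 0"
proof (rule ccontr)
  assume x: "x \<noteq> 0"
  let ?I = "{x. \<forall>y. kil x y = 0}"
  have "?I = UNIV"
  proof (rule ideal_trivial[of _ x])
    show "vec.subspace ?I" by (auto simp: vec.subspace_def kil_simps)
    fix y z assume "z \<in> ?I"
    then show "br y z \<in> ?I" using br_antisym[of y z] by (auto simp: kil_simps kil_invariant)
  qed (use x assms in auto)
  then have "kil x y = 0" for x y by blast
  moreover obtain \<alpha> where "\<alpha> \<in> roots D" using roots_nonempty by auto
  ultimately show False using kil_Xv[of \<alpha>] by simp
qed

lemma kil_nondegenerate_cartan:
  assumes "Z \<in> \<h>" "\<And>H. H \<in> \<h> \<Longrightarrow> kil Z H = 0" shows "Z = 0"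
proof (rule kil_nondegenerate)
  fix y show "kil Z y = 0"
  proof (rule UNIV_induct[of "\<lambda>y. kil Z y = 0", OF kil_right_subspace])
    show "kil Z x = 0" if "\<alpha> \<in> roots D" "x \<in> rs \<alpha>" for \<alpha> x
      using kil_orthogonal_cartan[OF that assms(1)] kil_sym[of Z x] by simp
  qed (rule assms(2))
qed

lemma cancel_neg: "(\<lambda>H. \<alpha> H + (- \<alpha>) H) = (\<lambda>x. (0::complex))" by auto

text \<open>Invariance gives \<open>([X\<^sub>\<alpha>, X\<^sub>-\<^sub>\<alpha>], H) = \<alpha>(H) (X\<^sub>\<alpha>, X\<^sub>-\<^sub>\<alpha>)\<close>, and the form is nondegenerate on the
Cartan subalgebra.\<close>

lemma Hv_bracket:
  assumes "\<alpha> \<in> roots D"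
  shows "br (Xv \<alpha>) (Xv (- \<alpha>)) = Hv \<alpha>" and Hv_in: "Hv \<alpha> \<in> \<h>"
    and kil_Hv: "\<And>H. H \<in> \<h> \<Longrightarrow> kil (Hv \<alpha>) H = \<alpha> H"
proof -
  let ?Z = "br (Xv \<alpha>) (Xv (- \<alpha>))"
  have Z: "?Z \<in> \<h>"
    using rs_bracket[OF Xv_in[OF assms] Xv_in[OF neg_root[OF assms]]] by (simp only: cancel_neg rs_zero)
  have k: "kil ?Z H = \<alpha> H" if "H \<in> \<h>" for H
  proof -
    have e: "br H (Xv (- \<alpha>)) = (- \<alpha> H) *s Xv (- \<alpha>)"
      using Xv_in[OF neg_root[OF assms]] that by (simp add: root_space_def)
    have "kil ?Z H = - kil (Xv \<alpha>) (br H (Xv (- \<alpha>)))"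
      unfolding kil_invariant br_antisym[of "Xv (- \<alpha>)" H] by (rule kil_minus)
    also have "\<dots> = \<alpha> H * kil (Xv \<alpha>) (Xv (- \<alpha>))"
      unfolding e kil_scale_right by simp
    finally show ?thesis by (simp only: kil_Xv[OF assms] mult_1_right)
  qed
  have "Hv \<alpha> = ?Z"
    unfolding H_vec_def
  proof (rule the_equality)
    show "?Z \<in> \<h> \<and> (\<forall>H\<in>\<h>. \<alpha> H = kil ?Z H)" using Z k by auto
    fix Z assume A: "Z \<in> \<h> \<and> (\<forall>H\<in>\<h>. \<alpha> H = kil Z H)"
    have "Z - ?Z = 0"
      by (rule kil_nondegenerate_cartan) (use A Z k cartan_subspace in \<open>auto simp: kil_simps intro: vec.subspace_diff\<close>)
    then show "Z = ?Z" by simp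
  qed
  then show "?Z = Hv \<alpha>" "Hv \<alpha> \<in> \<h>" "\<And>H. H \<in> \<h> \<Longrightarrow> kil (Hv \<alpha>) H = \<alpha> H" using Z k by auto
qed

lemma br_Hv_Xv: "\<alpha> \<in> roots D \<Longrightarrow> \<beta> \<in> roots D \<Longrightarrow> br (Hv \<alpha>) (Xv \<beta>) = \<beta> (Hv \<alpha>) *s Xv \<beta>"
  using Xv_in Hv_in by (auto simp: root_space_def)

text \<open>The functionals \<open>\<gamma> + j \<alpha>\<close> are pairwise distinct, so only finitely many of them are roots.\<close>

lemma infinite_string:
  assumes "\<alpha> \<in> roots D" "\<And>x. x \<notin> \<h> \<Longrightarrow> \<gamma> x = 0"
    and "\<And>j::nat. v j \<in> rs (\<lambda>H. \<gamma> H + of_nat j * \<alpha> H)" "\<And>j. v j \<noteq> 0"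
  shows False
proof -
  let ?f = "\<lambda>j::nat. (\<lambda>H. \<gamma> H + of_nat j * \<alpha> H)"
  have "?f j \<in> insert (\<lambda>x. 0) (roots D)" for j
  proof (cases "?f j = (\<lambda>x. 0)")
    case False
    then show ?thesis using rootI[of "?f j" "v j"] assms root_outside[OF assms(1)] by simp
  qed auto
  then have "range ?f \<subseteq> insert (\<lambda>x. 0) (roots D)" by blast
  then have "finite (range ?f)" using finite_roots finite_subset by blast
  moreover have "inj ?f"
  proof (rule injI)
    fix i j assume e: "?f i = ?f j"
    obtain H where H: "\<alpha> H \<noteq> 0" using root_nonzero[OF assms(1)] by auto
    have "of_nat i * \<alpha> H = of_nat j * \<alpha> H" using fun_cong[OF e, of H] by simp
    then show "i = j" using H by simp
  qed
  ultimately show False using finite_imageD infinite_UNIV_nat by blast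
qed

text \<open>For \<open>w\<^sub>k = ad(X\<^sub>\<alpha>)\<^sup>k v\<close> the relations of \<open>sl\<^sub>2\<close> give \<open>[X\<^sub>-\<^sub>\<alpha>, w\<^sub>k] = - d\<^sub>k w\<^sub>k\<^sub>-\<^sub>1\<close> with
\<open>d\<^sub>k = k \<gamma>(H\<^sub>\<alpha>) + k(k-1)/2 \<alpha>(H\<^sub>\<alpha>)\<close>. If no \<open>d\<^sub>k\<close> vanished, all \<open>w\<^sub>k\<close> would be nonzero and the string would not
end.\<close>

lemma string_from_bottom:
  assumes a: "\<alpha> \<in> roots D" and g: "\<And>x. x \<notin> \<h> \<Longrightarrow> \<gamma> x = 0" and v: "v \<in> rs \<gamma>" "v \<noteq> 0"
    and bottom: "br (Xv (- \<alpha>)) v = 0"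
  shows "\<exists>k::nat. k \<noteq> 0 \<and> of_nat k * \<gamma> (Hv \<alpha>) + of_nat (k * (k - 1) div 2) * \<alpha> (Hv \<alpha>) = 0"
proof (rule ccontr)
  define d where "d k = of_nat k * \<gamma> (Hv \<alpha>) + of_nat (k * (k - 1) div 2) * \<alpha> (Hv \<alpha>)" for k :: nat
  assume "\<not> ?thesis"
  then have d: "d k \<noteq> 0" if "k \<noteq> 0" for k using that unfolding d_def by blast
  have d_Suc: "d (Suc k) = d k + \<gamma> (Hv \<alpha>) + of_nat k * \<alpha> (Hv \<alpha>)" for k
  proof -
    have "Suc k * k div 2 = k * (k - 1) div 2 + k"
    proof (cases k)
      case (Suc m)
      have "Suc (Suc m) * Suc m = Suc m * m + 2 * Suc m" by (simp add: algebra_simps)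
      then show ?thesis using Suc by simp
    qed simp
    then show ?thesis by (simp add: d_def algebra_simps)
  qed
  define w where "w j = (br (Xv \<alpha>) ^^ j) v" for j
  have w0: "w 0 = v" and wS: "w (Suc j) = br (Xv \<alpha>) (w j)" for j by (simp_all add: w_def)
  have w: "w j \<in> rs (\<lambda>H. \<gamma> H + of_nat j * \<alpha> H)" for j
  proof (induction j)
    case (Suc j)
    have e: "(\<lambda>H. \<alpha> H + (\<gamma> H + of_nat j * \<alpha> H)) = (\<lambda>H. \<gamma> H + of_nat (Suc j) * \<alpha> H)"
      by (auto simp: algebra_simps)
    show ?case unfolding wS using rs_bracket[OF Xv_in[OF a] Suc] unfolding e .
  qed (use v w0 in simp)
  have YX: "br (Xv (- \<alpha>)) (Xv \<alpha>) = - Hv \<alpha>"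
    using br_antisym[of "Xv (- \<alpha>)" "Xv \<alpha>"] by (simp only: Hv_bracket(1)[OF a])
  have Hw: "br (- Hv \<alpha>) (w j) = - (\<gamma> (Hv \<alpha>) + of_nat j * \<alpha> (Hv \<alpha>)) *s w j" for j
    using w[of j] Hv_in[OF a] by (simp add: root_space_def br_simps del: of_nat_Suc)
  \<comment> \<open>Jacobi identity with \<open>[X\<^sub>-\<^sub>\<alpha>, X\<^sub>\<alpha>] = - H\<^sub>\<alpha>\<close>\<close>
  have step: "br (Xv (- \<alpha>)) (w (Suc j)) =
      - (\<gamma> (Hv \<alpha>) + of_nat j * \<alpha> (Hv \<alpha>)) *s w j + br (Xv \<alpha>) (br (Xv (- \<alpha>)) (w j))" for j
    unfolding wS[of j] jacobi[of "Xv (- \<alpha>)" "Xv \<alpha>" "w j"] YX Hw ..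
  have low: "br (Xv (- \<alpha>)) (w (Suc j)) = - d (Suc j) *s w j" for j
  proof (induction j)
    case 0
    have "br (Xv \<alpha>) (br (Xv (- \<alpha>)) (w 0)) = 0" unfolding w0 bottom by (rule br_zero_right)
    moreover have "d (Suc 0) = \<gamma> (Hv \<alpha>)" by (simp add: d_def)
    ultimately show ?case unfolding step by simp
  next
    case (Suc j)
    have "br (Xv \<alpha>) (br (Xv (- \<alpha>)) (w (Suc j))) = - d (Suc j) *s w (Suc j)"
      unfolding Suc br_scale_right wS[of j, symmetric] ..
    then show ?case
      unfolding step[of "Suc j"] d_Suc[of "Suc j"] by (simp only: vec.scale_left_distrib[symmetric]) simp
  qed
  have "w j \<noteq> 0" for j
  proof (induction j)
    case (Suc j)
    then have "- d (Suc j) *s w j \<noteq> 0" using d[of "Suc j"] by simp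
    then show ?case using low[of j] by (auto simp: br_simps)
  qed (use w0 v in simp)
  then show False using infinite_string[OF a g w] by blast
qed

lemma string_bottom_exists:
  assumes a: "\<alpha> \<in> roots D" and g: "\<And>x. x \<notin> \<h> \<Longrightarrow> \<gamma> x = 0" and v: "v \<in> rs \<gamma>" "v \<noteq> 0"
  shows "\<exists>(p::nat) u. u \<in> rs (\<lambda>H. \<gamma> H - of_nat p * \<alpha> H) \<and> u \<noteq> 0 \<and> br (Xv (- \<alpha>)) u = 0"
proof (rule ccontr)
  assume n: "\<not> ?thesis"
  define w where "w j = (br (Xv (- \<alpha>)) ^^ j) v" for j
  have w: "w j \<in> rs (\<lambda>H. \<gamma> H + of_nat j * (- \<alpha>) H)" for j
  proof (induction j)
    case (Suc j)
    have e: "(\<lambda>H. (- \<alpha>) H + (\<gamma> H + of_nat j * (- \<alpha>) H)) = (\<lambda>H. \<gamma> H + of_nat (Suc j) * (- \<alpha>) H)"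
      by (auto simp: algebra_simps)
    show ?case using rs_bracket[OF Xv_in[OF neg_root[OF a]] Suc] unfolding e w_def by simp
  qed (use v in \<open>simp add: w_def\<close>)
  have e: "(\<lambda>H. \<gamma> H + of_nat j * (- \<alpha>) H) = (\<lambda>H. \<gamma> H - of_nat j * \<alpha> H)" for j by auto
  have "w j \<noteq> 0" for j
  proof (induction j)
    case (Suc j)
    then have "br (Xv (- \<alpha>)) (w j) \<noteq> 0" using n w[of j] unfolding e by blast
    then show ?case by (simp add: w_def)
  qed (use v in \<open>simp add: w_def\<close>)
  then show False using infinite_string[OF neg_root[OF a] g w] by blast
qed

text \<open>At the bottom \<open>\<gamma> - p \<alpha>\<close> of the string through \<open>\<gamma>\<close> the preceding relation can be solved for
\<open>\<gamma>(H\<^sub>\<alpha>)\<close>.\<close>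

lemma root_string:
  assumes a: "\<alpha> \<in> roots D" and g: "\<gamma> \<in> roots D"
  shows "\<exists>r::real. \<gamma> (Hv \<alpha>) = of_real r * \<alpha> (Hv \<alpha>)"
proof -
  obtain p :: nat and u where u: "u \<in> rs (\<lambda>H. \<gamma> H - of_nat p * \<alpha> H)" "u \<noteq> 0" "br (Xv (- \<alpha>)) u = 0"
    using string_bottom_exists[OF a root_outside[OF g] Xv_in[OF g] Xv_nonzero[OF g]] by blast
  obtain k :: nat where k: "k \<noteq> 0"
    "of_nat k * (\<gamma> (Hv \<alpha>) - of_nat p * \<alpha> (Hv \<alpha>)) + of_nat (k * (k - 1) div 2) * \<alpha> (Hv \<alpha>) = 0"
    using string_from_bottom[OF a _ u] root_outside[OF a] root_outside[OF g] by auto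
  define m where "m = k * (k - 1) div 2"
  have "of_nat k * \<gamma> (Hv \<alpha>) = (of_nat k * of_nat p - of_nat m) * \<alpha> (Hv \<alpha>)"
    using k(2) unfolding m_def[symmetric] by (simp add: algebra_simps)
  then have "\<gamma> (Hv \<alpha>) = ((of_nat k * of_nat p - of_nat m) / of_nat k) * \<alpha> (Hv \<alpha>)"
    using k(1) by (simp add: field_simps)
  also have "(of_nat k * of_nat p - of_nat m) / of_nat k = complex_of_real ((real k * real p - real m) / real k)"
    by simp
  finally show ?thesis by blast
qed

text \<open>If \<open>\<alpha>(H\<^sub>\<alpha>) = 0\<close>, then \<open>\<gamma>(H\<^sub>\<alpha>) = 0\<close> for every root \<open>\<gamma>\<close>, so \<open>H\<^sub>\<alpha>\<close> would be central.\<close>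

lemma root_length_nonzero:
  assumes a: "\<alpha> \<in> roots D" shows "\<alpha> (Hv \<alpha>) \<noteq> 0"
proof
  assume 0: "\<alpha> (Hv \<alpha>) = 0"
  have "br (Hv \<alpha>) y = 0" for y
  proof (rule UNIV_induct[of "\<lambda>y. br (Hv \<alpha>) y = 0"])
    show "vec.subspace {y. br (Hv \<alpha>) y = 0}" by (auto simp: vec.subspace_def br_simps)
    show "br (Hv \<alpha>) y = 0" if "y \<in> \<h>" for y using cartan_abelian[OF Hv_in[OF a] that] .
    fix \<gamma> y assume g: "\<gamma> \<in> roots D" "y \<in> rs \<gamma>"
    have "\<gamma> (Hv \<alpha>) = 0" using root_string[OF a g(1)] 0 by auto
    then show "br (Hv \<alpha>) y = 0" using g(2) Hv_in[OF a] by (simp add: root_space_def)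
  qed
  then have "Hv \<alpha> = 0" by (rule center_trivial)
  then have "\<alpha> H = 0" for H
    using kil_Hv[OF a, of H] root_outside[OF a, of H] by (cases "H \<in> \<h>") (auto simp: kil_zero)
  then show False using root_nonzero[OF a] by auto
qed

text \<open>A nonzero vector \<open>z\<close> in the root space of \<open>\<alpha>\<close> orthogonal to \<open>X\<^sub>-\<^sub>\<alpha>\<close> satisfies \<open>[X\<^sub>-\<^sub>\<alpha>, z] = 0\<close>, so a string would start at
\<open>\<alpha>\<close> itself. All coefficients \<open>d\<^sub>k = (k + k(k-1)/2) \<alpha>(H\<^sub>\<alpha>)\<close> of that string are nonzero.\<close>

lemma root_space_one_dimensional:
  assumes a: "\<alpha> \<in> roots D" and y: "y \<in> rs \<alpha>"
  shows "y = kil y (Xv (- \<alpha>)) *s Xv \<alpha>"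
proof (rule ccontr)
  let ?z = "y - kil y (Xv (- \<alpha>)) *s Xv \<alpha>"
  assume "\<not> ?thesis"
  then have z0: "?z \<noteq> 0" by simp
  have z: "?z \<in> rs \<alpha>"
    by (rule vec.subspace_diff[OF rs_subspace y vec.subspace_scale[OF rs_subspace Xv_in[OF a]]])
  have kz: "kil ?z (Xv (- \<alpha>)) = 0" using kil_Xv[OF a] by (simp add: kil_simps)
  have c: "(\<lambda>H. (- \<alpha>) H + \<alpha> H) = (\<lambda>x. 0)" by auto
  have "br (Xv (- \<alpha>)) ?z = 0"
  proof (rule kil_nondegenerate_cartan)
    show "br (Xv (- \<alpha>)) ?z \<in> \<h>"
      using rs_bracket[OF Xv_in[OF neg_root[OF a]] z] by (simp only: c rs_zero)
    fix H assume H: "H \<in> \<h>"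
    have h1: "kil (br (Xv (- \<alpha>)) ?z) H = - kil (Xv (- \<alpha>)) (br H ?z)"
      unfolding kil_invariant br_antisym[of ?z H] by (rule kil_minus)
    have h2: "br H ?z = \<alpha> H *s ?z" using z H by (simp add: root_space_def)
    have h3: "kil (Xv (- \<alpha>)) (\<alpha> H *s ?z) = 0"
      unfolding kil_scale_right using kz kil_sym[of ?z "Xv (- \<alpha>)"] by (simp only: mult_zero_right)
    show "kil (br (Xv (- \<alpha>)) ?z) H = 0" unfolding h1 h2 h3 by (rule minus_zero)
  qed
  from string_from_bottom[OF a root_outside[OF a] z z0 this]
  obtain k :: nat where k: "k \<noteq> 0" "of_nat k * \<alpha> (Hv \<alpha>) + of_nat (k * (k - 1) div 2) * \<alpha> (Hv \<alpha>) = 0" by blast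
  have "of_nat (k + k * (k - 1) div 2) * \<alpha> (Hv \<alpha>) = 0"
    using k(2) by (simp only: of_nat_add distrib_right)
  then show False using root_length_nonzero[OF a] k(1) by (simp del: of_nat_add)
qed

lemma span_rootvec: "vec.span (\<h> \<union> Xv ` roots D) = UNIV"
proof -
  have "x \<in> vec.span (\<h> \<union> Xv ` roots D)" for x
  proof (rule UNIV_induct)
    show "vec.subspace {x. x \<in> vec.span (\<h> \<union> Xv ` roots D)}" by simp
    show "x \<in> vec.span (\<h> \<union> Xv ` roots D)" if "x \<in> \<h>" for x using that by (auto intro: vec.span_base)
    fix \<alpha> x assume "\<alpha> \<in> roots D" "x \<in> rs \<alpha>"
    then have "x = kil x (Xv (- \<alpha>)) *s Xv \<alpha>" "Xv \<alpha> \<in> \<h> \<union> Xv ` roots D"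
      using root_space_one_dimensional by auto
    then show "x \<in> vec.span (\<h> \<union> Xv ` roots D)" by (metis vec.span_base vec.span_scale)
  qed
  then show ?thesis by auto
qed

lemma br_Xv_Xv:
  assumes "\<alpha> \<in> roots D" "\<beta> \<in> roots D" "\<beta> \<noteq> - \<alpha>"
  shows "br (Xv \<alpha>) (Xv \<beta>) = complex_of_real (weylm D \<alpha> \<beta>) *s Xv (\<lambda>H. \<alpha> H + \<beta> H)"
  and "(\<lambda>H. \<alpha> H + \<beta> H) \<notin> roots D \<Longrightarrow> weylm D \<alpha> \<beta> = 0"
  and weylm_neg: "weylm D (- \<alpha>) (- \<beta>) = - weylm D \<alpha> \<beta>"
  using weyl assms by (auto simp: weyl_basis_def)

lemma ideal_from_generators:
  assumes "\<And>x. x \<in> S \<Longrightarrow> \<forall>H\<in>\<h>. br H x \<in> vec.span S"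
    and "\<And>x \<beta>. x \<in> S \<Longrightarrow> \<beta> \<in> roots D \<Longrightarrow> br (Xv \<beta>) x \<in> vec.span S"
    and "z \<in> S" "z \<noteq> 0"
  shows "vec.span S = UNIV"
proof (rule ideal_trivial[of _ z])
  show "vec.subspace (vec.span S)" by simp
  fix x y assume y: "y \<in> vec.span S"
  have gen: "br u y \<in> vec.span S" if "u \<in> \<h> \<union> Xv ` roots D" for u
    using y
  proof (induction rule: vec.span_induct_alt)
    case (step c x y)
    have "br u x \<in> vec.span S" using assms(1,2)[OF step.hyps] that by auto
    then show ?case using step by (auto simp: br_simps intro: vec.span_add vec.span_scale)
  qed (simp add: br_simps vec.span_zero)
  have "x \<in> vec.span (\<h> \<union> Xv ` roots D)" by (simp add: span_rootvec)
  then show "br x y \<in> vec.span S"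
  proof (induction rule: vec.span_induct_alt)
    case (step c u v)
    then show ?case using gen[OF step.hyps] by (auto simp: br_simps intro: vec.span_add vec.span_scale)
  qed (simp add: br_simps vec.span_zero)
qed (use assms vec.span_base in auto)

text \<open>The span is a nonzero ideal.\<close>

lemma span_Hv_Xv: "vec.span (Hv ` roots D \<union> Xv ` roots D) = UNIV"
proof -
  let ?S = "Hv ` roots D \<union> Xv ` roots D"
  obtain \<alpha> where a: "\<alpha> \<in> roots D" using roots_nonempty by auto
  show ?thesis
  proof (rule ideal_from_generators[of _ "Xv \<alpha>"])
    fix x assume x: "x \<in> ?S"
    then show "\<forall>H\<in>\<h>. br H x \<in> vec.span ?S"
    proof
      assume "x \<in> Hv ` roots D"
      then show ?thesis using Hv_in cartan_abelian by (auto simp: vec.span_zero)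
    next
      assume "x \<in> Xv ` roots D"
      then obtain \<beta> where b: "\<beta> \<in> roots D" "x = Xv \<beta>" by auto
      show ?thesis
      proof
        fix H assume "H \<in> \<h>"
        then have "br H x = \<beta> H *s x" using Xv_in[OF b(1)] b(2) by (simp add: root_space_def)
        then show "br H x \<in> vec.span ?S" using x by (auto intro: vec.span_scale vec.span_base)
      qed
    qed
    fix \<beta> assume b: "\<beta> \<in> roots D"
    show "br (Xv \<beta>) x \<in> vec.span ?S"
      using x
    proof
      assume "x \<in> Hv ` roots D"
      then obtain \<gamma> where g: "\<gamma> \<in> roots D" "x = Hv \<gamma>" by auto
      have "br (Xv \<beta>) x = - (\<beta> (Hv \<gamma>) *s Xv \<beta>)"
        unfolding g(2) using br_antisym[of "Xv \<beta>" "Hv \<gamma>"] br_Hv_Xv[OF g(1) b] by simp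
      moreover have "Xv \<beta> \<in> vec.span ?S" using b by (intro vec.span_base) simp
      ultimately show ?thesis by (simp only: vec.span_neg vec.span_scale)
    next
      assume "x \<in> Xv ` roots D"
      then obtain \<gamma> where g: "\<gamma> \<in> roots D" "x = Xv \<gamma>" by auto
      show ?thesis
      proof (cases "\<gamma> = - \<beta>")
        case True
        then show ?thesis using Hv_bracket(1)[OF b] g b by (auto intro: vec.span_base)
      next
        case False
        show ?thesis
        proof (cases "(\<lambda>H. \<beta> H + \<gamma> H) \<in> roots D")
          case True
          then show ?thesis unfolding g(2) br_Xv_Xv(1)[OF b g(1) False]
            by (intro vec.span_scale vec.span_base) auto
        next
          case n: False
          then show ?thesis unfolding g(2) br_Xv_Xv(1)[OF b g(1) False] br_Xv_Xv(2)[OF b g(1) False n]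
            by (simp add: vec.span_zero)
        qed
      qed
    qed
  qed (use a Xv_nonzero in auto)
qed

text \<open>The Jacobi identity expresses \<open>[[X\<^sub>\<alpha>, X\<^sub>-\<^sub>\<alpha>], X\<^sub>\<beta>]\<close> by double brackets whose structure constants are
real.\<close>

lemma real_root_value_generic:
  assumes a: "\<alpha> \<in> roots D" and b: "\<beta> \<in> roots D" and n: "\<beta> \<noteq> \<alpha>" "\<beta> \<noteq> - \<alpha>"
  shows "\<beta> (Hv \<alpha>) \<in> \<real>"
proof -
  have na: "- \<alpha> \<in> roots D" by (rule neg_root[OF a])
  have bracket_twice: "\<exists>r::real. br (Xv (- \<delta>)) (br (Xv \<delta>) (Xv \<beta>)) = of_real r *s Xv \<beta>"
    if d: "\<delta> \<in> roots D" "\<beta> \<noteq> - \<delta>" for \<delta>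
  proof (cases "(\<lambda>H. \<delta> H + \<beta> H) \<in> roots D")
    case False
    then have "br (Xv \<delta>) (Xv \<beta>) = 0" using br_Xv_Xv[OF d(1) b d(2)] by simp
    then show ?thesis by (intro exI[of _ 0]) (simp add: br_simps)
  next
    case True
    have ne: "(\<lambda>H. \<delta> H + \<beta> H) \<noteq> - (- \<delta>)"
      using root_nonzero[OF b] by (auto simp: fun_eq_iff)
    have e: "(\<lambda>H. (- \<delta>) H + (\<delta> H + \<beta> H)) = \<beta>" by auto
    have "br (Xv (- \<delta>)) (br (Xv \<delta>) (Xv \<beta>)) =
        of_real (weylm D \<delta> \<beta>) *s (of_real (weylm D (- \<delta>) (\<lambda>H. \<delta> H + \<beta> H)) *s Xv \<beta>)"
      unfolding br_Xv_Xv(1)[OF d(1) b d(2)] br_scale_right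
        br_Xv_Xv(1)[OF neg_root[OF d(1)] True ne] e ..
    then show ?thesis by (intro exI[of _ "weylm D \<delta> \<beta> * weylm D (- \<delta>) (\<lambda>H. \<delta> H + \<beta> H)"])
      (simp only: vec.scale_scale of_real_mult)
  qed
  obtain r where r: "br (Xv (- \<alpha>)) (br (Xv \<alpha>) (Xv \<beta>)) = complex_of_real r *s Xv \<beta>"
    using bracket_twice[OF a n(2)] by blast
  have n': "\<beta> \<noteq> - (- \<alpha>)" unfolding neg_neg by (rule n(1))
  obtain s where s: "br (Xv \<alpha>) (br (Xv (- \<alpha>)) (Xv \<beta>)) = complex_of_real s *s Xv \<beta>"
    using bracket_twice[OF na n'] unfolding neg_neg by blast
  have "\<beta> (Hv \<alpha>) *s Xv \<beta> = br (br (Xv \<alpha>) (Xv (- \<alpha>))) (Xv \<beta>)"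
    unfolding Hv_bracket(1)[OF a] by (rule br_Hv_Xv[OF a b, symmetric])
  also have "\<dots> = complex_of_real s *s Xv \<beta> - complex_of_real r *s Xv \<beta>"
    using jacobi[of "Xv \<alpha>" "Xv (- \<alpha>)" "Xv \<beta>"] unfolding r s by (metis add_diff_cancel_right')
  finally have "\<beta> (Hv \<alpha>) *s Xv \<beta> = complex_of_real (s - r) *s Xv \<beta>"
    by (simp only: of_real_diff vec.scale_left_diff_distrib)
  then have "\<beta> (Hv \<alpha>) = complex_of_real (s - r)"
    using Xv_nonzero[OF b] vec.scale_cancel_right by blast
  then show ?thesis by auto
qed

text \<open>If some other root is not orthogonal to \<open>\<alpha>\<close>, its value at \<open>H\<^sub>\<alpha>\<close> is real and a real multiple of
\<open>\<alpha>(H\<^sub>\<alpha>)\<close>. If there is none, \<open>X\<^sub>\<alpha>\<close>, \<open>X\<^sub>-\<^sub>\<alpha>\<close> and \<open>H\<^sub>\<alpha>\<close> span an ideal, hence everything, and \<open>c = \<alpha>(H\<^sub>\<alpha>)\<close> is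
computed from a trace: the operator \<open>ad X\<^sub>\<alpha> ad X\<^sub>-\<^sub>\<alpha> + ad X\<^sub>-\<^sub>\<alpha> ad X\<^sub>\<alpha>\<close> is \<open>2 c - (ad H\<^sub>\<alpha>)\<^sup>2 / c\<close>, and taking traces,
with \<open>(X\<^sub>\<alpha>, X\<^sub>-\<^sub>\<alpha>) = 1\<close> and \<open>(H\<^sub>\<alpha>, H\<^sub>\<alpha>) = c\<close>, gives \<open>2 = 2 c n - 1\<close> for the dimension \<open>n\<close>.\<close>

lemma real_root_length:
  assumes a: "\<alpha> \<in> roots D" shows "\<alpha> (Hv \<alpha>) \<in> \<real>"
proof (cases "\<exists>\<gamma>\<in>roots D. \<gamma> \<noteq> \<alpha> \<and> \<gamma> \<noteq> - \<alpha> \<and> \<gamma> (Hv \<alpha>) \<noteq> 0")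
  case True
  then obtain \<gamma> where g: "\<gamma> \<in> roots D" "\<gamma> \<noteq> \<alpha>" "\<gamma> \<noteq> - \<alpha>" "\<gamma> (Hv \<alpha>) \<noteq> 0" by blast
  obtain r :: real where r: "\<gamma> (Hv \<alpha>) = of_real r * \<alpha> (Hv \<alpha>)" using root_string[OF a g(1)] by blast
  then have "\<alpha> (Hv \<alpha>) = \<gamma> (Hv \<alpha>) / of_real r" using g(4) by auto
  then show ?thesis using real_root_value_generic[OF a g(1-3)] by simp
next
  case False
  define c where "c = \<alpha> (Hv \<alpha>)"
  have c0: "c \<noteq> 0" unfolding c_def by (rule root_length_nonzero[OF a])
  let ?X = "Xv \<alpha>" and ?Y = "Xv (- \<alpha>)" and ?H = "Hv \<alpha>"
  have na: "- \<alpha> \<in> roots D" by (rule neg_root[OF a])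
  have XY: "br ?X ?Y = ?H" by (rule Hv_bracket(1)[OF a])
  have YX: "br ?Y ?X = - ?H" using br_antisym[of ?Y ?X] by (simp only: XY)
  have HX: "br ?H ?X = c *s ?X" unfolding c_def by (rule br_Hv_Xv[OF a a])
  have XH: "br ?X ?H = - (c *s ?X)" using br_antisym[of ?X ?H] by (simp only: HX)
  have HY: "br ?H ?Y = - (c *s ?Y)" using br_Hv_Xv[OF a na] by (simp add: c_def)
  have YH: "br ?Y ?H = c *s ?Y" using br_antisym[of ?Y ?H] by (simp only: HY minus_minus)
  let ?S = "{?X, ?Y, ?H}"
  \<comment> \<open>the remaining roots vanish at \<open>H\<^sub>\<alpha>\<close>, so their sums with \<open>\<plusminus> \<alpha>\<close> do not, and only \<open>\<plusminus> \<alpha>\<close> have this property\<close>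
  have other: "br (Xv \<beta>) x = 0" if b: "\<beta> \<in> roots D" "\<beta> \<noteq> \<alpha>" "\<beta> \<noteq> - \<alpha>" and x: "x \<in> ?S" for \<beta> x
  proof -
    have b0: "\<beta> (Hv \<alpha>) = 0" using False b by blast
    have sum: "br (Xv \<beta>) (Xv \<delta>) = 0" if d: "\<delta> \<in> {\<alpha>, - \<alpha>}" for \<delta>
    proof -
      have dr: "\<delta> \<in> roots D" using d a na by auto
      have dn: "\<delta> \<noteq> - \<beta>" using d b(2,3) neg_neg[of \<alpha>] neg_neg[of \<beta>] by auto
      have "(\<lambda>H. \<beta> H + \<delta> H) \<notin> roots D"
      proof
        assume r: "(\<lambda>H. \<beta> H + \<delta> H) \<in> roots D"
        have v: "(\<lambda>H. \<beta> H + \<delta> H) (Hv \<alpha>) = \<delta> (Hv \<alpha>)" using b0 by simp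
        have d1: "\<delta> (Hv \<alpha>) = c \<or> \<delta> (Hv \<alpha>) = - c" using d by (auto simp: c_def)
        then have "(\<lambda>H. \<beta> H + \<delta> H) (Hv \<alpha>) \<noteq> 0" using v c0 by auto
        then have "(\<lambda>H. \<beta> H + \<delta> H) = \<alpha> \<or> (\<lambda>H. \<beta> H + \<delta> H) = - \<alpha>" using False r by blast
        then show False
        proof
          assume e: "(\<lambda>H. \<beta> H + \<delta> H) = \<alpha>"
          show False
          proof (cases "\<delta> = \<alpha>")
            case True
            then have "\<beta> = (\<lambda>x. 0)" using e by (auto simp: fun_eq_iff)
            then show False using root_nonzero[OF b(1)] by simp
          next
            case False
            then have "\<delta> = - \<alpha>" using d by simp
            then have "- c = c" using fun_cong[OF e, of "Hv \<alpha>"] b0 by (simp add: c_def)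
            then show False using c0 by simp
          qed
        next
          assume e: "(\<lambda>H. \<beta> H + \<delta> H) = - \<alpha>"
          show False
          proof (cases "\<delta> = - \<alpha>")
            case True
            then have "\<beta> = (\<lambda>x. 0)" using e by (auto simp: fun_eq_iff)
            then show False using root_nonzero[OF b(1)] by simp
          next
            case False
            then have "\<delta> = \<alpha>" using d by simp
            then have "c = - c" using fun_cong[OF e, of "Hv \<alpha>"] b0 by (simp add: c_def)
            then show False using c0 by simp
          qed
        qed
      qed
      then show ?thesis using br_Xv_Xv[OF b(1) dr dn] by simp
    qed
    have "br (Xv \<beta>) ?H = 0"
      using br_antisym[of "Xv \<beta>" ?H] br_Hv_Xv[OF a b(1)] b0 by simp
    then show ?thesis using x sum by auto
  qed
  have S: "vec.span ?S = UNIV"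
  proof (rule ideal_from_generators[of _ ?X])
    have b: "x \<in> ?S \<Longrightarrow> c *s x \<in> vec.span ?S" for c x by (intro vec.span_scale vec.span_base)
    fix x assume x: "x \<in> ?S"
    show "\<forall>H\<in>\<h>. br H x \<in> vec.span ?S"
    proof
      fix H assume H: "H \<in> \<h>"
      have e: "br H ?X = \<alpha> H *s ?X" "br H ?Y = (- \<alpha>) H *s ?Y" "br H ?H = 0"
        using Xv_in[OF a] Xv_in[OF na] H Hv_in[OF a] cartan_abelian unfolding root_space_def by auto
      have "br H ?X \<in> vec.span ?S" "br H ?Y \<in> vec.span ?S" "br H ?H \<in> vec.span ?S"
        unfolding e by (rule b, simp)+ (rule vec.span_zero)
      then show "br H x \<in> vec.span ?S" using x by blast
    qed
    fix \<beta> assume be: "\<beta> \<in> roots D"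
    consider "\<beta> = \<alpha>" | "\<beta> = - \<alpha>" | "\<beta> \<noteq> \<alpha>" "\<beta> \<noteq> - \<alpha>" by blast
    then show "br (Xv \<beta>) x \<in> vec.span ?S"
    proof cases
      case 1
      have "br ?X ?X \<in> vec.span ?S" "br ?X ?Y \<in> vec.span ?S" "br ?X ?H \<in> vec.span ?S"
        unfolding br_self XY XH by (auto intro: vec.span_zero vec.span_neg vec.span_scale vec.span_base)
      then show ?thesis using x 1 by blast
    next
      case 2
      have "br ?Y ?X \<in> vec.span ?S" "br ?Y ?Y \<in> vec.span ?S" "br ?Y ?H \<in> vec.span ?S"
        unfolding br_self YX YH by (auto intro: vec.span_zero vec.span_neg vec.span_scale vec.span_base)
      then show ?thesis using x 2 by blast
    next
      case 3
      then show ?thesis using other[OF be 3 x] vec.span_zero by simp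
    qed
  qed (use Xv_nonzero[OF a] in auto)
  \<comment> \<open>checked on the basis \<open>X\<^sub>\<alpha>\<close>, \<open>X\<^sub>-\<^sub>\<alpha>\<close>, \<open>H\<^sub>\<alpha>\<close>\<close>
  have id: "br ?X (br ?Y z) + br ?Y (br ?X z) = (2 * c) *s z - (1 / c) *s br ?H (br ?H z)" for z
  proof -
    let ?L = "\<lambda>z. br ?X (br ?Y z) + br ?Y (br ?X z) - (2 * c) *s z + (1 / c) *s br ?H (br ?H z)"
    have "z \<in> vec.span ?S" unfolding S by (rule UNIV_I)
    then have "?L z = 0"
    proof (induction rule: vec.span_induct_alt)
      case (step k x y)
      have "?L x = 0"
      proof -
        have X: "br ?X (br ?Y ?X) = c *s ?X" "br ?Y (br ?X ?X) = 0" "br ?H (br ?H ?X) = c *s (c *s ?X)"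
          unfolding YX HX br_self br_minus_right br_scale_right br_zero_right XH minus_minus by (rule refl)+
        have Y: "br ?X (br ?Y ?Y) = 0" "br ?Y (br ?X ?Y) = c *s ?Y" "br ?H (br ?H ?Y) = c *s (c *s ?Y)"
          unfolding XY HY br_self br_minus_right br_scale_right br_zero_right YH
          by (rule refl)+ (simp only: minus_minus vec.scale_minus_right)
        have H: "br ?X (br ?Y ?H) = c *s ?H" "br ?Y (br ?X ?H) = c *s ?H" "br ?H (br ?H ?H) = 0"
          unfolding YH XH br_self br_minus_right br_scale_right br_zero_right XY YX
          by (rule refl, simp only: minus_minus vec.scale_minus_right, rule refl)
        have "c *s v + 0 - (2 * c) *s v + (1 / c) *s (c *s (c *s v)) = 0"
          "0 + c *s v - (2 * c) *s v + (1 / c) *s (c *s (c *s v)) = 0"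
          "c *s v + c *s v - (2 * c) *s v + (1 / c) *s 0 = 0" for v :: "complex ^ 'n"
          using c0 by (simp_all add: vec_eq_iff)
        then have "?L ?X = 0" "?L ?Y = 0" "?L ?H = 0" unfolding X Y H by blast+
        then show ?thesis using step.hyps by blast
      qed
      moreover have "?L (k *s x + y) = k *s ?L x + ?L y"
        unfolding br_add_right br_scale_right by (simp add: vec_eq_iff algebra_simps)
      ultimately show ?case using step.IH by (simp only: vec.scale_zero_right add_0_right)
    qed (simp add: br_simps)
    moreover have "u - v + w = 0 \<Longrightarrow> u = v - w" for u v w :: "complex ^ 'n" by (simp add: algebra_simps add_eq_0_iff)
    ultimately show ?thesis by blast
  qed
  have "kil ?X ?Y + kil ?Y ?X = 2 * c * of_nat CARD('n) - (1 / c) * kil ?H ?H"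
  proof -
    have "kil ?X ?Y + kil ?Y ?X = (\<Sum>i\<in>UNIV. (br ?X (br ?Y (axis i 1)) + br ?Y (br ?X (axis i 1))) $ i)"
      by (simp add: kil_sum sum.distrib)
    also have "\<dots> = (\<Sum>i\<in>UNIV. 2 * c - (1 / c) * br ?H (br ?H (axis i 1)) $ i)"
      unfolding id by (simp add: axis_def)
    also have "\<dots> = 2 * c * of_nat CARD('n) - (1 / c) * kil ?H ?H"
      by (simp add: kil_sum sum_subtractf sum_distrib_left)
    finally show ?thesis .
  qed
  moreover have "kil ?X ?Y = 1" "kil ?Y ?X = 1" using kil_Xv[OF a] kil_sym[of ?X ?Y] by simp_all
  moreover have "kil ?H ?H = c" using kil_Hv[OF a Hv_in[OF a]] by (simp add: c_def)
  ultimately have "3 = 2 * c * of_nat CARD('n)" using c0 by simp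
  then have "c = of_real (3 / (2 * real CARD('n)))" by (simp add: field_simps)
  then show ?thesis unfolding c_def by (metis Reals_of_real)
qed

lemma real_root_value:
  assumes a: "\<alpha> \<in> roots D" and b: "\<beta> \<in> roots D" shows "\<beta> (Hv \<alpha>) \<in> \<real>"
proof -
  consider "\<beta> = \<alpha>" | "\<beta> = - \<alpha>" | "\<beta> \<noteq> \<alpha>" "\<beta> \<noteq> - \<alpha>" by blast
  then show ?thesis
    by cases (use real_root_length[OF a] real_root_value_generic[OF a b] in auto)
qed

section \<open>The compact real form and its reductive decomposition\<close>

abbreviation Av where "Av \<equiv> A_vec D"
abbreviation Sv where "Sv \<equiv> S_vec D"
abbreviation \<u> where "\<u> \<equiv> u_alg D"

lemma Av_neg: "Av (- \<alpha>) = - Av \<alpha>" and Sv_neg: "Sv (- \<alpha>) = Sv \<alpha>"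
  unfolding A_vec_def S_vec_def neg_neg by (auto simp: add.commute)

lemma subspace_u: "subspace \<u>"
  by (simp add: u_alg_def)

lemma u_generators:
  assumes "\<alpha> \<in> roots D" shows "\<i> *s Hv \<alpha> \<in> \<u>" "Av \<alpha> \<in> \<u>" "Sv \<alpha> \<in> \<u>"
  using assms by (auto simp: u_alg_def intro: span_base)

lemma u_scaled_Av_Sv:
  assumes "\<alpha> \<in> roots D \<or> r = 0"
  shows "complex_of_real r *s Av \<alpha> \<in> \<u>" "complex_of_real r *s Sv \<alpha> \<in> \<u>"
  using assms u_generators[of \<alpha>] subspace_u
  by (auto simp: scaleR_eq_smult[symmetric] subspace_scale subspace_0)

lemma br_in_rs: "x \<in> rs \<beta> \<Longrightarrow> H \<in> \<h> \<Longrightarrow> br H x = \<beta> H *s x"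
  by (simp add: root_space_def)

text \<open>The structure constants are real and change sign under \<open>(\<alpha>, \<beta>) \<mapsto> (-\<alpha>, -\<beta>)\<close>, so the four brackets of root
vectors combine to real multiples of vectors \<open>A\<close> and \<open>S\<close>.\<close>

lemma br_Av_Sv_generic:
  assumes a: "\<alpha> \<in> roots D" and b: "\<beta> \<in> roots D" and n: "\<beta> \<noteq> \<alpha>" "\<beta> \<noteq> - \<alpha>"
  shows "br (Av \<alpha>) (Av \<beta>) \<in> \<u>" "br (Av \<alpha>) (Sv \<beta>) \<in> \<u>" "br (Sv \<alpha>) (Sv \<beta>) \<in> \<u>"
proof -
  have na: "- \<alpha> \<in> roots D" and nb: "- \<beta> \<in> roots D" using a b neg_root by auto
  have n2: "\<beta> \<noteq> - (- \<alpha>)" "- \<beta> \<noteq> - \<alpha>" "- \<beta> \<noteq> - (- \<alpha>)" using n neg_neg[of \<alpha>] neg_neg[of \<beta>] by metis+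
  define p where "p = weylm D \<alpha> \<beta>"
  define m where "m = weylm D \<alpha> (- \<beta>)"
  define \<sigma> where "\<sigma> = (\<lambda>H. \<alpha> H + \<beta> H)"
  define \<delta> where "\<delta> = (\<lambda>H. \<alpha> H + (- \<beta>) H)"
  have s': "(\<lambda>H. (- \<alpha>) H + (- \<beta>) H) = - \<sigma>" and d': "(\<lambda>H. (- \<alpha>) H + \<beta> H) = - \<delta>"
    by (auto simp: \<sigma>_def \<delta>_def fun_eq_iff)
  have p': "weylm D (- \<alpha>) (- \<beta>) = - p" unfolding p_def by (rule weylm_neg[OF a b n(2)])
  have m': "weylm D (- \<alpha>) \<beta> = - m"
    using weylm_neg[OF a nb n2(2)] unfolding m_def neg_neg .
  have e: "br (Xv \<alpha>) (Xv \<beta>) = of_real p *s Xv \<sigma>" "br (Xv \<alpha>) (Xv (- \<beta>)) = of_real m *s Xv \<delta>"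
    "br (Xv (- \<alpha>)) (Xv (- \<beta>)) = - (of_real p *s Xv (- \<sigma>))" "br (Xv (- \<alpha>)) (Xv \<beta>) = - (of_real m *s Xv (- \<delta>))"
    using br_Xv_Xv(1)[OF a b n(2)] br_Xv_Xv(1)[OF a nb n2(2)] br_Xv_Xv(1)[OF na nb n2(3)] br_Xv_Xv(1)[OF na b n2(1)]
    unfolding s' d' p' m' p_def[symmetric] m_def[symmetric] \<sigma>_def[symmetric] \<delta>_def[symmetric]
    by (simp_all add: vec.scale_minus_left)
  have r: "\<sigma> \<in> roots D \<or> p = 0" "\<delta> \<in> roots D \<or> m = 0"
    using br_Xv_Xv(2)[OF a b n(2)] br_Xv_Xv(2)[OF a nb n2(2)] unfolding p_def m_def \<sigma>_def \<delta>_def by blast+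
  have "br (Av \<alpha>) (Av \<beta>) = of_real p *s Av \<sigma> - of_real m *s Av \<delta>"
    unfolding A_vec_def br_diff_left br_diff_right e by (simp add: vec_eq_iff algebra_simps)
  then show "br (Av \<alpha>) (Av \<beta>) \<in> \<u>" using u_scaled_Av_Sv(1)[OF r(1)] u_scaled_Av_Sv(1)[OF r(2)] subspace_u
    by (simp add: subspace_diff)
  have "br (Av \<alpha>) (Sv \<beta>) = of_real p *s Sv \<sigma> + of_real m *s Sv \<delta>"
    unfolding A_vec_def S_vec_def br_diff_left br_scale_right br_add_right e by (simp add: vec_eq_iff algebra_simps)
  then show "br (Av \<alpha>) (Sv \<beta>) \<in> \<u>" using u_scaled_Av_Sv(2)[OF r(1)] u_scaled_Av_Sv(2)[OF r(2)] subspace_u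
    by (simp add: subspace_add)
  have "br (Sv \<alpha>) (Sv \<beta>) = - (of_real p *s Av \<sigma>) - of_real m *s Av \<delta>"
    unfolding A_vec_def S_vec_def br_scale_left br_scale_right br_add_left br_add_right e
    by (simp add: vec_eq_iff algebra_simps)
  then show "br (Sv \<alpha>) (Sv \<beta>) \<in> \<u>" using u_scaled_Av_Sv(1)[OF r(1)] u_scaled_Av_Sv(1)[OF r(2)] subspace_u
    by (simp add: subspace_diff subspace_neg)
qed

lemma br_Av_Sv_same: assumes a: "\<alpha> \<in> roots D" shows "br (Av \<alpha>) (Sv \<alpha>) \<in> \<u>"
proof -
  have YX: "br (Xv (- \<alpha>)) (Xv \<alpha>) = - Hv \<alpha>"
    using br_antisym[of "Xv (- \<alpha>)" "Xv \<alpha>"] by (simp only: Hv_bracket(1)[OF a])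
  have "br (Av \<alpha>) (Sv \<alpha>) = 2 *\<^sub>R (\<i> *s Hv \<alpha>)"
    unfolding A_vec_def S_vec_def br_diff_left br_scale_right br_add_right br_self YX Hv_bracket(1)[OF a]
    by (simp add: vec_eq_iff scaleR_eq_smult)
  then show ?thesis using u_generators(1)[OF a] subspace_u by (simp add: subspace_scale)
qed

text \<open>Here the reality of \<open>\<beta>(H\<^sub>\<alpha>)\<close> enters.\<close>

lemma br_iH:
  assumes a: "\<alpha> \<in> roots D" and b: "\<beta> \<in> roots D"
  shows "br (\<i> *s Hv \<alpha>) (Av \<beta>) \<in> \<u>" "br (\<i> *s Hv \<alpha>) (Sv \<beta>) \<in> \<u>"
proof -
  obtain r :: real where r: "\<beta> (Hv \<alpha>) = of_real r" using real_root_value[OF a b] by (auto elim: Reals_cases)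
  have e: "br (Hv \<alpha>) (Xv \<beta>) = of_real r *s Xv \<beta>" "br (Hv \<alpha>) (Xv (- \<beta>)) = - (of_real r *s Xv (- \<beta>))"
    using br_Hv_Xv[OF a b] br_Hv_Xv[OF a neg_root[OF b]] r by (simp_all add: vec.scale_minus_left)
  have "br (\<i> *s Hv \<alpha>) (Av \<beta>) = r *\<^sub>R Sv \<beta>"
    unfolding A_vec_def S_vec_def br_scale_left br_diff_right e by (simp add: vec_eq_iff scaleR_eq_smult algebra_simps)
  then show "br (\<i> *s Hv \<alpha>) (Av \<beta>) \<in> \<u>" using u_generators(3)[OF b] subspace_u by (simp add: subspace_scale)
  have "br (\<i> *s Hv \<alpha>) (Sv \<beta>) = (- r) *\<^sub>R Av \<beta>"
    unfolding A_vec_def S_vec_def br_scale_left br_scale_right br_add_right e by (simp add: vec_eq_iff scaleR_eq_smult algebra_simps)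
  then show "br (\<i> *s Hv \<alpha>) (Sv \<beta>) \<in> \<u>" using u_generators(2)[OF b] subspace_u by (simp only: subspace_scale)
qed

lemma span_real_induct [consumes 1, case_names zero step]:
  assumes "x \<in> span S" "P 0" "\<And>c x y. x \<in> S \<Longrightarrow> P y \<Longrightarrow> P (c *\<^sub>R x + y)"
  shows "P (x :: complex ^ 'm)"
  using span_induct_alt[OF assms(1)] assms(2,3) by blast

lemma br_scaleR: "br (r *\<^sub>R x) y = r *\<^sub>R br x y" "br x (r *\<^sub>R y) = r *\<^sub>R br x y"
  by (simp_all add: scaleR_eq_smult br_simps)

lemma br_span_closed:
  assumes "\<And>x y. x \<in> S \<Longrightarrow> y \<in> T \<Longrightarrow> br x y \<in> W" "subspace W" "x \<in> span S" "y \<in> span T"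
  shows "br x y \<in> W"
  using assms(3)
proof (induction rule: span_real_induct)
  case (step c x z)
  have "br x y \<in> W"
    using assms(4)
  proof (induction rule: span_real_induct)
    case (step c u v)
    then show ?case using assms(1)[OF \<open>x \<in> S\<close>] assms(2)
      by (simp add: br_add_right br_scaleR subspace_add subspace_scale)
  qed (use assms(2) in \<open>simp add: br_simps subspace_0\<close>)
  then show ?case using step assms(2) by (simp add: br_add_left br_scaleR subspace_add subspace_scale)
qed (use assms(2) in \<open>simp add: br_simps subspace_0\<close>)

lemma u_closed:
  assumes "x \<in> \<u>" "y \<in> \<u>" shows "br x y \<in> \<u>"
proof (rule br_span_closed[OF _ subspace_u assms[unfolded u_alg_def]])
  let ?G = "(\<lambda>\<alpha>. \<i> *s Hv \<alpha>) ` roots D \<union> Av ` roots D \<union> Sv ` roots D"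
  fix x y assume x: "x \<in> ?G" and y: "y \<in> ?G"
  have sw: "br v w \<in> \<u> \<Longrightarrow> br w v \<in> \<u>" for v w
    using br_antisym[of w v] subspace_neg[OF subspace_u] by simp
  have AA: "br (Av \<alpha>) (Av \<beta>) \<in> \<u>" and AS: "br (Av \<alpha>) (Sv \<beta>) \<in> \<u>" and SS: "br (Sv \<alpha>) (Sv \<beta>) \<in> \<u>"
    if a: "\<alpha> \<in> roots D" and b: "\<beta> \<in> roots D" for \<alpha> \<beta>
  proof -
    consider "\<beta> = \<alpha>" | "\<beta> = - \<alpha>" | "\<beta> \<noteq> \<alpha>" "\<beta> \<noteq> - \<alpha>" by blast
    then have "br (Av \<alpha>) (Av \<beta>) \<in> \<u> \<and> br (Av \<alpha>) (Sv \<beta>) \<in> \<u> \<and> br (Sv \<alpha>) (Sv \<beta>) \<in> \<u>"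
    proof cases
      case 1
      then show ?thesis using br_Av_Sv_same[OF a] subspace_0[OF subspace_u] by (simp add: br_self)
    next
      case 2
      show ?thesis unfolding 2 Av_neg Sv_neg br_minus_right br_self
        using br_Av_Sv_same[OF a] subspace_0[OF subspace_u] by simp
    next
      case 3
      then show ?thesis using br_Av_Sv_generic[OF a b] by blast
    qed
    then show "br (Av \<alpha>) (Av \<beta>) \<in> \<u>" "br (Av \<alpha>) (Sv \<beta>) \<in> \<u>" "br (Sv \<alpha>) (Sv \<beta>) \<in> \<u>" by blast+
  qed
  have HH: "br (\<i> *s Hv \<alpha>) (\<i> *s Hv \<beta>) \<in> \<u>" if "\<alpha> \<in> roots D" "\<beta> \<in> roots D" for \<alpha> \<beta>
    using cartan_abelian[OF Hv_in[OF that(1)] Hv_in[OF that(2)]] subspace_0[OF subspace_u] by (simp add: br_simps)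
  from x y show "br x y \<in> \<u>"
    by (elim UnE imageE) (simp_all add: HH AA AS SS br_iH sw[OF AS] sw[OF br_iH(1)] sw[OF br_iH(2)])
qed

text \<open>\<open>H\<^sub>\<alpha> = - i (i H\<^sub>\<alpha>)\<close> and \<open>X\<^sub>\<alpha> = A\<^sub>\<alpha>/2 - i S\<^sub>\<alpha>/2\<close> span everything.\<close>

lemma u_complexification: "\<exists>a\<in>\<u>. \<exists>b\<in>\<u>. x = a + \<i> *s b"
proof -
  let ?Q = "{x. \<exists>a\<in>\<u>. \<exists>b\<in>\<u>. x = a + \<i> *s b}"
  have sub: "vec.subspace ?Q"
    unfolding vec.subspace_def
  proof (intro conjI ballI allI)
    have "0 = 0 + \<i> *s (0 :: complex ^ 'n)" by simp
    then show "0 \<in> ?Q" using subspace_0[OF subspace_u] by blast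
    fix x y assume "x \<in> ?Q" "y \<in> ?Q"
    then obtain a b a' b' where m: "a \<in> \<u>" "b \<in> \<u>" "a' \<in> \<u>" "b' \<in> \<u>" and "x = a + \<i> *s b" "y = a' + \<i> *s b'" by blast
    then have "x + y = (a + a') + \<i> *s (b + b')" by (simp add: vec.scale_right_distrib algebra_simps)
    then show "x + y \<in> ?Q" using m subspace_add[OF subspace_u] by blast
  next
    fix c x assume "x \<in> ?Q"
    then obtain a b where m: "a \<in> \<u>" "b \<in> \<u>" and x: "x = a + \<i> *s b" by blast
    have "c *s x = (Re c *\<^sub>R a - Im c *\<^sub>R b) + \<i> *s (Im c *\<^sub>R a + Re c *\<^sub>R b)"
      unfolding x scaleR_eq_smult
      by (subst complex_eq[of c]) (simp add: vec_eq_iff algebra_simps)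
    moreover have "Re c *\<^sub>R a - Im c *\<^sub>R b \<in> \<u>" "Im c *\<^sub>R a + Re c *\<^sub>R b \<in> \<u>"
      using m subspace_u by (simp_all add: subspace_add subspace_diff subspace_scale)
    ultimately show "c *s x \<in> ?Q" by blast
  qed
  have "Hv ` roots D \<union> Xv ` roots D \<subseteq> ?Q"
  proof safe
    fix \<alpha> assume a: "\<alpha> \<in> roots D"
    have "Hv \<alpha> = 0 + \<i> *s (- (\<i> *s Hv \<alpha>))" by (simp add: vec_eq_iff)
    then show "\<exists>a\<in>\<u>. \<exists>b\<in>\<u>. Hv \<alpha> = a + \<i> *s b"
      using u_generators(1)[OF a] subspace_u subspace_neg subspace_0 by blast
    have "Xv \<alpha> = (1/2) *\<^sub>R Av \<alpha> + \<i> *s (- ((1/2) *\<^sub>R Sv \<alpha>))"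
      by (simp add: vec_eq_iff A_vec_def S_vec_def scaleR_eq_smult algebra_simps)
    then show "\<exists>a\<in>\<u>. \<exists>b\<in>\<u>. Xv \<alpha> = a + \<i> *s b"
      using u_generators(2,3)[OF a] subspace_u subspace_neg subspace_scale by blast
  qed
  then have "vec.span (Hv ` roots D \<union> Xv ` roots D) \<subseteq> ?Q" by (rule vec.span_minimal[OF _ sub])
  then show ?thesis unfolding span_Hv_Xv by blast
qed

subsection \<open>Positive roots and the roots of the parabolic subalgebra\<close>

lemma finite_simples: "finite (simples D)"
  using simple_system finite_roots finite_subset by (auto simp: simple_system_def)

lemma simples_independent:
  fixes c :: "'n functional \<Rightarrow> real"
  assumes "\<And>H. (\<Sum>\<beta>\<in>simples D. of_real (c \<beta>) * \<beta> H) = 0" "\<beta> \<in> simples D"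
  shows "c \<beta> = 0"
  using simple_system assms by (auto simp: simple_system_def)

lemma simples_coefficients_unique:
  fixes c d :: "'n functional \<Rightarrow> real"
  assumes "\<And>H. (\<Sum>\<beta>\<in>simples D. of_real (c \<beta>) * \<beta> H) = (\<Sum>\<beta>\<in>simples D. of_real (d \<beta>) * \<beta> H)" "\<beta> \<in> simples D"
  shows "c \<beta> = d \<beta>"
proof -
  have "(\<Sum>\<beta>\<in>simples D. of_real (c \<beta> - d \<beta>) * \<beta> H) = 0" for H
    using assms(1)[of H] by (simp only: of_real_diff left_diff_distrib sum_subtractf right_minus_eq)
  from simples_independent[of "\<lambda>\<beta>. c \<beta> - d \<beta>", OF this assms(2)] show ?thesis by simp
qed

lemma integer_coefficients:
  assumes "\<alpha> \<in> roots D"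
  obtains c :: "'n functional \<Rightarrow> int" where "\<And>H. \<alpha> H = (\<Sum>\<beta>\<in>simples D. of_int (c \<beta>) * \<beta> H)"
    "(\<forall>\<beta>\<in>simples D. 0 \<le> c \<beta>) \<or> (\<forall>\<beta>\<in>simples D. c \<beta> \<le> 0)"
proof -
  have "\<exists>c :: 'n functional \<Rightarrow> int. (\<forall>H. \<alpha> H = (\<Sum>\<beta>\<in>simples D. of_int (c \<beta>) * \<beta> H)) \<and>
      ((\<forall>\<beta>\<in>simples D. 0 \<le> c \<beta>) \<or> (\<forall>\<beta>\<in>simples D. c \<beta> \<le> 0))"
    using simple_system unfolding simple_system_def by (elim conjE bspec[OF _ assms])
  then show ?thesis using that by (elim exE conjE) blast
qed

lemma pos_roots_subset: "pos_roots D \<subseteq> roots D"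
  by (auto simp: pos_roots_def)

lemma posI:
  assumes "\<alpha> \<in> roots D" "\<And>H. \<alpha> H = (\<Sum>\<beta>\<in>simples D. of_int (c \<beta>) * \<beta> H)" "\<And>\<beta>. \<beta> \<in> simples D \<Longrightarrow> 0 \<le> c \<beta>"
  shows "\<alpha> \<in> pos_roots D"
proof -
  have "\<alpha> H = (\<Sum>\<beta>\<in>simples D. of_nat (nat (c \<beta>)) * \<beta> H)" for H
    unfolding assms(2) by (rule sum.cong) (use assms(3) in auto)
  then show ?thesis unfolding pos_roots_def using assms(1) by (intro CollectI conjI exI[of _ "\<lambda>\<beta>. nat (c \<beta>)"]) auto
qed

lemma pos_or_neg: assumes "\<alpha> \<in> roots D" shows "\<alpha> \<in> pos_roots D \<or> - \<alpha> \<in> pos_roots D"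
proof -
  obtain c :: "'n functional \<Rightarrow> int" where c: "\<And>H. \<alpha> H = (\<Sum>\<beta>\<in>simples D. of_int (c \<beta>) * \<beta> H)"
    "(\<forall>\<beta>\<in>simples D. 0 \<le> c \<beta>) \<or> (\<forall>\<beta>\<in>simples D. c \<beta> \<le> 0)"
    using integer_coefficients[OF assms] by blast
  have "(- \<alpha>) H = (\<Sum>\<beta>\<in>simples D. of_int (- c \<beta>) * \<beta> H)" for H
    by (simp add: c(1) sum_negf)
  then show ?thesis using posI[OF assms c(1)] posI[OF neg_root[OF assms], of "\<lambda>\<beta>. - c \<beta>"] c(2) by fastforce
qed

lemma not_pos_and_neg: assumes "\<alpha> \<in> pos_roots D" shows "- \<alpha> \<notin> pos_roots D"
proof
  assume "- \<alpha> \<in> pos_roots D"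
  then obtain d :: "'n functional \<Rightarrow> nat" where d: "\<And>H. (- \<alpha>) H = (\<Sum>\<beta>\<in>simples D. of_nat (d \<beta>) * \<beta> H)"
    by (auto simp: pos_roots_def)
  obtain c :: "'n functional \<Rightarrow> nat" where c: "\<And>H. \<alpha> H = (\<Sum>\<beta>\<in>simples D. of_nat (c \<beta>) * \<beta> H)"
    using assms by (auto simp: pos_roots_def)
  have z: "(\<Sum>\<beta>\<in>simples D. of_real (real (c \<beta>) + real (d \<beta>)) * \<beta> H) = 0" for H
  proof -
    have "(\<Sum>\<beta>\<in>simples D. of_nat (c \<beta>) * \<beta> H) + (\<Sum>\<beta>\<in>simples D. of_nat (d \<beta>) * \<beta> H) = 0"
      unfolding c[of H, symmetric] d[of H, symmetric] by simp
    then show ?thesis by (simp add: distrib_right sum.distrib)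
  qed
  have "c \<beta> = 0" if "\<beta> \<in> simples D" for \<beta>
    using simples_independent[OF z that] by linarith
  then have "\<alpha> H = 0" for H using c[of H] by simp
  then show False using root_nonzero pos_roots_subset assms by blast
qed

lemma Theta_roots_subset: "Theta_roots D \<subseteq> roots D"
  by (auto simp: Theta_roots_def)

lemma Theta_roots_neg: assumes "\<alpha> \<in> Theta_roots D" shows "- \<alpha> \<in> Theta_roots D"
proof -
  obtain c :: "'n functional \<Rightarrow> real" where c: "\<alpha> \<in> roots D" "\<And>H. \<alpha> H = (\<Sum>\<beta>\<in>Theta D. of_real (c \<beta>) * \<beta> H)"
    using assms by (auto simp: Theta_roots_def)
  have "(- \<alpha>) H = (\<Sum>\<beta>\<in>Theta D. of_real (- c \<beta>) * \<beta> H)" for H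
    by (simp add: c(2) sum_negf)
  then show ?thesis unfolding Theta_roots_def using neg_root[OF c(1)]
    by (intro CollectI conjI exI[of _ "\<lambda>\<beta>. - c \<beta>"]) auto
qed

lemma Theta_roots_add:
  assumes "\<alpha> \<in> Theta_roots D" "\<beta> \<in> Theta_roots D" "(\<lambda>H. \<alpha> H + \<beta> H) \<in> roots D"
  shows "(\<lambda>H. \<alpha> H + \<beta> H) \<in> Theta_roots D"
proof -
  obtain c d :: "'n functional \<Rightarrow> real" where c: "\<And>H. \<alpha> H = (\<Sum>\<beta>\<in>Theta D. of_real (c \<beta>) * \<beta> H)"
    "\<And>H. \<beta> H = (\<Sum>\<beta>\<in>Theta D. of_real (d \<beta>) * \<beta> H)"
    using assms by (auto simp: Theta_roots_def)
  have "\<alpha> H + \<beta> H = (\<Sum>\<gamma>\<in>Theta D. of_real (c \<gamma> + d \<gamma>) * \<gamma> H)" for H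
    by (simp add: c distrib_right sum.distrib)
  then show ?thesis unfolding Theta_roots_def using assms(3)
    by (intro CollectI conjI exI[of _ "\<lambda>\<gamma>. c \<gamma> + d \<gamma>"]) auto
qed

text \<open>The root \<open>\<alpha>\<close> involves a simple root outside \<open>\<Theta>\<close> with positive coefficient. Adding \<open>\<beta>\<close> does not change
this coefficient, and one positive coefficient makes a root positive.\<close>

lemma compl_add_Theta:
  assumes a: "\<alpha> \<in> compl_roots D" and b: "\<beta> \<in> Theta_roots D" and r: "(\<lambda>H. \<alpha> H + \<beta> H) \<in> roots D"
  shows "(\<lambda>H. \<alpha> H + \<beta> H) \<in> pos_roots D"
proof -
  obtain c :: "'n functional \<Rightarrow> nat" where c: "\<And>H. \<alpha> H = (\<Sum>\<beta>\<in>simples D. of_nat (c \<beta>) * \<beta> H)"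
    using a by (auto simp: compl_roots_def pos_roots_def)
  obtain d :: "'n functional \<Rightarrow> real" where d: "\<And>H. \<beta> H = (\<Sum>\<beta>\<in>Theta D. of_real (d \<beta>) * \<beta> H)"
    using b by (auto simp: Theta_roots_def)
  define d' where "d' \<gamma> = (if \<gamma> \<in> Theta D then d \<gamma> else 0)" for \<gamma>
  have d': "\<beta> H = (\<Sum>\<gamma>\<in>simples D. of_real (d' \<gamma>) * \<gamma> H)" for H
    unfolding d by (rule sum.mono_neutral_cong_left) (use finite_simples Theta_subset in \<open>auto simp: d'_def\<close>)
  \<comment> \<open>otherwise \<open>\<alpha>\<close> would be spanned by \<open>\<Theta>\<close>\<close>
  have "\<exists>\<delta>\<in>simples D. \<delta> \<notin> Theta D \<and> c \<delta> \<noteq> 0"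
  proof (rule ccontr)
    assume "\<not> ?thesis"
    then have z: "c \<gamma> = 0" if "\<gamma> \<in> simples D" "\<gamma> \<notin> Theta D" for \<gamma> using that by blast
    have "\<alpha> H = (\<Sum>\<gamma>\<in>Theta D. of_real (real (c \<gamma>)) * \<gamma> H)" for H
      unfolding c by (rule sum.mono_neutral_cong_right) (use finite_simples Theta_subset z in auto)
    then have "\<alpha> \<in> Theta_roots D" unfolding Theta_roots_def using a pos_roots_subset
      by (intro CollectI conjI exI[of _ "\<lambda>\<gamma>. real (c \<gamma>)"]) (auto simp: compl_roots_def)
    then show False using a by (simp add: compl_roots_def)
  qed
  then obtain \<delta> where \<delta>: "\<delta> \<in> simples D" "\<delta> \<notin> Theta D" "c \<delta> \<noteq> 0" by blast
  obtain e :: "'n functional \<Rightarrow> int" where e: "\<And>H. \<alpha> H + \<beta> H = (\<Sum>\<beta>\<in>simples D. of_int (e \<beta>) * \<beta> H)"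
    "(\<forall>\<beta>\<in>simples D. 0 \<le> e \<beta>) \<or> (\<forall>\<beta>\<in>simples D. e \<beta> \<le> 0)"
    using integer_coefficients[OF r] by blast
  have "real_of_int (e \<delta>) = real (c \<delta>) + d' \<delta>"
  proof (rule simples_coefficients_unique[OF _ \<delta>(1)])
    fix H show "(\<Sum>\<beta>\<in>simples D. of_real (real_of_int (e \<beta>)) * \<beta> H) = (\<Sum>\<beta>\<in>simples D. of_real (real (c \<beta>) + d' \<beta>) * \<beta> H)"
      using e(1)[of H] c[of H] d'[of H] by (simp add: distrib_right sum.distrib)
  qed
  then have "e \<delta> > 0" using \<delta> by (simp add: d'_def)
  then have "\<forall>\<beta>\<in>simples D. 0 \<le> e \<beta>" using e(2) \<delta>(1) by force
  then show ?thesis using posI[OF r e(1)] by blast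
qed

lemma compl_subset: "compl_roots D \<subseteq> roots D" and finite_compl: "finite (compl_roots D)"
  using pos_roots_subset finite_roots finite_subset by (auto simp: compl_roots_def)

lemma compl_not_neg: "\<alpha> \<in> compl_roots D \<Longrightarrow> - \<alpha> \<notin> compl_roots D"
  using not_pos_and_neg by (auto simp: compl_roots_def)

lemma compl_not_Theta: "\<alpha> \<in> compl_roots D \<Longrightarrow> \<alpha> \<notin> Theta_roots D \<and> - \<alpha> \<notin> Theta_roots D"
  using Theta_roots_neg[of "- \<alpha>"] unfolding neg_neg by (auto simp: compl_roots_def)

lemma root_trichotomy:
  assumes "\<alpha> \<in> roots D" shows "\<alpha> \<in> Theta_roots D \<or> \<alpha> \<in> compl_roots D \<or> - \<alpha> \<in> compl_roots D"
  using pos_or_neg[OF assms] Theta_roots_neg[of "- \<alpha>"] unfolding neg_neg by (auto simp: compl_roots_def)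

subsection \<open>Coordinates on the tangent space\<close>

abbreviation \<m> where "\<m> \<equiv> m_Theta D"
abbreviation compl where "compl \<equiv> compl_roots D"

text \<open>The coordinates along \<open>A\<^sub>\<alpha>\<close> and \<open>S\<^sub>\<alpha>\<close>, which are orthogonal vectors with \<open>(A\<^sub>\<alpha>,A\<^sub>\<alpha>) = (S\<^sub>\<alpha>,S\<^sub>\<alpha>) = -2\<close>.\<close>

definition coord_A where "coord_A \<alpha> Y = - Re (kil (Av \<alpha>) Y) / 2"
definition coord_S where "coord_S \<alpha> Y = - Re (kil (Sv \<alpha>) Y) / 2"

text \<open>The orthogonal projection to \<open>\<m>\<close>, given by an explicit formula on the whole Lie algebra. On \<open>\<u>\<close> it
agrees with \<open>proj_m\<close>, see \<open>proj_m_eq_m_part\<close> below.\<close>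

definition m_part where "m_part Y = (\<Sum>\<alpha>\<in>compl. coord_A \<alpha> Y *\<^sub>R Av \<alpha> + coord_S \<alpha> Y *\<^sub>R Sv \<alpha>)"

text \<open>The complement of \<open>\<m>\<close> in \<open>\<u>\<close>. It is contained in the Lie algebra of \<open>K\<close>.\<close>

definition levi where
  "levi = span ((\<lambda>\<alpha>. \<i> *s Hv \<alpha>) ` roots D \<union> Av ` Theta_roots D \<union> Sv ` Theta_roots D)"

lemma neg_eq_iff: "- \<beta> = - \<alpha> \<longleftrightarrow> \<beta> = (\<alpha> :: 'n functional)" "- \<beta> = \<alpha> \<longleftrightarrow> \<beta> = - \<alpha>" "\<alpha> = - \<beta> \<longleftrightarrow> \<beta> = - \<alpha>"
  using neg_neg[of \<alpha>] neg_neg[of \<beta>] by metis+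

lemma kil_Av_Sv:
  assumes a: "\<alpha> \<in> roots D" and b: "\<beta> \<in> roots D"
  shows "kil (Av \<alpha>) (Av \<beta>) = (if \<beta> = \<alpha> then - 2 else if \<beta> = - \<alpha> then 2 else 0)"
    and "kil (Av \<alpha>) (Sv \<beta>) = 0" and "kil (Sv \<alpha>) (Av \<beta>) = 0"
    and "kil (Sv \<alpha>) (Sv \<beta>) = (if \<beta> = \<alpha> then - 2 else if \<beta> = - \<alpha> then - 2 else 0)"
proof -
  have k: "kil (Xv \<alpha>) (Xv \<beta>) = (if \<beta> = - \<alpha> then 1 else 0)" "kil (Xv \<alpha>) (Xv (- \<beta>)) = (if \<beta> = \<alpha> then 1 else 0)"
    "kil (Xv (- \<alpha>)) (Xv \<beta>) = (if \<beta> = \<alpha> then 1 else 0)" "kil (Xv (- \<alpha>)) (Xv (- \<beta>)) = (if \<beta> = - \<alpha> then 1 else 0)"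
    using kil_Xv_Xv[OF a b] kil_Xv_Xv[OF a neg_root[OF b]] kil_Xv_Xv[OF neg_root[OF a] b]
      kil_Xv_Xv[OF neg_root[OF a] neg_root[OF b]] unfolding neg_eq_iff neg_neg by simp_all
  have n: "\<alpha> \<noteq> - \<alpha>" by (rule root_neq_neg[OF a])
  show "kil (Av \<alpha>) (Av \<beta>) = (if \<beta> = \<alpha> then - 2 else if \<beta> = - \<alpha> then 2 else 0)"
    unfolding A_vec_def kil_diff k using n by auto
  show "kil (Av \<alpha>) (Sv \<beta>) = 0" unfolding A_vec_def S_vec_def kil_diff kil_add_right kil_scale_right k by auto
  show "kil (Sv \<alpha>) (Av \<beta>) = 0" unfolding A_vec_def S_vec_def kil_diff kil_add_left kil_scale_left k by auto
  show "kil (Sv \<alpha>) (Sv \<beta>) = (if \<beta> = \<alpha> then - 2 else if \<beta> = - \<alpha> then - 2 else 0)"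
    unfolding S_vec_def kil_add_left kil_scale_left kil_add_right kil_scale_right k using n by auto
qed

lemma kil_Av_Sv_cartan:
  assumes a: "\<alpha> \<in> roots D" and H: "H \<in> \<h>"
  shows "kil (Av \<alpha>) H = 0" "kil (Sv \<alpha>) H = 0"
  using kil_orthogonal_cartan[OF a Xv_in[OF a] H] kil_orthogonal_cartan[OF neg_root[OF a] Xv_in[OF neg_root[OF a]] H]
  unfolding A_vec_def S_vec_def kil_diff kil_scale_left kil_add_left by simp_all

lemma coord_A_linear: "linear (coord_A \<alpha>)" and coord_S_linear: "linear (coord_S \<alpha>)"
  unfolding coord_A_def coord_S_def by (auto intro!: linearI simp: kil_simps field_simps)

lemma m_part_linear: "linear m_part"
  unfolding m_part_def
  by (intro linear_compose_sum ballI linear_compose_add linearI)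
    (simp_all add: linear_add[OF coord_A_linear] linear_add[OF coord_S_linear] linear_cmul[OF coord_A_linear] linear_cmul[OF coord_S_linear] scaleR_add_left)

lemma coord_A_generators:
  assumes "\<alpha> \<in> compl" "\<beta> \<in> compl"
  shows "coord_A \<alpha> (Av \<beta>) = (if \<beta> = \<alpha> then 1 else 0)" "coord_A \<alpha> (Sv \<beta>) = 0" "coord_S \<alpha> (Av \<beta>) = 0" "coord_S \<alpha> (Sv \<beta>) = (if \<beta> = \<alpha> then 1 else 0)"
proof -
  have a: "\<alpha> \<in> roots D" and b: "\<beta> \<in> roots D" using assms compl_subset by auto
  have n: "\<beta> \<noteq> - \<alpha>" using compl_not_neg[OF assms(1)] assms(2) by auto
  show "coord_A \<alpha> (Av \<beta>) = (if \<beta> = \<alpha> then 1 else 0)" "coord_A \<alpha> (Sv \<beta>) = 0" "coord_S \<alpha> (Av \<beta>) = 0" "coord_S \<alpha> (Sv \<beta>) = (if \<beta> = \<alpha> then 1 else 0)"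
    unfolding coord_A_def coord_S_def kil_Av_Sv[OF a b] using n by auto
qed

lemma coord_A_sum:
  assumes "\<beta> \<in> compl" "I \<subseteq> compl"
  shows "coord_A \<beta> (\<Sum>\<alpha>\<in>I. f \<alpha> *\<^sub>R Av \<alpha> + g \<alpha> *\<^sub>R Sv \<alpha>) = (if \<beta> \<in> I then f \<beta> else 0)"
    "coord_S \<beta> (\<Sum>\<alpha>\<in>I. f \<alpha> *\<^sub>R Av \<alpha> + g \<alpha> *\<^sub>R Sv \<alpha>) = (if \<beta> \<in> I then g \<beta> else 0)"
proof -
  have fin: "finite I" using assms finite_compl finite_subset by blast
  have "coord_A \<beta> (\<Sum>\<alpha>\<in>I. f \<alpha> *\<^sub>R Av \<alpha> + g \<alpha> *\<^sub>R Sv \<alpha>) = (\<Sum>\<alpha>\<in>I. if \<alpha> = \<beta> then f \<alpha> else 0)"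
    unfolding linear_sum[OF coord_A_linear] linear_add[OF coord_A_linear] linear_cmul[OF coord_A_linear]
    by (rule sum.cong) (use assms in \<open>auto simp: coord_A_generators subset_iff\<close>)
  then show "coord_A \<beta> (\<Sum>\<alpha>\<in>I. f \<alpha> *\<^sub>R Av \<alpha> + g \<alpha> *\<^sub>R Sv \<alpha>) = (if \<beta> \<in> I then f \<beta> else 0)"
    using fin by simp
  have "coord_S \<beta> (\<Sum>\<alpha>\<in>I. f \<alpha> *\<^sub>R Av \<alpha> + g \<alpha> *\<^sub>R Sv \<alpha>) = (\<Sum>\<alpha>\<in>I. if \<alpha> = \<beta> then g \<alpha> else 0)"
    unfolding linear_sum[OF coord_S_linear] linear_add[OF coord_S_linear] linear_cmul[OF coord_S_linear]
    by (rule sum.cong) (use assms in \<open>auto simp: coord_A_generators subset_iff\<close>)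
  then show "coord_S \<beta> (\<Sum>\<alpha>\<in>I. f \<alpha> *\<^sub>R Av \<alpha> + g \<alpha> *\<^sub>R Sv \<alpha>) = (if \<beta> \<in> I then g \<beta> else 0)"
    using fin by simp
qed

lemma m_of_subspace: "subspace (m_of D \<sigma>)" by (simp add: m_of_def)

lemma m_of_generators: "\<alpha> \<in> \<sigma> \<Longrightarrow> Av \<alpha> \<in> m_of D \<sigma>" "\<alpha> \<in> \<sigma> \<Longrightarrow> Sv \<alpha> \<in> m_of D \<sigma>"
  by (auto simp: m_of_def intro: span_base)

lemma m_of_mono: "\<sigma> \<subseteq> \<tau> \<Longrightarrow> m_of D \<sigma> \<subseteq> m_of D \<tau>"
  unfolding m_of_def by (intro span_mono) auto

lemma m_of_sum: "(\<Sum>\<alpha>\<in>\<sigma>. f \<alpha> *\<^sub>R Av \<alpha> + g \<alpha> *\<^sub>R Sv \<alpha>) \<in> m_of D \<sigma>"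
  by (intro subspace_sum[OF m_of_subspace] subspace_add[OF m_of_subspace] subspace_scale[OF m_of_subspace] m_of_generators)

lemma m_subspace: "subspace \<m>" by (simp add: m_Theta_def m_of_subspace)

lemma m_part_in: "m_part Y \<in> \<m>"
  unfolding m_Theta_def m_part_def by (rule m_of_sum)

lemma m_of_representation:
  assumes "\<sigma> \<subseteq> compl" "Y \<in> m_of D \<sigma>"
  shows "Y = (\<Sum>\<alpha>\<in>\<sigma>. coord_A \<alpha> Y *\<^sub>R Av \<alpha> + coord_S \<alpha> Y *\<^sub>R Sv \<alpha>)"
  using assms(2) unfolding m_of_def
proof (induction rule: span_real_induct)
  case zero
  then show ?case by (simp add: linear_0[OF coord_A_linear] linear_0[OF coord_S_linear])
next
  case (step c x y)
  have fin: "finite \<sigma>" using assms(1) finite_compl finite_subset by blast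
  let ?R = "\<lambda>Y. (\<Sum>\<alpha>\<in>\<sigma>. coord_A \<alpha> Y *\<^sub>R Av \<alpha> + coord_S \<alpha> Y *\<^sub>R Sv \<alpha>)"
  have x: "?R x = x"
  proof -
    from step.hyps obtain \<beta> where b: "\<beta> \<in> \<sigma>" and x: "x = Av \<beta> \<or> x = Sv \<beta>" by auto
    have A: "?R (Av \<beta>) = (\<Sum>\<alpha>\<in>\<sigma>. if \<alpha> = \<beta> then Av \<alpha> else 0)"
      by (rule sum.cong) (use assms(1) b in \<open>auto simp: coord_A_generators subset_iff\<close>)
    have S: "?R (Sv \<beta>) = (\<Sum>\<alpha>\<in>\<sigma>. if \<alpha> = \<beta> then Sv \<alpha> else 0)"
      by (rule sum.cong) (use assms(1) b in \<open>auto simp: coord_A_generators subset_iff\<close>)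
    have A': "?R (Av \<beta>) = Av \<beta>" unfolding A using fin b by simp
    have S': "?R (Sv \<beta>) = Sv \<beta>" unfolding S using fin b by simp
    show ?thesis using x A' S' by (elim disjE) (simp_all only:)
  qed
  have "?R (c *\<^sub>R x + y) = c *\<^sub>R ?R x + ?R y"
    by (simp add: linear_add[OF coord_A_linear] linear_add[OF coord_S_linear] linear_cmul[OF coord_A_linear] linear_cmul[OF coord_S_linear]
        scaleR_add_left scaleR_sum_right sum.distrib scaleR_add_right add_ac)
  then show ?case using x step.IH by simp
qed

lemma m_part_id: "Y \<in> \<m> \<Longrightarrow> m_part Y = Y"
  using m_of_representation[of compl Y] unfolding m_Theta_def m_part_def by simp

lemma m_subset_u: "\<m> \<subseteq> \<u>"
  unfolding m_Theta_def m_of_def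
  by (rule span_minimal) (use u_generators compl_subset subspace_u in auto)

lemma levi_subspace: "subspace levi" by (simp add: levi_def)

lemma levi_subset_u: "levi \<subseteq> \<u>"
  unfolding levi_def
  by (rule span_minimal) (use u_generators Theta_roots_subset subspace_u in auto)

lemma u_decomposition:
  assumes "Y \<in> \<u>" shows "Y - m_part Y \<in> levi"
  using assms unfolding u_alg_def
proof (induction rule: span_real_induct)
  case zero
  then show ?case by (simp add: linear_0[OF m_part_linear] subspace_0[OF levi_subspace])
next
  case (step c x y)
  have z: "m_part z = 0" if "\<And>\<alpha>. \<alpha> \<in> compl \<Longrightarrow> kil (Av \<alpha>) z = 0 \<and> kil (Sv \<alpha>) z = 0" for z
    unfolding m_part_def using that by (intro sum.neutral) (simp add: coord_A_def coord_S_def)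
  have root: "Av \<beta> - m_part (Av \<beta>) \<in> levi \<and> Sv \<beta> - m_part (Sv \<beta>) \<in> levi" if b: "\<beta> \<in> roots D" for \<beta>
  proof -
    consider "\<beta> \<in> Theta_roots D" | "\<beta> \<in> compl" | "- \<beta> \<in> compl" using root_trichotomy[OF b] by blast
    then show ?thesis
    proof cases
      case 1
      have "kil (Av \<alpha>) (Av \<beta>) = 0 \<and> kil (Sv \<alpha>) (Av \<beta>) = 0 \<and> kil (Av \<alpha>) (Sv \<beta>) = 0 \<and> kil (Sv \<alpha>) (Sv \<beta>) = 0" if "\<alpha> \<in> compl" for \<alpha>
      proof -
        have "\<beta> \<noteq> \<alpha>" "\<beta> \<noteq> - \<alpha>" using compl_not_Theta[OF that] 1 by auto
        then show ?thesis using kil_Av_Sv[OF _ b, of \<alpha>] that compl_subset by auto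
      qed
      then have "m_part (Av \<beta>) = 0" "m_part (Sv \<beta>) = 0" using z by blast+
      then show ?thesis using 1 by (auto simp: levi_def intro: span_base)
    next
      case 2
      have "m_part (Av \<beta>) = Av \<beta>" "m_part (Sv \<beta>) = Sv \<beta>" using 2 m_of_generators[of \<beta> compl] by (auto simp: m_Theta_def intro: m_part_id)
      then show ?thesis by (simp add: subspace_0[OF levi_subspace])
    next
      case 3
      have "Av (- \<beta>) \<in> \<m>" "Sv (- \<beta>) \<in> \<m>" using 3 m_of_generators[of "- \<beta>" compl] by (auto simp: m_Theta_def)
      then have "Av \<beta> \<in> \<m>" "Sv \<beta> \<in> \<m>" unfolding Av_neg Sv_neg using subspace_neg[OF m_subspace, of "- Av \<beta>"] by simp_all
      then show ?thesis by (simp add: m_part_id subspace_0[OF levi_subspace])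
    qed
  qed
  have iH: "\<i> *s Hv \<beta> - m_part (\<i> *s Hv \<beta>) \<in> levi" if b: "\<beta> \<in> roots D" for \<beta>
  proof -
    have "m_part (\<i> *s Hv \<beta>) = 0"
      using z[of "\<i> *s Hv \<beta>"] kil_Av_Sv_cartan[OF _ Hv_in[OF b]] compl_subset by (auto simp: kil_scale_right)
    then show ?thesis using b by (auto simp: levi_def intro: span_base)
  qed
  have "x - m_part x \<in> levi" using step.hyps root iH by blast
  moreover have e: "c *\<^sub>R x + y - m_part (c *\<^sub>R x + y) = c *\<^sub>R (x - m_part x) + (y - m_part y)"
    by (simp add: linear_add[OF m_part_linear] linear_cmul[OF m_part_linear] scaleR_diff_right)
  ultimately show ?case using step.IH unfolding e
    by (intro subspace_add[OF levi_subspace] subspace_scale[OF levi_subspace])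
qed

subsection \<open>The Levi part preserves the parabolic subalgebra\<close>

abbreviation \<p> where "\<p> \<equiv> p_Theta D"

lemma p_subspace: "vec.subspace \<p>" by (simp add: p_Theta_def)

lemma p_real_subspace: "subspace \<p>"
  using p_subspace by (auto simp: subspace_def vec.subspace_def scaleR_eq_smult)

lemma p_generators:
  "x \<in> \<h> \<Longrightarrow> x \<in> \<p>" "\<alpha> \<in> Theta_roots D \<Longrightarrow> x \<in> rs \<alpha> \<Longrightarrow> x \<in> \<p>" "\<alpha> \<in> pos_roots D \<Longrightarrow> x \<in> rs \<alpha> \<Longrightarrow> x \<in> \<p>"
proof -
  show 1: "x \<in> \<h> \<Longrightarrow> x \<in> \<p>" by (auto simp: p_Theta_def intro: vec.span_base)
  show 3: "x \<in> rs \<alpha> \<Longrightarrow> x \<in> \<p>" if "\<alpha> \<in> pos_roots D" using that by (auto simp: p_Theta_def intro: vec.span_base)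
  show "x \<in> rs \<alpha> \<Longrightarrow> x \<in> \<p>" if "\<alpha> \<in> Theta_roots D"
    using pos_or_neg[of \<alpha>] that Theta_roots_subset 3
    by (auto simp: p_Theta_def intro!: vec.span_base)
qed

lemma p_induct:
  assumes "vec.subspace {x. Q x}" "\<And>x. x \<in> \<h> \<Longrightarrow> Q x"
    "\<And>\<alpha> x. \<alpha> \<in> Theta_roots D \<union> pos_roots D \<Longrightarrow> x \<in> rs \<alpha> \<Longrightarrow> Q x" "x \<in> \<p>"
  shows "Q x"
proof -
  have "\<p> \<subseteq> {x. Q x}"
    unfolding p_Theta_def by (rule vec.span_minimal) (use assms in auto)
  then show ?thesis using assms(4) by auto
qed

text \<open>A sum of a root in \<open>\<langle>\<Theta>\<rangle>\<close> and a root of \<open>\<p>\<close> is 0, no root, or a root of \<open>\<p>\<close> again, by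
\<open>compl_add_Theta\<close>.\<close>

lemma Theta_root_vector_preserves_p:
  assumes b: "\<beta> \<in> Theta_roots D" and x: "x \<in> \<p>"
  shows "br (Xv \<beta>) x \<in> \<p>"
proof (rule p_induct[OF _ _ _ x, of "\<lambda>x. br (Xv \<beta>) x \<in> \<p>"])
  have br: "\<beta> \<in> roots D" using b Theta_roots_subset by auto
  show "vec.subspace {x. br (Xv \<beta>) x \<in> \<p>}"
    using p_subspace by (auto simp: vec.subspace_def br_simps)
  fix x assume "x \<in> \<h>"
  then have "br (Xv \<beta>) x = - (\<beta> x *s Xv \<beta>)" using br_antisym[of "Xv \<beta>" x] br_in_rs[OF Xv_in[OF br]] by simp
  moreover have "Xv \<beta> \<in> \<p>" by (rule p_generators(2)[OF b Xv_in[OF br]])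
  ultimately show "br (Xv \<beta>) x \<in> \<p>" by (simp only: vec.subspace_neg[OF p_subspace] vec.subspace_scale[OF p_subspace])
next
  have br: "\<beta> \<in> roots D" using b Theta_roots_subset by auto
  fix \<alpha> x assume a: "\<alpha> \<in> Theta_roots D \<union> pos_roots D" and x: "x \<in> rs \<alpha>"
  have ar: "\<alpha> \<in> roots D" using a Theta_roots_subset pos_roots_subset by auto
  let ?s = "\<lambda>H. \<alpha> H + \<beta> H"
  have e: "(\<lambda>H. \<beta> H + \<alpha> H) = ?s" by (auto simp: add.commute)
  have B: "br (Xv \<beta>) x \<in> rs ?s" using rs_bracket[OF Xv_in[OF br] x] unfolding e .
  show "br (Xv \<beta>) x \<in> \<p>"
  proof (cases "?s \<in> roots D")
    case True
    show ?thesis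
    proof (cases "\<alpha> \<in> Theta_roots D")
      case t: True
      show ?thesis by (rule p_generators(2)[OF Theta_roots_add[OF t b True] B])
    next
      case False
      then have "\<alpha> \<in> compl" using a by (simp add: compl_roots_def)
      then show ?thesis by (rule p_generators(3)[OF compl_add_Theta[OF _ b True] B])
    qed
  next
    case False
    show ?thesis
    proof (cases "?s = (\<lambda>x. 0)")
      case True
      show ?thesis using p_generators(1) B unfolding True rs_zero by blast
    next
      case n: False
      have "rs ?s = {0}"
        by (rule rs_eq_zero_or_root[OF _ False n]) (simp add: root_outside[OF ar] root_outside[OF br])
      then show ?thesis using B vec.subspace_0[OF p_subspace] by auto
    qed
  qed
qed

lemma cartan_preserves_p:
  assumes H: "H \<in> \<h>" and x: "x \<in> \<p>" shows "br H x \<in> \<p>"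
proof (rule p_induct[OF _ _ _ x, of "\<lambda>x. br H x \<in> \<p>"])
  show "vec.subspace {x. br H x \<in> \<p>}" using p_subspace by (auto simp: vec.subspace_def br_simps)
  show "br H x \<in> \<p>" if "x \<in> \<h>" for x using cartan_abelian[OF H that] vec.subspace_0[OF p_subspace] by simp
  fix \<alpha> x assume a: "\<alpha> \<in> Theta_roots D \<union> pos_roots D" and x: "x \<in> rs \<alpha>"
  then have "x \<in> \<p>" using p_generators by blast
  then show "br H x \<in> \<p>" unfolding br_in_rs[OF x H] by (rule vec.subspace_scale[OF p_subspace])
qed

lemma levi_preserves_p:
  assumes "Y \<in> levi" "x \<in> \<p>" shows "br Y x \<in> \<p>"
  using assms(1) unfolding levi_def
proof (induction rule: span_real_induct)
  case zero
  then show ?case by (simp add: br_simps vec.subspace_0[OF p_subspace])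
next
  case (step c y z)
  have T: "br (Av \<beta>) x \<in> \<p>" "br (Sv \<beta>) x \<in> \<p>" if b: "\<beta> \<in> Theta_roots D" for \<beta>
    using Theta_root_vector_preserves_p[OF b assms(2)] Theta_root_vector_preserves_p[OF Theta_roots_neg[OF b] assms(2)]
    unfolding A_vec_def S_vec_def br_diff_left br_scale_left br_add_left
    by (simp_all only: vec.subspace_diff[OF p_subspace] vec.subspace_scale[OF p_subspace] vec.subspace_add[OF p_subspace])
  have H: "br (\<i> *s Hv \<beta>) x \<in> \<p>" if b: "\<beta> \<in> roots D" for \<beta>
    unfolding br_scale_left by (rule vec.subspace_scale[OF p_subspace cartan_preserves_p[OF Hv_in[OF b] assms(2)]])
  have "br y x \<in> \<p>" using step.hyps T H by blast
  then show ?case using step.IH unfolding br_add_left br_scaleR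
    by (intro subspace_add[OF p_real_subspace] subspace_scale[OF p_real_subspace])
qed

subsection \<open>The Killing-orthogonal projection to the complexified tangent space\<close>

text \<open>The roots occurring in the complexification \<open>mC\<close> of \<open>\<m>\<close>.\<close>

definition m_roots where "m_roots = {\<alpha> \<in> roots D. \<alpha> \<in> compl \<or> - \<alpha> \<in> compl}"
definition mC where "mC = vec.span (Xv ` m_roots)"

text \<open>The projection to \<open>mC\<close> that is orthogonal for the Killing form. It serves as an invariant of the
parabolic situation: the group \<open>K\<close> commutes with it, whereas no nonzero element of \<open>\<m>\<close> does
infinitesimally. So it detects tangent vectors of the quotient.\<close>

definition mC_part where "mC_part v = (\<Sum>\<alpha>\<in>m_roots. kil v (Xv (- \<alpha>)) *s Xv \<alpha>)"

lemma m_roots_subset: "m_roots \<subseteq> roots D" and finite_m_roots: "finite m_roots"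
  and m_roots_neg: "\<alpha> \<in> m_roots \<Longrightarrow> - \<alpha> \<in> m_roots"
  using finite_roots finite_subset[of m_roots] neg_root by (auto simp: m_roots_def neg_neg)

lemma mC_subspace: "vec.subspace mC" by (simp add: mC_def)

lemma mC_part_linear: "Vector_Spaces.linear (*s) (*s) mC_part"
  unfolding mC_part_def
  unfolding Vector_Spaces.linear_iff
  by (intro conjI allI vec.vector_space_axioms) (simp_all add: kil_simps vec.scale_left_distrib sum.distrib vec.scale_sum_right)

lemma mC_part_in: "mC_part v \<in> mC"
  unfolding mC_part_def mC_def by (intro vec.span_sum vec.span_scale vec.span_base) auto

lemma mC_part_id: assumes "v \<in> mC" shows "mC_part v = v"
  using assms unfolding mC_def
proof (induction rule: vec.span_induct_alt)
  case (step c x y)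
  then obtain \<beta> where b: "\<beta> \<in> m_roots" "x = Xv \<beta>" by auto
  have "mC_part x = (\<Sum>\<alpha>\<in>m_roots. if \<alpha> = \<beta> then Xv \<alpha> else 0)"
    unfolding mC_part_def b(2)
  proof (rule sum.cong)
    fix \<alpha> assume "\<alpha> \<in> m_roots"
    then have a: "\<alpha> \<in> roots D" and b': "\<beta> \<in> roots D" using b m_roots_subset by auto
    show "kil (Xv \<beta>) (Xv (- \<alpha>)) *s Xv \<alpha> = (if \<alpha> = \<beta> then Xv \<alpha> else 0)"
      using kil_Xv_Xv[OF b' neg_root[OF a]] by (simp add: neg_eq_iff(1))
  qed simp
  then have "mC_part x = x" using finite_m_roots b by simp
  then show ?case using step.IH by (simp add: vec.linear_add[OF mC_part_linear] vec.linear_scale[OF mC_part_linear])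
qed (simp add: vec.linear_0[OF mC_part_linear])

lemma mC_part_cartan: assumes "H \<in> \<h>" shows "mC_part H = 0"
  unfolding mC_part_def
proof (rule sum.neutral, rule ballI)
  fix \<alpha> assume "\<alpha> \<in> m_roots"
  then have na: "- \<alpha> \<in> roots D" using m_roots_subset m_roots_neg by blast
  have "kil H (Xv (- \<alpha>)) = 0" using kil_orthogonal_cartan[OF na Xv_in[OF na] assms] by (simp only: kil_sym)
  then show "kil H (Xv (- \<alpha>)) *s Xv \<alpha> = 0" by simp
qed

lemma mC_part_orthogonal: assumes "\<And>w. w \<in> mC \<Longrightarrow> kil v w = 0" shows "mC_part v = 0"
  unfolding mC_part_def
proof (rule sum.neutral, rule ballI)
  fix \<alpha> assume "\<alpha> \<in> m_roots"
  then have "Xv (- \<alpha>) \<in> mC" unfolding mC_def using m_roots_neg by (intro vec.span_base) auto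
  then show "kil v (Xv (- \<alpha>)) *s Xv \<alpha> = 0" using assms by simp
qed

lemma mC_part_residual: assumes "w \<in> mC" shows "kil (v - mC_part v) w = 0"
  using assms unfolding mC_def
proof (induction rule: vec.span_induct_alt)
  case (step c x y)
  then obtain \<beta> where b: "\<beta> \<in> m_roots" "x = Xv \<beta>" by auto
  have b': "\<beta> \<in> roots D" using b m_roots_subset by auto
  have "kil (mC_part v) x = (\<Sum>\<alpha>\<in>m_roots. if \<alpha> = - \<beta> then kil v (Xv \<beta>) else 0)"
    unfolding mC_part_def b(2) kil_sum_left
  proof (rule sum.cong)
    fix \<alpha> assume "\<alpha> \<in> m_roots"
    then have a: "\<alpha> \<in> roots D" using m_roots_subset by auto
    show "kil (kil v (Xv (- \<alpha>)) *s Xv \<alpha>) (Xv \<beta>) = (if \<alpha> = - \<beta> then kil v (Xv \<beta>) else 0)"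
      unfolding kil_scale_left kil_Xv_Xv[OF a b'] using neg_neg[of \<beta>] neg_eq_iff(2)[of \<alpha> \<beta>] by auto
  qed simp
  then have "kil (mC_part v) x = kil v x" using finite_m_roots m_roots_neg[OF b(1)] b(2) by simp
  then show ?case using step.IH by (simp add: kil_simps)
qed (simp add: kil_zero)

lemma m_subset_mC: "\<m> \<subseteq> mC"
proof -
  have "Av \<alpha> \<in> mC \<and> Sv \<alpha> \<in> mC" if a: "\<alpha> \<in> compl" for \<alpha>
  proof -
    have "\<alpha> \<in> m_roots" using a compl_subset by (auto simp: m_roots_def)
    then have "Xv \<alpha> \<in> mC" "Xv (- \<alpha>) \<in> mC" unfolding mC_def using m_roots_neg by (auto intro: vec.span_base)
    then show ?thesis unfolding A_vec_def S_vec_def using mC_subspace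
      by (simp add: vec.subspace_diff vec.subspace_scale vec.subspace_add)
  qed
  moreover have "subspace mC"
    using mC_subspace by (auto simp: subspace_def vec.subspace_def scaleR_eq_smult)
  ultimately show ?thesis
    unfolding m_Theta_def m_of_def by (intro span_minimal) auto
qed

lemma mC_m_generated: "x \<in> mC \<Longrightarrow> x \<in> vec.span \<m>"
proof -
  have "Xv \<alpha> \<in> vec.span \<m>" if a: "\<alpha> \<in> m_roots" for \<alpha>
  proof -
    have "Av \<alpha> \<in> \<m> \<and> Sv \<alpha> \<in> \<m>"
    proof (cases "\<alpha> \<in> compl")
      case True
      then show ?thesis using m_of_generators[of \<alpha> compl] by (simp add: m_Theta_def)
    next
      case False
      then have "- \<alpha> \<in> compl" using a by (simp add: m_roots_def)
      then have "Av (- \<alpha>) \<in> \<m>" "Sv (- \<alpha>) \<in> \<m>" using m_of_generators[of "- \<alpha>" compl] by (simp_all add: m_Theta_def)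
      then show ?thesis unfolding Av_neg Sv_neg using subspace_neg[OF m_subspace, of "- Av \<alpha>"] by simp
    qed
    moreover have "Xv \<alpha> = (1/2) *s Av \<alpha> + (- \<i> / 2) *s Sv \<alpha>"
      by (simp add: vec_eq_iff A_vec_def S_vec_def algebra_simps)
    ultimately show ?thesis by (metis vec.span_add vec.span_base vec.span_scale)
  qed
  then have "mC \<subseteq> vec.span \<m>" unfolding mC_def by (intro vec.span_minimal) auto
  then show "x \<in> mC \<Longrightarrow> x \<in> vec.span \<m>" by blast
qed

text \<open>An isometry of the Killing form that preserves \<open>\<m>\<close> preserves \<open>mC\<close> and its orthogonal complement. The
elements of \<open>Ad(K)\<close> are of this kind.\<close>

lemma mC_part_equivariant:
  assumes T: "Vector_Spaces.linear (*s) (*s) T" and inv: "\<And>v. T (T' v) = v"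
    and kil: "\<And>x y. kil (T x) (T y) = kil x y"
    and m: "\<And>x. x \<in> \<m> \<Longrightarrow> T x \<in> \<m>" "\<And>x. x \<in> \<m> \<Longrightarrow> T' x \<in> \<m>"
  shows "mC_part (T v) = T (mC_part v)"
proof -
  have TmC: "T x \<in> mC" if "x \<in> mC" for x
    using mC_m_generated[OF that]
  proof (induction rule: vec.span_induct_alt)
    case (step c x y)
    then show ?case using m(1)[OF step.hyps] m_subset_mC mC_subspace
      by (auto simp: vec.linear_add[OF T] vec.linear_scale[OF T] intro!: vec.subspace_add vec.subspace_scale)
  qed (simp add: vec.linear_0[OF T] vec.subspace_0[OF mC_subspace])
  have orth: "kil (T (v - mC_part v)) w = 0" if "w \<in> mC" for w
    using mC_m_generated[OF that]
  proof (induction rule: vec.span_induct_alt)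
    case (step c x y)
    have "kil (T (v - mC_part v)) x = kil (v - mC_part v) (T' x)"
      using kil[of "v - mC_part v" "T' x"] inv by simp
    also have "\<dots> = 0" using mC_part_residual m(2)[OF step.hyps] m_subset_mC by blast
    finally show ?case using step.IH by (simp add: kil_simps)
  qed (simp add: kil_zero)
  have "T v = T (mC_part v) + T (v - mC_part v)" by (simp add: vec.linear_diff[OF T])
  then have "mC_part (T v) = mC_part (T (mC_part v)) + mC_part (T (v - mC_part v))"
    by (metis vec.linear_add[OF mC_part_linear])
  also have "\<dots> = T (mC_part v) + 0"
    using mC_part_id[OF TmC[OF mC_part_in]] mC_part_orthogonal[OF orth] by metis
  finally show ?thesis by simp
qed

text \<open>For \<open>H\<close> in the Cartan subalgebra, \<open>[Y, H]\<close> lies in \<open>mC\<close>, and it is equal to its projection, which is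
\<open>[Y, 0]\<close> by assumption. So \<open>Y\<close> centralizes the Cartan subalgebra and lies in it, but also in \<open>mC\<close>.\<close>

lemma commuting_with_mC_part_trivial:
  assumes Y: "Y \<in> \<m>" and c: "\<And>z. br Y (mC_part z) = mC_part (br Y z)"
  shows "Y = 0"
proof -
  have mY: "Y \<in> mC" using Y m_subset_mC by auto
  have "br H Y = 0" if H: "H \<in> \<h>" for H
  proof -
    have "br H x \<in> mC" if "x \<in> mC" for x
      using that unfolding mC_def
    proof (induction rule: vec.span_induct_alt)
      case (step c x y)
      then obtain \<beta> where b: "\<beta> \<in> m_roots" "x = Xv \<beta>" by auto
      then have "br H x = \<beta> H *s x" using br_in_rs[OF Xv_in H] m_roots_subset by auto
      then have "br H x \<in> vec.span (Xv ` m_roots)" using vec.span_scale[OF vec.span_base[OF step.hyps]] by simp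
      then show ?case using step.IH unfolding br_add_right br_scale_right
        by (intro vec.span_add vec.span_scale)
    qed (simp add: br_simps vec.span_zero)
    then have B: "br Y H \<in> mC" using mY br_antisym[of Y H] vec.subspace_neg[OF mC_subspace] by simp
    have "br Y H = mC_part (br Y H)" by (simp only: mC_part_id[OF B])
    also have "\<dots> = 0" using c[of H] by (simp only: mC_part_cartan[OF H] br_zero_right)
    finally show ?thesis using br_antisym[of H Y] by simp
  qed
  then have "Y \<in> \<h>" by (rule cartan_maximal)
  then show "Y = 0" using mC_part_cartan mC_part_id[OF mY] by simp
qed

subsection \<open>Invariant scalar products\<close>

lemma isotropy_partition: "\<Union> (isotropy D) = compl" and isotropy_disjoint: "disjoint (isotropy D)"
  and isotropy_subset: "\<sigma> \<in> isotropy D \<Longrightarrow> \<sigma> \<subseteq> compl"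
  using isotropy by (auto simp: isotropy_decomposition_def partition_on_def)

lemma finite_isotropy: "finite (isotropy D)"
  using finite_compl isotropy_partition by (metis finite_UnionD)

lemma sum_compl_isotropy: "(\<Sum>\<alpha>\<in>compl. f \<alpha>) = (\<Sum>\<sigma>\<in>isotropy D. \<Sum>\<alpha>\<in>\<sigma>. f \<alpha>)"
  unfolding isotropy_partition[symmetric]
  by (rule sum.Union_disjoint_sets[unfolded o_def])
    (use finite_subset[OF isotropy_subset finite_compl] isotropy_disjoint in \<open>auto simp: disjoint_def\<close>)

text \<open>An operator with the defining property exists because the components \<open>\<sigma>\<close> are disjoint.\<close>

lemma Lambda_op_spec:
  "linear (Lambda_op D lam)" "\<sigma> \<in> isotropy D \<Longrightarrow> Y \<in> m_of D \<sigma> \<Longrightarrow> Lambda_op D lam Y = lam \<sigma> *\<^sub>R Y"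
proof -
  define L where "L Y = (\<Sum>\<sigma>\<in>isotropy D. lam \<sigma> *\<^sub>R (\<Sum>\<alpha>\<in>\<sigma>. coord_A \<alpha> Y *\<^sub>R Av \<alpha> + coord_S \<alpha> Y *\<^sub>R Sv \<alpha>))" for Y
  have lin: "linear L"
    unfolding L_def
    by (intro linear_compose_sum ballI linear_compose_scale_right linear_compose_add linearI)
      (simp_all add: linear_add[OF coord_A_linear] linear_add[OF coord_S_linear] linear_cmul[OF coord_A_linear] linear_cmul[OF coord_S_linear] scaleR_add_left)
  have L: "L Y = lam \<sigma> *\<^sub>R Y" if s: "\<sigma> \<in> isotropy D" and Y: "Y \<in> m_of D \<sigma>" for \<sigma> Y
  proof -
    have rep: "Y = (\<Sum>\<alpha>\<in>\<sigma>. coord_A \<alpha> Y *\<^sub>R Av \<alpha> + coord_S \<alpha> Y *\<^sub>R Sv \<alpha>)"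
      by (rule m_of_representation[OF isotropy_subset[OF s] Y])
    have z: "(\<Sum>\<alpha>\<in>\<tau>. coord_A \<alpha> Y *\<^sub>R Av \<alpha> + coord_S \<alpha> Y *\<^sub>R Sv \<alpha>) = 0" if t: "\<tau> \<in> isotropy D" "\<tau> \<noteq> \<sigma>" for \<tau>
    proof (rule sum.neutral, rule ballI)
      fix \<alpha> assume a: "\<alpha> \<in> \<tau>"
      have "\<alpha> \<notin> \<sigma>" using a t s isotropy_disjoint by (auto simp: disjoint_def)
      moreover have "\<alpha> \<in> compl" using a t isotropy_subset by blast
      ultimately have "coord_A \<alpha> Y = 0" "coord_S \<alpha> Y = 0"
        using coord_A_sum[OF _ isotropy_subset[OF s], of \<alpha> "\<lambda>\<alpha>. coord_A \<alpha> Y" "\<lambda>\<alpha>. coord_S \<alpha> Y"] rep by simp_all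
      then show "coord_A \<alpha> Y *\<^sub>R Av \<alpha> + coord_S \<alpha> Y *\<^sub>R Sv \<alpha> = 0" by simp
    qed
    have "L Y = (\<Sum>\<tau>\<in>isotropy D. if \<tau> = \<sigma> then lam \<sigma> *\<^sub>R Y else 0)"
      unfolding L_def by (rule sum.cong) (use z rep in auto)
    then show ?thesis using finite_isotropy s by simp
  qed
  have "linear (Lambda_op D lam) \<and> (\<forall>\<sigma>\<in>isotropy D. \<forall>Y\<in>m_of D \<sigma>. Lambda_op D lam Y = lam \<sigma> *\<^sub>R Y)"
    unfolding Lambda_op_def by (rule someI[of _ L]) (use lin L in blast)
  then show "linear (Lambda_op D lam)" "\<sigma> \<in> isotropy D \<Longrightarrow> Y \<in> m_of D \<sigma> \<Longrightarrow> Lambda_op D lam Y = lam \<sigma> *\<^sub>R Y"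
    by blast+
qed

lemma Re_kil_Av: "Re (kil (Av \<alpha>) Z) = - 2 * coord_A \<alpha> Z" "Re (kil (Sv \<alpha>) Z) = - 2 * coord_S \<alpha> Z"
  by (simp_all add: coord_A_def coord_S_def)

lemma m_isotropy_sum:
  assumes "Y \<in> \<m>"
  shows "Y = (\<Sum>\<sigma>\<in>isotropy D. \<Sum>\<alpha>\<in>\<sigma>. coord_A \<alpha> Y *\<^sub>R Av \<alpha> + coord_S \<alpha> Y *\<^sub>R Sv \<alpha>)"
  using m_part_id[OF assms] unfolding m_part_def sum_compl_isotropy by simp

lemma B_form_coordinates:
  assumes Y: "Y \<in> \<m>"
  shows "B_form D lam Y Z = (\<Sum>\<sigma>\<in>isotropy D. \<Sum>\<alpha>\<in>\<sigma>. 2 * lam \<sigma> * (coord_A \<alpha> Y * coord_A \<alpha> Z + coord_S \<alpha> Y * coord_S \<alpha> Z))"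
proof -
  let ?Y = "\<lambda>\<sigma>. \<Sum>\<alpha>\<in>\<sigma>. coord_A \<alpha> Y *\<^sub>R Av \<alpha> + coord_S \<alpha> Y *\<^sub>R Sv \<alpha>"
  have "Lambda_op D lam Y = (\<Sum>\<sigma>\<in>isotropy D. Lambda_op D lam (?Y \<sigma>))"
    using linear_sum[OF Lambda_op_spec(1), of lam ?Y "isotropy D"] m_isotropy_sum[OF Y] by simp
  also have "\<dots> = (\<Sum>\<sigma>\<in>isotropy D. lam \<sigma> *\<^sub>R ?Y \<sigma>)"
    by (rule sum.cong) (simp_all add: Lambda_op_spec(2) m_of_sum)
  finally have L: "Lambda_op D lam Y = (\<Sum>\<sigma>\<in>isotropy D. lam \<sigma> *\<^sub>R ?Y \<sigma>)" .
  have "B_form D lam Y Z = - (\<Sum>\<sigma>\<in>isotropy D. lam \<sigma> * (\<Sum>\<alpha>\<in>\<sigma>. coord_A \<alpha> Y * Re (kil (Av \<alpha>) Z) + coord_S \<alpha> Y * Re (kil (Sv \<alpha>) Z)))"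
    unfolding B_form_def L kil_sum_left kil_scaleR kil_add_left by simp
  also have "\<dots> = (\<Sum>\<sigma>\<in>isotropy D. \<Sum>\<alpha>\<in>\<sigma>. 2 * lam \<sigma> * (coord_A \<alpha> Y * coord_A \<alpha> Z + coord_S \<alpha> Y * coord_S \<alpha> Z))"
    unfolding Re_kil_Av sum_negf[symmetric] sum_distrib_left by (intro sum.cong refl) (simp add: algebra_simps)
  finally show ?thesis .
qed

text \<open>A map that preserves the components commutes with \<open>\<Lambda>\<close> on \<open>\<m>\<close>.\<close>

lemma B_form_invariant:
  assumes T: "linear T" and kil: "\<And>x y. kil (T x) (T y) = kil x y"
    and m: "\<And>\<sigma> x. \<sigma> \<in> isotropy D \<Longrightarrow> x \<in> m_of D \<sigma> \<Longrightarrow> T x \<in> m_of D \<sigma>" and Y: "Y \<in> \<m>"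
  shows "B_form D lam (T Y) (T Z) = B_form D lam Y Z"
proof -
  let ?Y = "\<lambda>\<sigma>. \<Sum>\<alpha>\<in>\<sigma>. coord_A \<alpha> Y *\<^sub>R Av \<alpha> + coord_S \<alpha> Y *\<^sub>R Sv \<alpha>"
  have Ys: "Y = (\<Sum>\<sigma>\<in>isotropy D. ?Y \<sigma>)" by (rule m_isotropy_sum[OF Y])
  have "Lambda_op D lam (T (\<Sum>\<sigma>\<in>isotropy D. ?Y \<sigma>)) = (\<Sum>\<sigma>\<in>isotropy D. Lambda_op D lam (T (?Y \<sigma>)))"
    unfolding linear_sum[OF T, of ?Y] linear_sum[OF Lambda_op_spec(1)] ..
  also have "\<dots> = (\<Sum>\<sigma>\<in>isotropy D. T (Lambda_op D lam (?Y \<sigma>)))"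
  proof (rule sum.cong)
    fix \<sigma> assume s: "\<sigma> \<in> isotropy D"
    show "Lambda_op D lam (T (?Y \<sigma>)) = T (Lambda_op D lam (?Y \<sigma>))"
      unfolding Lambda_op_spec(2)[OF s m[OF s m_of_sum]] Lambda_op_spec(2)[OF s m_of_sum] linear_cmul[OF T] ..
  qed simp
  also have "\<dots> = T (Lambda_op D lam (\<Sum>\<sigma>\<in>isotropy D. ?Y \<sigma>))"
    unfolding linear_sum[OF Lambda_op_spec(1)] linear_sum[OF T] ..
  finally have "Lambda_op D lam (T Y) = T (Lambda_op D lam Y)" using Ys by simp
  then show ?thesis by (simp add: B_form_def kil)
qed

section \<open>The exponential map and the adjoint representation\<close>

abbreviation G where "G \<equiv> grp D"
abbreviation E where "E \<equiv> gexp D"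
abbreviation mul (infixl "\<odot>" 70) where "x \<odot> y \<equiv> x \<otimes>\<^bsub>grp D\<^esub> y"
abbreviation ginv where "ginv x \<equiv> inv\<^bsub>grp D\<^esub> x"
abbreviation gone ("\<e>") where "\<e> \<equiv> \<one>\<^bsub>grp D\<^esub>"
abbreviation U where "U \<equiv> U_grp D"
abbreviation K where "K \<equiv> K_grp D"

lemma lie: "lie_group G (gtop D) (gcharts D)" and expm: "exponential_map G (gtop D) (gcharts D) E"
  and Ad_derivative_zero: "((\<lambda>t. Ad D (E (t *\<^sub>R X)) Y) has_vector_derivative br X Y) (at 0)"
  using group_algebra by (auto simp: lie_group_with_algebra_def)

sublocale G: Group.group "grp D"
  using lie by (simp add: lie_group_def)

lemma inv_mult_cancel: "x \<in> carrier G \<Longrightarrow> w \<in> carrier G \<Longrightarrow> ginv x \<odot> (x \<odot> w) = w"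
  by (simp add: G.m_assoc[symmetric])

lemma topspace_G: "topspace (gtop D) = carrier G" and Hausdorff_G: "Hausdorff_space (gtop D)"
  and mult_continuous: "continuous_map (prod_topology (gtop D) (gtop D)) (gtop D) (\<lambda>(x, y). x \<odot> y)"
  using lie by (auto simp: lie_group_def smooth_manifold_def smooth_map_def)

lemma continuous_map_mul:
  assumes "continuous_map T (gtop D) f" "continuous_map T (gtop D) g"
  shows "continuous_map T (gtop D) (\<lambda>x. f x \<odot> g x)"
  using continuous_map_compose[OF continuous_map_pairedI[OF assms] mult_continuous] by (simp add: o_def)

lemma E_continuous: "continuous_map euclidean (gtop D) E"
  using expm by (simp add: exponential_map_def smooth_map_def)

lemma E_carrier: "E X \<in> carrier G"
  using continuous_map_image_subset_topspace[OF E_continuous] topspace_G by auto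

lemma E_add: "E ((s + t) *\<^sub>R X) = E (s *\<^sub>R X) \<odot> E (t *\<^sub>R X)"
  using expm unfolding exponential_map_def by blast

lemma E_zero: "E 0 = \<e>"
proof -
  have "E 0 \<odot> E 0 = E 0" using E_add[of 0 0 0] by simp
  then show ?thesis using E_carrier[of 0] by (metis G.l_cancel_one)
qed

lemma E_neg: "E (- X) = ginv (E X)"
proof -
  have "E (- X) \<odot> E X = \<e>" using E_add[of "-1" 1 X] E_zero by simp
  then show ?thesis using E_carrier G.inv_equality by metis
qed

lemma continuous_map_E:
  assumes "continuous_on S f" shows "continuous_map (top_of_set S) (gtop D) (\<lambda>x. E (f x))"
  using continuous_map_compose[OF _ E_continuous, of "top_of_set S" f] assms by (simp add: o_def)

lemma continuous_map_const_G: "x \<in> carrier G \<Longrightarrow> continuous_map T (gtop D) (\<lambda>y. x)"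
  by (simp add: topspace_G)

text \<open>In a chart the exponential map is smooth with bijective differential at 0, so it is locally injective,
and then open by invariance of domain.\<close>

lemma E_local_homeomorphism:
  "\<exists>r>0. inj_on E (ball 0 r) \<and> (\<forall>B. open B \<and> B \<subseteq> ball 0 r \<longrightarrow> openin (gtop D) (E ` B))"
proof -
  have "\<e> \<in> topspace (gtop D)" by (simp add: topspace_G)
  moreover have "\<Union> (fst ` gcharts D) = topspace (gtop D)" using lie by (simp add: lie_group_def smooth_manifold_def)
  ultimately obtain P where "P \<in> gcharts D" "\<e> \<in> fst P" by blast
  then obtain C \<phi> where C: "(C, \<phi>) \<in> gcharts D" "\<e> \<in> C" by (cases P) simp
  have oC: "openin (gtop D) C" and hom: "homeomorphic_map (subtopology (gtop D) C) (subtopology euclidean (\<phi> ` C)) \<phi>"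
    using lie C(1) by (auto simp: lie_group_def smooth_manifold_def)
  define W where "W = E -` C"
  have "openin euclidean {x \<in> topspace euclidean. E x \<in> C}"
    by (rule openin_continuous_map_preimage[OF E_continuous oC])
  then have W: "open W" by (simp add: W_def vimage_def)
  have inv: "inv_into UNIV id = (id :: complex ^ 'n \<Rightarrow> _)" by (metis inv_id)
  have "smooth_on (\<phi> \<circ> E \<circ> inv_into UNIV id) (id ` (UNIV \<inter> E -` C))"
    using expm C(1) unfolding exponential_map_def smooth_map_def by fast
  then have sm: "smooth_on (\<phi> \<circ> E) W" unfolding inv W_def by simp
  have "bij (frechet_derivative (\<phi> \<circ> E) (at 0))" using expm C unfolding exponential_map_def by fast
  then have inj: "inj (frechet_derivative (\<phi> \<circ> E) (at 0))" by (rule bij_is_inj)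
  have 0: "0 \<in> W" using C(2) by (simp add: W_def E_zero)
  obtain r where r: "r > 0" "ball 0 r \<subseteq> W" "inj_on (\<phi> \<circ> E) (ball 0 r)"
    using C1_locally_injective[OF W 0 _ inj] sm unfolding smooth_on_def by blast
  have "openin (gtop D) (E ` B)" if B: "open B" "B \<subseteq> ball 0 r" for B
  proof -
    have BC: "E ` B \<subseteq> C" using B(2) r(2) by (auto simp: W_def)
    have "continuous_on W (\<phi> \<circ> E)" using sm Ck_on.simps(1)[of "\<phi> \<circ> E" W] unfolding smooth_on_def by blast
    then have "open ((\<phi> \<circ> E) ` B)"
      using B r by (intro invariance_of_domain) (auto intro: continuous_on_subset inj_on_subset)
    then have o: "openin (subtopology euclidean (\<phi> ` C)) ((\<phi> \<circ> E) ` B)"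
      using BC by (intro open_openin_trans[THEN openin_open_subtopology[THEN iffD2]] | auto simp: openin_open)+
    have "openin (subtopology (gtop D) C) {x \<in> topspace (subtopology (gtop D) C). \<phi> x \<in> (\<phi> \<circ> E) ` B}"
      by (rule openin_continuous_map_preimage[OF homeomorphic_imp_continuous_map[OF hom] o])
    moreover have ts: "topspace (subtopology (gtop D) C) = C" using oC openin_subset by fastforce
    moreover have "inj_on \<phi> C" using homeomorphic_imp_injective_map[OF hom] ts by simp
    then have "{x \<in> C. \<phi> x \<in> (\<phi> \<circ> E) ` B} = E ` B" using BC by (auto dest: inj_onD)
    ultimately show ?thesis using oC openin_trans_full by metis
  qed
  moreover have "inj_on E (ball 0 r)" using r(3) by (rule inj_on_imageI2)
  ultimately show ?thesis using r(1) by blast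
qed

text \<open>Radius of a ball on which the exponential map is a homeomorphism onto an open set.\<close>

definition inj_radius where
  "inj_radius = (SOME r. r > 0 \<and> inj_on E (ball 0 r) \<and> (\<forall>B. open B \<and> B \<subseteq> ball 0 r \<longrightarrow> openin (gtop D) (E ` B)))"

lemma inj_radius_pos: "inj_radius > 0" and E_inj: "inj_on E (ball 0 inj_radius)"
  and E_open: "open B \<Longrightarrow> B \<subseteq> ball 0 inj_radius \<Longrightarrow> openin (gtop D) (E ` B)"
  using someI_ex[OF E_local_homeomorphism] unfolding inj_radius_def by auto

lemma E_inj_norm: "norm X < inj_radius \<Longrightarrow> norm Y < inj_radius \<Longrightarrow> E X = E Y \<Longrightarrow> X = Y"
  using inj_onD[OF E_inj, of X Y] by simp

lemma eventually_near_unit: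
  assumes c: "continuous_map (top_of_set S) (gtop D) c" "t \<in> S" "c t = \<e>" and r: "0 < r" "r \<le> inj_radius"
  shows "\<exists>d>0. \<forall>\<tau>\<in>S. dist \<tau> t < d \<longrightarrow> c \<tau> \<in> E ` ball 0 r"
proof -
  have o: "openin (gtop D) (E ` ball 0 r)" using E_open[OF open_ball subset_ball[OF r(2)]] .
  have "openin (top_of_set S) {\<tau> \<in> topspace (top_of_set S). c \<tau> \<in> E ` ball 0 r}"
    by (rule openin_continuous_map_preimage[OF c(1) o])
  moreover have "t \<in> {\<tau> \<in> topspace (top_of_set S). c \<tau> \<in> E ` ball 0 r}"
    using c(2,3) r(1) E_zero by (auto intro!: image_eqI[of _ _ 0])
  ultimately show ?thesis unfolding openin_euclidean_subtopology_iff by fastforce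
qed

text \<open>The exponential map has a logarithm near the unit. Doubling \<open>c(\<tau>/2)\<close> gives \<open>c(\<tau>)\<close>, so the logarithm of
\<open>c\<close> is halved when the time is halved. Thus \<open>c\<close> agrees with \<open>t \<mapsto> exp(tZ)\<close> at dyadic fractions of a small
time, hence at their multiples, which are dense.\<close>

lemma one_parameter_subgroup:
  assumes c: "continuous_map euclideanreal (gtop D) c" and hom: "\<And>s t. c (s + t) = c s \<odot> c t"
  shows "\<exists>Z. \<forall>t. E (t *\<^sub>R Z) = c t"
proof -
  have cc: "c t \<in> carrier G" for t using continuous_map_image_subset_topspace[OF c] topspace_G by auto
  have c0: "c 0 = \<e>" using hom[of 0 0] cc[of 0] by (metis G.l_cancel_one add_0)
  have coord_S: "continuous_map (top_of_set UNIV) (gtop D) c" using c by simp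
  obtain d where d: "d > 0" "\<And>\<tau>. \<bar>\<tau>\<bar> < d \<Longrightarrow> c \<tau> \<in> E ` ball 0 (inj_radius / 2)"
    using eventually_near_unit[OF coord_S, of 0 "inj_radius / 2"] c0 inj_radius_pos by (auto simp: dist_real_def)
  define e where "e = d / 2"
  have e: "e > 0" "e < d" using d by (auto simp: e_def)
  have "\<exists>z. norm z < inj_radius / 2 \<and> E z = c \<tau>" if "\<bar>\<tau>\<bar> < d" for \<tau> using d(2)[OF that] by (auto simp: image_iff)
  then obtain z where z: "\<And>\<tau>. \<bar>\<tau>\<bar> < d \<Longrightarrow> norm (z \<tau>) < inj_radius / 2 \<and> E (z \<tau>) = c \<tau>" by metis
  \<comment> \<open>\<open>2 z(\<tau>/2)\<close> and \<open>z(\<tau>)\<close> both have norm below the injectivity radius and the same exponential\<close>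
  have half: "z (\<tau> / 2) = (1/2) *\<^sub>R z \<tau>" if "\<bar>\<tau>\<bar> < d" for \<tau>
  proof -
    have h: "\<bar>\<tau> / 2\<bar> < d" using that by simp
    have "E (2 *\<^sub>R z (\<tau> / 2)) = E (z (\<tau> / 2)) \<odot> E (z (\<tau> / 2))" using E_add[of 1 1 "z (\<tau> / 2)"] by simp
    also have "\<dots> = c \<tau>" using z[OF h] hom[of "\<tau> / 2" "\<tau> / 2"] by simp
    also have "\<dots> = E (z \<tau>)" using z[OF that] by simp
    finally have "2 *\<^sub>R z (\<tau> / 2) = z \<tau>"
      using z[OF h] z[OF that] inj_radius_pos by (intro E_inj_norm) auto
    then show ?thesis by (metis scaleR_half_double scaleR_2 scaleR_scaleR)
  qed
  define Z where "Z = (1 / e) *\<^sub>R z e"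
  have eq: "E ((e / 2 ^ n) *\<^sub>R Z) = c (e / 2 ^ n)" for n
  proof -
    have bd: "\<bar>e / 2 ^ n\<bar> < d" for n :: nat
    proof -
      have "e / 2 ^ n \<le> e / 1" using e by (intro divide_left_mono) auto
      then show ?thesis using e by simp
    qed
    have "z (e / 2 ^ n) = (e / 2 ^ n) *\<^sub>R Z"
    proof (induction n)
      case 0
      then show ?case using e by (simp add: Z_def)
    next
      case (Suc n)
      have "z (e / 2 ^ Suc n) = z ((e / 2 ^ n) / 2)" by (simp add: mult.commute)
      also have "\<dots> = (1/2) *\<^sub>R (e / 2 ^ n) *\<^sub>R Z" using half[OF bd] Suc by simp
      finally show ?case by simp
    qed
    then have "c (e / 2 ^ n) = E ((e / 2 ^ n) *\<^sub>R Z)" using z[OF bd[of n]] by simp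
    then show ?thesis by simp
  qed
  have nat: "E ((real k * s) *\<^sub>R Z) = c (real k * s)" if "E (s *\<^sub>R Z) = c s" for k s
  proof (induction k)
    case 0
    show ?case by (simp add: E_zero c0)
  next
    case (Suc k)
    have "real (Suc k) * s = real k * s + s" by (simp add: algebra_simps)
    then show ?case using Suc that by (simp only: E_add hom)
  qed
  have neg: "E ((- s) *\<^sub>R Z) = c (- s)" if "E (s *\<^sub>R Z) = c s" for s
  proof -
    have "c (- s) \<odot> c s = \<e>" using hom[of "- s" s] c0 by simp
    then have "c (- s) = ginv (c s)" using G.inv_equality[of "c (- s)" "c s"] cc by simp
    then show ?thesis using that E_neg[of "s *\<^sub>R Z"] by simp
  qed
  let ?S = "{t. E (t *\<^sub>R Z) = c t}"
  have "continuous_map euclideanreal (gtop D) (\<lambda>t. E (t *\<^sub>R Z))"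
    using continuous_map_E[of UNIV "\<lambda>t. t *\<^sub>R Z"] by (simp add: continuous_intros)
  from closedin_continuous_maps_eq[OF Hausdorff_G this c] have cl: "closed ?S" by simp
  have "t \<in> ?S" for t
  proof -
    \<comment> \<open>multiples of \<open>e / 2\<^sup>n\<close> that approximate \<open>t\<close>\<close>
    define u where "u n = real_of_int \<lfloor>t / (e / 2 ^ n)\<rfloor> * (e / 2 ^ n)" for n :: nat
    have uS: "u n \<in> ?S" for n
    proof (cases "\<lfloor>t / (e / 2 ^ n)\<rfloor> \<ge> 0")
      case True
      then obtain k where "\<lfloor>t / (e / 2 ^ n)\<rfloor> = int k" using nonneg_int_cases by blast
      then show ?thesis using nat[OF eq[of n], of k] by (simp add: u_def)
    next
      case False
      then have "- \<lfloor>t / (e / 2 ^ n)\<rfloor> \<ge> 0" by simp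
      then obtain k where "- \<lfloor>t / (e / 2 ^ n)\<rfloor> = int k" using nonneg_int_cases by blast
      then have "\<lfloor>t / (e / 2 ^ n)\<rfloor> = - int k" by simp
      then show ?thesis using neg[OF nat[OF eq[of n], of k]] by (simp add: u_def)
    qed
    have b: "\<bar>u n - t\<bar> \<le> e * (1 / 2) ^ n" for n
    proof -
      define p where "p = e / 2 ^ n"
      have p: "p > 0" using e by (simp add: p_def)
      have "u n \<le> (t / p) * p" "(t / p - 1) * p \<le> u n"
        unfolding u_def p_def[symmetric] using p by (intro mult_right_mono; linarith)+
      then have "\<bar>u n - t\<bar> \<le> p" using p by (simp add: left_diff_distrib abs_le_iff)
      then show ?thesis by (simp add: p_def power_one_over)
    qed
    have lim: "(\<lambda>n. e * (1 / 2) ^ n) \<longlonglongrightarrow> 0"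
      using tendsto_mult[OF tendsto_const[of e] LIMSEQ_realpow_zero[of "1 / 2"]] by simp
    have "\<forall>\<^sub>F n in sequentially. norm (u n - t) \<le> e * (1 / 2) ^ n"
      unfolding real_norm_def by (intro always_eventually allI b)
    then have "(\<lambda>n. u n - t) \<longlonglongrightarrow> 0" by (rule Lim_null_comparison[OF _ lim])
    then have "u \<longlonglongrightarrow> t" by (rule LIM_zero_cancel)
    then show ?thesis by (rule closed_sequentially[OF cl uS])
  qed
  then show ?thesis by (intro exI[of _ Z]) simp
qed

lemma one_parameter_unique:
  assumes "\<And>t. E (t *\<^sub>R Z) = E (t *\<^sub>R Z')" shows "Z = Z'"
proof -
  define N where "N = norm Z + norm Z' + 1"
  define t where "t = inj_radius / (2 * N)"
  have p: "0 < N" by (simp add: N_def add_nonneg_pos)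
  have t: "t > 0" using inj_radius_pos p by (simp add: t_def)
  have b: "norm (t *\<^sub>R Y) < inj_radius" if "norm Y \<le> N" for Y :: "complex ^ 'n"
  proof -
    have "t * norm Y \<le> t * N" using that t by (intro mult_left_mono) auto
    also have "\<dots> = inj_radius / 2" using p by (simp add: t_def)
    finally show ?thesis using t inj_radius_pos by simp
  qed
  have "norm (t *\<^sub>R Z) < inj_radius" by (rule b) (simp add: N_def)
  moreover have "norm (t *\<^sub>R Z') < inj_radius" by (rule b) (simp add: N_def)
  ultimately have "t *\<^sub>R Z = t *\<^sub>R Z'" using E_inj_norm assms by blast
  then show ?thesis using t by simp
qed

text \<open>Conjugation turns a one-parameter subgroup into another one, which has a generator.\<close>

lemma Ad_spec:
  assumes g: "g \<in> carrier G" shows "E (t *\<^sub>R Ad D g Y) = g \<odot> E (t *\<^sub>R Y) \<odot> ginv g"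
proof -
  let ?c = "\<lambda>t. g \<odot> E (t *\<^sub>R Y) \<odot> ginv g"
  have "continuous_map (top_of_set UNIV) (gtop D) ?c"
    using g by (intro continuous_map_mul continuous_map_const_G continuous_map_E) (auto intro: continuous_intros)
  then have cont: "continuous_map euclideanreal (gtop D) ?c" by simp
  have "?c (s + t) = ?c s \<odot> ?c t" for s t
  proof -
    let ?x = "E (s *\<^sub>R Y)" and ?y = "E (t *\<^sub>R Y)"
    have "?c s \<odot> ?c t = g \<odot> (?x \<odot> (ginv g \<odot> g) \<odot> ?y) \<odot> ginv g"
      using g E_carrier by (simp add: G.m_assoc inv_mult_cancel)
    also have "\<dots> = ?c (s + t)" using g E_carrier by (simp add: E_add G.m_assoc)
    finally show ?thesis by simp
  qed
  from one_parameter_subgroup[OF cont this] obtain Z where Z: "\<And>t. E (t *\<^sub>R Z) = ?c t" by blast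
  have "\<forall>t. E (t *\<^sub>R Ad D g Y) = ?c t"
    unfolding Ad_rep_def by (rule theI[of _ Z]) (use Z one_parameter_unique in auto)
  then show ?thesis by blast
qed

lemma Ad_unique:
  assumes "g \<in> carrier G" "\<And>t. E (t *\<^sub>R Z) = g \<odot> E (t *\<^sub>R Y) \<odot> ginv g" shows "Ad D g Y = Z"
  using one_parameter_unique[of "Ad D g Y" Z] Ad_spec[OF assms(1)] assms(2) by metis

lemma Ad_mult:
  assumes "g \<in> carrier G" "h \<in> carrier G" shows "Ad D (g \<odot> h) Y = Ad D g (Ad D h Y)"
proof (rule Ad_unique)
  show "E (t *\<^sub>R Ad D g (Ad D h Y)) = g \<odot> h \<odot> E (t *\<^sub>R Y) \<odot> ginv (g \<odot> h)" for t
    using assms E_carrier by (simp add: Ad_spec G.m_assoc G.inv_mult_group)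
qed (use assms in simp)

lemma Ad_one: "Ad D \<e> Y = Y"
  by (rule Ad_unique) (use E_carrier in auto)

text \<open>Both sides solve the differential equation \<open>y' = [X, y]\<close>. Its left side needs only the derivative of
\<open>Ad(exp(tX))\<close> at \<open>t = 0\<close> and the group law.\<close>

lemma Ad_E: "Ad D (E X) Y = exp_act br Y [] X"
proof -
  have "((\<lambda>t. Ad D (E (t *\<^sub>R X)) Y) has_vector_derivative br X (Ad D (E (t *\<^sub>R X)) Y)) (at t)" for t
  proof -
    have e: "Ad D (E ((\<tau> - t) *\<^sub>R X)) (Ad D (E (t *\<^sub>R X)) Y) = Ad D (E (\<tau> *\<^sub>R X)) Y" for \<tau>
      using Ad_mult[OF E_carrier E_carrier, of "(\<tau> - t) *\<^sub>R X" "t *\<^sub>R X" Y] E_add[of "\<tau> - t" t X] by simp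
    have "((\<lambda>\<tau>. \<tau> - t) has_vector_derivative 1) (at t)" by (auto intro!: derivative_eq_intros)
    moreover have "((\<lambda>s. Ad D (E (s *\<^sub>R X)) (Ad D (E (t *\<^sub>R X)) Y)) has_vector_derivative
        br X (Ad D (E (t *\<^sub>R X)) Y)) (at (t - t))" using Ad_derivative_zero by simp
    ultimately have "(((\<lambda>s. Ad D (E (s *\<^sub>R X)) (Ad D (E (t *\<^sub>R X)) Y)) \<circ> (\<lambda>\<tau>. \<tau> - t)) has_vector_derivative
        (1 *\<^sub>R br X (Ad D (E (t *\<^sub>R X)) Y))) (at t)" by (rule vector_diff_chain_at)
    then show ?thesis by (simp add: o_def e)
  qed
  from ad.linear_ode_unique[OF this, of 1] show ?thesis by (simp add: E_zero Ad_one)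
qed

text \<open>Multiplying a solution of \<open>y' = [X, y]\<close> by a complex number gives a solution.\<close>

lemma exp_act_complex_linear: "Vector_Spaces.linear (*s) (*s) (\<lambda>w. exp_act br w [] X)"
proof -
  have "exp_act br (c *s w) [] X = c *s exp_act br w [] X" for c w
  proof -
    have cl: "bounded_linear (\<lambda>v :: complex ^ 'n. c *s v)"
      using linear_smult_real[OF vec.linear_scale_self] linear_linear by blast
    have "((\<lambda>t. c *s exp_act br w [] (t *\<^sub>R X)) has_vector_derivative br X (c *s exp_act br w [] (t *\<^sub>R X))) (at t)" for t
      using bounded_linear.has_vector_derivative[OF cl ad.exp_act_flow] by (simp add: br_simps)
    from ad.linear_ode_unique[OF this, of 1] show ?thesis by (simp add: ad.exp_act_zero)
  qed
  then show ?thesis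
    unfolding Vector_Spaces.linear_iff
    by (intro conjI allI vec.vector_space_axioms linear_add[OF ad.linear_exp_act])
qed

lemma bounded_bilinear_kil: "bounded_bilinear kil"
proof -
  have "bilinear kil"
    unfolding bilinear_def by (auto intro!: linearI simp: kil_simps scaleR_conv_of_real[where 'a=complex])
  then show ?thesis by (simp add: bilinear_conv_bounded_bilinear)
qed

text \<open>The derivative along the flow vanishes by invariance of the Killing form.\<close>

lemma exp_act_kil: "kil (exp_act br x [] X) (exp_act br y [] X) = kil x y"
proof -
  have "((\<lambda>t. kil (exp_act br x [] (t *\<^sub>R X)) (exp_act br y [] (t *\<^sub>R X))) has_vector_derivative 0) (at t)" for t
  proof -
    let ?x = "exp_act br x [] (t *\<^sub>R X)" and ?y = "exp_act br y [] (t *\<^sub>R X)"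
    have "kil ?x (br X ?y) + kil (br X ?x) ?y = 0"
      using br_antisym[of X ?x] kil_invariant[of ?x X ?y] by (simp add: kil_simps)
    then show ?thesis
      using bounded_bilinear.has_vector_derivative[OF bounded_bilinear_kil ad.exp_act_flow[of x X t] ad.exp_act_flow[of y X t]]
      by simp
  qed
  from has_vector_derivative_zero_constant[OF convex_UNIV, of "\<lambda>t. kil (exp_act br x [] (t *\<^sub>R X)) (exp_act br y [] (t *\<^sub>R X))"] this
  obtain c where c: "\<And>t. kil (exp_act br x [] (t *\<^sub>R X)) (exp_act br y [] (t *\<^sub>R X)) = c" by auto
  show ?thesis using c[of 1] c[of 0] by (simp add: ad.exp_act_zero)
qed

lemma U_subgroup: "subgroup U G"
  unfolding U_grp_def by (rule G.generate_is_subgroup) (use E_carrier in auto)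

lemma U_carrier: "x \<in> U \<Longrightarrow> x \<in> carrier G"
  using subgroup.mem_carrier[OF U_subgroup] .

lemma U_mult: "x \<in> U \<Longrightarrow> y \<in> U \<Longrightarrow> x \<odot> y \<in> U"
  by (rule subgroup.m_closed[OF U_subgroup])

lemma U_inv: "x \<in> U \<Longrightarrow> ginv x \<in> U"
  by (rule subgroup.m_inv_closed[OF U_subgroup])

lemma U_one: "\<e> \<in> U" by (rule subgroup.one_closed[OF U_subgroup])

lemma U_E: "Y \<in> \<u> \<Longrightarrow> E Y \<in> U"
  unfolding U_grp_def by (auto intro: generate.incl)

text \<open>The group \<open>U\<close> is generated by exponentials, so a property of \<open>Ad\<close> on \<open>U\<close> that is stable under composition
needs to be checked for exponential series only.\<close>

lemma Ad_U_induct: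
  assumes x: "x \<in> U" and E: "\<And>Y. Y \<in> \<u> \<Longrightarrow> Q (\<lambda>v. exp_act br v [] Y)" and id: "Q (\<lambda>v. v)"
    and comp: "\<And>f g. Q f \<Longrightarrow> Q g \<Longrightarrow> Q (\<lambda>v. f (g v))"
  shows "Q (Ad D x)"
proof -
  have Q: "Q (Ad D (E Y))" if "Y \<in> \<u>" for Y proof -
    have "Ad D (E Y) = (\<lambda>v. exp_act br v [] Y)" by (rule ext) (rule Ad_E)
    then show ?thesis using E[OF that] by simp
  qed
  show ?thesis
    using x unfolding U_grp_def
  proof (induction rule: generate.induct)
    case one
    have "Ad D \<e> = (\<lambda>v. v)" by (rule ext) (rule Ad_one)
    then show ?case using id by simp
  next
    case (incl h)
    then show ?case using Q by auto
  next
    case (inv h)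
    then obtain Y where "Y \<in> \<u>" "h = E Y" by auto
    then show ?case using Q[of "- Y"] subspace_neg[OF subspace_u] by (simp add: E_neg)
  next
    case (eng h1 h2)
    then have "h1 \<in> carrier G" "h2 \<in> carrier G" using U_carrier unfolding U_grp_def by auto
    then have "Ad D (h1 \<odot> h2) = (\<lambda>v. Ad D h1 (Ad D h2 v))" by (auto simp: Ad_mult)
    then show ?case using comp eng by simp
  qed
qed

lemma Ad_complex_linear: "x \<in> U \<Longrightarrow> Vector_Spaces.linear (*s) (*s) (Ad D x)"
proof (rule Ad_U_induct[where Q="Vector_Spaces.linear (*s) (*s)"])
  show "Vector_Spaces.linear (*s) (*s) (\<lambda>v :: complex ^ 'n. v)" by (rule vec.linear_ident)
  show "Vector_Spaces.linear (*s) (*s) (\<lambda>v. f (g v))"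
    if "Vector_Spaces.linear (*s) (*s) f" "Vector_Spaces.linear (*s) (*s) g" for f g :: "complex ^ 'n \<Rightarrow> complex ^ 'n"
    using Vector_Spaces.linear_compose[OF that(2,1)] by (simp add: o_def)
qed (auto intro: exp_act_complex_linear)

lemma Ad_linear: "x \<in> U \<Longrightarrow> linear (Ad D x)"
  using Ad_complex_linear linear_smult_real by blast

lemma Ad_kil: assumes "x \<in> U" shows "kil (Ad D x v) (Ad D x w) = kil v w"
proof -
  have "\<forall>v w. kil (Ad D x v) (Ad D x w) = kil v w"
    by (rule Ad_U_induct[where Q="\<lambda>f. \<forall>v w. kil (f v) (f w) = kil v w", OF assms]) (simp_all add: exp_act_kil)
  then show ?thesis by blast
qed

lemma Ad_u: assumes "x \<in> U" "v \<in> \<u>" shows "Ad D x v \<in> \<u>"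
proof -
  have "\<forall>v\<in>\<u>. Ad D x v \<in> \<u>"
    by (rule Ad_U_induct[where Q="\<lambda>f. \<forall>v\<in>\<u>. f v \<in> \<u>", OF assms(1)])
      (auto intro: ad.exp_act_in_subspace[OF subspace_u] u_closed)
  then show ?thesis using assms(2) by blast
qed

lemma Ad_inv: "x \<in> carrier G \<Longrightarrow> Ad D x (Ad D (ginv x) v) = v" "x \<in> carrier G \<Longrightarrow> Ad D (ginv x) (Ad D x v) = v"
  using Ad_mult[of x "ginv x" v] Ad_mult[of "ginv x" x v] by (simp_all add: Ad_one)

text \<open>Differentiate \<open>Ad(x) Ad(exp(tY)) = Ad(exp(t Ad(x) Y)) Ad(x)\<close> at \<open>t = 0\<close>.\<close>

lemma Ad_bracket:
  assumes x: "x \<in> U" shows "Ad D x (br Y Z) = br (Ad D x Y) (Ad D x Z)"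
proof -
  have xc: "x \<in> carrier G" by (rule U_carrier[OF x])
  have e: "Ad D x (Ad D (E (t *\<^sub>R Y)) Z) = Ad D (E (t *\<^sub>R Ad D x Y)) (Ad D x Z)" for t
  proof -
    have "Ad D (x \<odot> E (t *\<^sub>R Y) \<odot> ginv x) (Ad D x Z) = Ad D x (Ad D (E (t *\<^sub>R Y)) Z)"
      using xc E_carrier by (simp add: Ad_mult Ad_inv)
    then show ?thesis unfolding Ad_spec[OF xc] by simp
  qed
  have "bounded_linear (Ad D x)" using Ad_linear[OF x] linear_linear by blast
  from bounded_linear.has_vector_derivative[OF this Ad_derivative_zero[of Y Z]]
  have "((\<lambda>t. Ad D (E (t *\<^sub>R Ad D x Y)) (Ad D x Z)) has_vector_derivative Ad D x (br Y Z)) (at 0)"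
    unfolding e .
  then show ?thesis using Ad_derivative_zero vector_derivative_unique_at by blast
qed

subsection \<open>The isotropy group\<close>

lemma K_U: "k \<in> K \<Longrightarrow> k \<in> U" by (simp add: K_grp_def)

lemma K_subgroup: "subgroup K G"
proof (rule G.subgroupI)
  show "K \<subseteq> carrier G" using K_U U_carrier by blast
  have "\<e> \<in> K" using U_one by (auto simp: K_grp_def P_grp_def Ad_one)
  then show "K \<noteq> {}" by blast
  fix x assume x: "x \<in> K"
  then have xc: "x \<in> carrier G" and p: "Ad D x ` \<p> = \<p>" and xU: "x \<in> U" by (auto simp: K_grp_def P_grp_def)
  have "Ad D (ginv x) ` \<p> = Ad D (ginv x) ` (Ad D x ` \<p>)" by (simp add: p)
  also have "\<dots> = \<p>" by (simp add: image_image Ad_inv[OF xc])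
  finally show "ginv x \<in> K" using xc U_inv[OF xU] by (simp add: K_grp_def P_grp_def)
  fix y assume y: "y \<in> K"
  then have yc: "y \<in> carrier G" and q: "Ad D y ` \<p> = \<p>" and yU: "y \<in> U" by (auto simp: K_grp_def P_grp_def)
  have "Ad D (x \<odot> y) ` \<p> = Ad D x ` (Ad D y ` \<p>)" by (simp add: image_image Ad_mult[OF xc yc])
  then show "x \<odot> y \<in> K" using xc yc U_mult[OF xU yU] p q by (simp add: K_grp_def P_grp_def)
qed

lemma K_inv: "k \<in> K \<Longrightarrow> ginv k \<in> K"
  by (rule subgroup.m_inv_closed[OF K_subgroup])

lemma Ad_K_isotropy: "k \<in> K \<Longrightarrow> \<sigma> \<in> isotropy D \<Longrightarrow> Y \<in> m_of D \<sigma> \<Longrightarrow> Ad D k Y \<in> m_of D \<sigma>"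
  using isotropy unfolding isotropy_decomposition_def by blast

lemma Ad_K_m:
  assumes k: "k \<in> K" and Y: "Y \<in> \<m>" shows "Ad D k Y \<in> \<m>"
proof -
  let ?Y = "\<lambda>\<sigma>. \<Sum>\<alpha>\<in>\<sigma>. coord_A \<alpha> Y *\<^sub>R Av \<alpha> + coord_S \<alpha> Y *\<^sub>R Sv \<alpha>"
  have "Ad D k (\<Sum>\<sigma>\<in>isotropy D. ?Y \<sigma>) = (\<Sum>\<sigma>\<in>isotropy D. Ad D k (?Y \<sigma>))"
    by (rule linear_sum[OF Ad_linear[OF K_U[OF k]]])
  also have "\<dots> \<in> \<m>"
  proof (rule subspace_sum[OF m_subspace])
    fix \<sigma> assume s: "\<sigma> \<in> isotropy D"
    have "Ad D k (?Y \<sigma>) \<in> m_of D \<sigma>" by (rule Ad_K_isotropy[OF k s m_of_sum])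
    then show "Ad D k (?Y \<sigma>) \<in> \<m>" using m_of_mono[OF isotropy_subset[OF s]] by (auto simp: m_Theta_def)
  qed
  finally show ?thesis using m_isotropy_sum[OF Y] by simp
qed

lemma Ad_K_mC_part: "k \<in> K \<Longrightarrow> mC_part (Ad D k v) = Ad D k (mC_part v)"
  by (rule mC_part_equivariant[where T'="Ad D (ginv k)"])
    (auto intro: Ad_complex_linear Ad_kil Ad_K_m K_inv K_U Ad_inv U_carrier)

lemma Ad_K_B_form: "k \<in> K \<Longrightarrow> Y \<in> \<m> \<Longrightarrow> B_form D lam (Ad D k Y) (Ad D k Z) = B_form D lam Y Z"
  by (rule B_form_invariant) (auto intro: Ad_linear K_U Ad_kil Ad_K_isotropy)

text \<open>The exponential series of an element that preserves \<open>\<p>\<close> maps \<open>\<p>\<close> onto itself.\<close>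

lemma levi_in_K:
  assumes Y: "Y \<in> levi" shows "E Y \<in> K"
proof -
  have sub: "Ad D (E Z) ` \<p> \<subseteq> \<p>" if "Z \<in> levi" for Z
    unfolding Ad_E by (auto intro: ad.exp_act_in_subspace[OF p_real_subspace] levi_preserves_p[OF that])
  have "x \<in> Ad D (E Y) ` \<p>" if x: "x \<in> \<p>" for x
  proof -
    have "Ad D (E (- Y)) x \<in> \<p>" using sub[OF subspace_neg[OF levi_subspace Y]] x by blast
    moreover have "x = Ad D (E Y) (Ad D (E (- Y)) x)" by (simp add: E_neg Ad_inv E_carrier)
    ultimately show ?thesis by blast
  qed
  then have "Ad D (E Y) ` \<p> = \<p>" using sub[OF Y] by blast
  then show ?thesis using U_E levi_subset_u Y E_carrier by (auto simp: K_grp_def P_grp_def)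
qed

lemma levi_k_Theta: "levi \<subseteq> k_Theta D"
  using levi_in_K subspace_scale[OF levi_subspace] by (auto simp: k_Theta_def)

text \<open>This is the derivative of \<open>Ad_K_mC_part\<close> along the one-parameter group of \<open>Y\<close>.\<close>

lemma k_Theta_mC_part:
  assumes "Y \<in> k_Theta D" shows "br Y (mC_part z) = mC_part (br Y z)"
proof -
  have "bounded_linear mC_part" using linear_smult_real[OF mC_part_linear] linear_linear by blast
  from bounded_linear.has_vector_derivative[OF this Ad_derivative_zero[of Y z]]
  have "((\<lambda>t. mC_part (Ad D (E (t *\<^sub>R Y)) z)) has_vector_derivative mC_part (br Y z)) (at 0)" .
  moreover have "mC_part (Ad D (E (t *\<^sub>R Y)) z) = Ad D (E (t *\<^sub>R Y)) (mC_part z)" for t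
    using assms by (intro Ad_K_mC_part) (simp add: k_Theta_def)
  ultimately have "((\<lambda>t. Ad D (E (t *\<^sub>R Y)) (mC_part z)) has_vector_derivative mC_part (br Y z)) (at 0)" by simp
  then show ?thesis using Ad_derivative_zero vector_derivative_unique_at by blast
qed

text \<open>Two decompositions of \<open>Y\<close> differ by an element of \<open>\<m>\<close> in the Lie algebra of \<open>K\<close>. It commutes with the
projection to \<open>mC\<close>, hence vanishes. So the sum of \<open>\<k>\<^sub>\<Theta>\<close> and \<open>\<m>\<close> is direct.\<close>

lemma proj_m_eq_m_part:
  assumes Y: "Y \<in> \<u>" shows "proj_m D Y = m_part Y"
  unfolding proj_m_def
proof (rule the_equality)
  show 1: "m_part Y \<in> \<m> \<and> Y - m_part Y \<in> k_Theta D" using m_part_in u_decomposition[OF Y] levi_k_Theta by blast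
  fix Z assume Z: "Z \<in> \<m> \<and> Y - Z \<in> k_Theta D"
  have "Z - m_part Y = 0"
  proof (rule commuting_with_mC_part_trivial)
    show "Z - m_part Y \<in> \<m>" using Z m_part_in subspace_diff[OF m_subspace] by blast
    fix z
    have e: "Z - m_part Y = (Y - m_part Y) - (Y - Z)" by simp
    show "br (Z - m_part Y) (mC_part z) = mC_part (br (Z - m_part Y) z)"
      unfolding e br_diff_left[of "Y - m_part Y" "Y - Z"] vec.linear_diff[OF mC_part_linear]
      using k_Theta_mC_part 1 Z by simp
  qed
  then show "Z = m_part Y" by simp
qed

section \<open>The logarithm near the unit of the compact group\<close>

text \<open>The adjoint representation is injective, so it has a linear left inverse on matrices. A left inverse
is given here by its effect on the columns \<open>[h, e\<^sub>j]\<close> of the matrix of \<open>ad h\<close>.\<close>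

lemma bracket_left_inverse:
  "\<exists>P :: 'n \<Rightarrow> complex ^ 'n \<Rightarrow> complex ^ 'n. (\<forall>j. bounded_linear (P j)) \<and> (\<forall>h. (\<Sum>j\<in>UNIV. P j (br h (axis j 1))) = h)"
proof -
  let ?M = "\<lambda>h. matrix (br h)"
  have lin: "linear ?M"
    by (rule linearI) (simp_all add: matrix_def vec_eq_iff br_simps br_scaleR)
  have "inj ?M"
    unfolding linear_injective_0[OF lin]
  proof (intro allI impI)
    fix h assume h: "?M h = 0"
    show "h = 0"
    proof (rule center_trivial)
      fix y show "br h y = 0" using matrix_works[OF br_linear(1), of h y] unfolding h by simp
    qed
  qed
  then obtain Q where Q: "linear Q" "Q \<circ> ?M = id" using linear_injective_left_inverse[OF lin] by blast
  define C where "C j v = (\<chi> i k. if k = j then v $ i else 0)" for j :: 'n and v :: "complex ^ 'n"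
  have C: "linear (C j)" for j by (rule linearI) (auto simp: C_def vec_eq_iff)
  have M: "(\<Sum>j\<in>UNIV. C j (br h (axis j 1))) = ?M h" for h
    by (simp add: vec_eq_iff C_def matrix_def)
  have "(\<Sum>j\<in>UNIV. Q (C j (br h (axis j 1)))) = h" for h
    using linear_sum[OF Q(1), of "\<lambda>j. C j (br h (axis j 1))" UNIV] M[of h] fun_cong[OF Q(2), of h] by simp
  moreover have "bounded_linear (\<lambda>v. Q (C j v))" for j
    using linear_compose[OF C Q(1)] linear_linear by (auto simp: o_def)
  ultimately show ?thesis by (intro exI[of _ "\<lambda>j v. Q (C j v)"]) blast
qed

text \<open>The function \<open>\<Psi>(Z)\<close> depends only on \<open>Ad(exp Z)\<close> and has derivative the identity at 0. So it recovers a small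
\<open>Z\<close>, to first order even explicitly, from the adjoint action.\<close>

lemma adjoint_chart:
  "\<exists>(P :: 'n \<Rightarrow> complex ^ 'n \<Rightarrow> complex ^ 'n) \<Psi> r. r > 0 \<and> (\<forall>j. bounded_linear (P j)) \<and>
     (\<forall>h. (\<Sum>j\<in>UNIV. P j (br h (axis j 1))) = h) \<and>
     (\<forall>Z. \<Psi> Z = (\<Sum>j\<in>UNIV. P j (Ad D (E Z) (axis j 1)))) \<and>
     inj_on \<Psi> (ball 0 r) \<and> (\<Psi> has_derivative (\<lambda>h. h)) (at 0) \<and> continuous_on UNIV \<Psi>"
proof -
  obtain P :: "'n \<Rightarrow> complex ^ 'n \<Rightarrow> complex ^ 'n" where
    P: "\<And>j. bounded_linear (P j)" "\<And>h. (\<Sum>j\<in>UNIV. P j (br h (axis j 1))) = h"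
    using bracket_left_inverse by blast
  define \<Psi> where "\<Psi> Z = (\<Sum>j\<in>UNIV. P j (exp_act br (axis j 1) [] Z))" for Z
  have sm: "Ck_on k \<Psi> UNIV" for k
  proof -
    have "Ck_on k (exp_act br v []) UNIV" for v
      using ad.smooth_exp_act[of v "[]"] unfolding smooth_on_def by blast
    then show ?thesis unfolding \<Psi>_def by (intro Ck_on_sum Ck_on_linear[OF P(1)] accessible_UNIV)
  qed
  have "(\<Psi> has_derivative (\<lambda>h. \<Sum>j\<in>UNIV. P j (exp_act br (axis j 1) [h] 0))) (at 0)"
    unfolding \<Psi>_def by (intro has_derivative_sum bounded_linear.has_derivative[OF P(1)] ad.exp_act_derivative)
  then have der: "(\<Psi> has_derivative (\<lambda>h. h)) (at 0)" by (simp add: ad.exp_act_zero_direction P(2))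
  have "frechet_derivative \<Psi> (at 0) = (\<lambda>h. h)" using frechet_derivative_at[OF der] by simp
  then have inj: "inj (frechet_derivative \<Psi> (at 0))" by simp
  obtain r where "r > 0" "inj_on \<Psi> (ball 0 r)"
    using C1_locally_injective[OF open_UNIV UNIV_I sm inj] by blast
  moreover have "\<Psi> Z = (\<Sum>j\<in>UNIV. P j (Ad D (E Z) (axis j 1)))" for Z by (simp add: \<Psi>_def Ad_E)
  ultimately show ?thesis using P der Ck_on_continuous[OF sm] by blast
qed

lemma Ad_E_locally_injective:
  "\<exists>r>0. \<forall>Z Z'. norm Z < r \<longrightarrow> norm Z' < r \<longrightarrow> (\<forall>v. Ad D (E Z) v = Ad D (E Z') v) \<longrightarrow> Z = Z'"
proof -
  obtain P :: "'n \<Rightarrow> complex ^ 'n \<Rightarrow> complex ^ 'n" and \<Psi> r where r: "r > 0"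
    and \<Psi>: "\<And>Z. \<Psi> Z = (\<Sum>j\<in>UNIV. P j (Ad D (E Z) (axis j 1)))" and inj: "inj_on \<Psi> (ball 0 r)"
    using adjoint_chart by blast
  have "Z = Z'" if "norm Z < r" "norm Z' < r" "\<forall>v. Ad D (E Z) v = Ad D (E Z') v" for Z Z'
    by (rule inj_onD[OF inj]) (use that in \<open>simp_all add: \<Psi>\<close>)
  then show ?thesis using r by blast
qed

lemma scale_i_twice: "\<i> *s (\<i> *s x) = - (x :: complex ^ 'n)"
  by (simp add: vec_eq_iff)

text \<open>If \<open>\<u>\<close> meets \<open>i\<u>\<close>, the intersection is a nonzero complex ideal, so \<open>\<u>\<close> is everything. Otherwise
\<open>\<theta>(a + ib) = a - ib\<close>, for \<open>a\<close>, \<open>b\<close> in \<open>\<u>\<close>, is a well-defined automorphism of the real Lie algebra, which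
commutes with \<open>Ad(U)\<close>. If \<open>exp Z\<close> is in \<open>U\<close>, this gives \<open>Ad(exp \<theta>Z) = \<theta> Ad(exp Z) \<theta> = Ad(exp Z)\<close>, hence \<open>\<theta>Z = Z\<close> for
small \<open>Z\<close>, i.e. \<open>Z\<close> is in \<open>\<u>\<close>.\<close>

lemma log_in_u: "\<exists>r>0. \<forall>Z. norm Z < r \<longrightarrow> E Z \<in> U \<longrightarrow> Z \<in> \<u>"
proof (cases "\<exists>z. z \<noteq> 0 \<and> z \<in> \<u> \<and> \<i> *s z \<in> \<u>")
  case True
  then obtain z where z: "z \<noteq> 0" "z \<in> \<u>" "\<i> *s z \<in> \<u>" by blast
  let ?I = "{x. x \<in> \<u> \<and> \<i> *s x \<in> \<u>}"
  have cs: "c *s x = Re c *\<^sub>R x + Im c *\<^sub>R (\<i> *s x)" for c and x :: "complex ^ 'n"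
    unfolding scaleR_eq_smult by (subst complex_eq[of c]) (simp add: vec_eq_iff algebra_simps)
  have "?I = UNIV"
  proof (rule ideal_trivial[of _ z])
    show "vec.subspace ?I"
      unfolding vec.subspace_def
    proof (intro conjI ballI allI)
      show "0 \<in> ?I" using subspace_0[OF subspace_u] by simp
      show "x + y \<in> ?I" if "x \<in> ?I" "y \<in> ?I" for x y
        using that subspace_add[OF subspace_u] by (simp add: vec.scale_right_distrib)
      fix c x assume x: "x \<in> ?I"
      have "Re c *\<^sub>R x + Im c *\<^sub>R (\<i> *s x) \<in> \<u>"
        using x subspace_u by (intro subspace_add subspace_scale) auto
      then have "c *s x \<in> \<u>" using cs[of c x] by simp
      moreover have "\<i> *s (c *s x) = c *s (\<i> *s x)" by (simp add: vec_eq_iff)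
      moreover have "c *s (\<i> *s x) \<in> \<u>"
      proof -
        have "Re c *\<^sub>R (\<i> *s x) + Im c *\<^sub>R (- x) \<in> \<u>"
          using x subspace_u by (intro subspace_add subspace_scale subspace_neg) auto
        then show ?thesis using cs[of c "\<i> *s x"] unfolding scale_i_twice by simp
      qed
      ultimately show "c *s x \<in> ?I" by (simp only: mem_Collect_eq)
    qed
    fix y x assume x: "x \<in> ?I"
    obtain a b where y: "y = a + \<i> *s b" and ab: "a \<in> \<u>" "b \<in> \<u>" using u_complexification[of y] by blast
    have "br y x = br a x + br b (\<i> *s x)" by (simp add: y br_simps)
    moreover have "\<i> *s br y x = br a (\<i> *s x) - br b x" by (simp add: y br_simps vec.scale_right_distrib scale_i_twice)
    moreover have "br a x \<in> \<u>" "br b x \<in> \<u>" "br a (\<i> *s x) \<in> \<u>" "br b (\<i> *s x) \<in> \<u>"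
      using x ab u_closed by auto
    ultimately show "br y x \<in> ?I"
      using subspace_add[OF subspace_u] subspace_diff[OF subspace_u] by simp
  qed (use z in auto)
  then show ?thesis by (intro exI[of _ 1]) auto
next
  case False
  have uniq: "a = a' \<and> b = b'" if m: "a \<in> \<u>" "b \<in> \<u>" "a' \<in> \<u>" "b' \<in> \<u>" and e: "a + \<i> *s b = a' + \<i> *s b'" for a b a' b'
  proof -
    have "a - a' = \<i> *s (b' - b)" using e by (simp add: vec_eq_iff algebra_simps)
    then have "\<i> *s (b' - b) \<in> \<u>" using m subspace_diff[OF subspace_u] by metis
    moreover have "b' - b \<in> \<u>" using m subspace_diff[OF subspace_u] by blast
    ultimately have "b' - b = 0" using False by blast
    then show ?thesis using e by simp
  qed
  have "\<forall>x. \<exists>a. a \<in> \<u> \<and> (\<exists>b\<in>\<u>. x = a + \<i> *s b)" using u_complexification by blast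
  from choice[OF this] obtain ra where ra: "\<And>x. ra x \<in> \<u> \<and> (\<exists>b\<in>\<u>. x = ra x + \<i> *s b)" by blast
  have "\<forall>x. \<exists>b. b \<in> \<u> \<and> x = ra x + \<i> *s b" using ra by blast
  from choice[OF this] obtain ia where ia: "\<And>x. ia x \<in> \<u> \<and> x = ra x + \<i> *s ia x" by blast
  define \<theta> where "\<theta> x = ra x - \<i> *s ia x" for x
  have th: "\<theta> (a + \<i> *s b) = a - \<i> *s b" if "a \<in> \<u>" "b \<in> \<u>" for a b
  proof -
    let ?x = "a + \<i> *s b"
    have "ra ?x = a \<and> ia ?x = b"
      by (rule uniq) (use ra[of ?x] ia[of ?x] that in auto)
    then show ?thesis unfolding \<theta>_def by simp
  qed
  have dec: "\<exists>a b. a \<in> \<u> \<and> b \<in> \<u> \<and> x = a + \<i> *s b" for x using u_complexification by blast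
  have th_linear: "linear \<theta>"
  proof (rule linearI)
    fix x y :: "complex ^ 'n" and c :: real
    obtain a b where x: "a \<in> \<u>" "b \<in> \<u>" "x = a + \<i> *s b" using dec by blast
    obtain a' b' where y: "a' \<in> \<u>" "b' \<in> \<u>" "y = a' + \<i> *s b'" using dec by blast
    have "x + y = (a + a') + \<i> *s (b + b')" by (simp add: x y vec.scale_right_distrib)
    then have "\<theta> (x + y) = (a + a') - \<i> *s (b + b')"
      using th[OF subspace_add[OF subspace_u x(1) y(1)] subspace_add[OF subspace_u x(2) y(2)]] by simp
    then show "\<theta> (x + y) = \<theta> x + \<theta> y" by (simp add: x y th vec.scale_right_distrib)
    have "c *\<^sub>R x = c *\<^sub>R a + \<i> *s (c *\<^sub>R b)" by (simp add: x vec_eq_iff algebra_simps)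
    then have "\<theta> (c *\<^sub>R x) = c *\<^sub>R a - \<i> *s (c *\<^sub>R b)"
      using th[OF subspace_scale[OF subspace_u x(1)] subspace_scale[OF subspace_u x(2)]] by simp
    then show "\<theta> (c *\<^sub>R x) = c *\<^sub>R \<theta> x" by (simp add: x th vec_eq_iff algebra_simps)
  qed
  have th_br: "\<theta> (br x y) = br (\<theta> x) (\<theta> y)" for x y
  proof -
    obtain a b where x: "a \<in> \<u>" "b \<in> \<u>" "x = a + \<i> *s b" using dec by blast
    obtain a' b' where y: "a' \<in> \<u>" "b' \<in> \<u>" "y = a' + \<i> *s b'" using dec by blast
    have "br x y = (br a a' - br b b') + \<i> *s (br a b' + br b a')"
      by (simp add: x y br_simps vec_eq_iff algebra_simps)
    then have "\<theta> (br x y) = (br a a' - br b b') - \<i> *s (br a b' + br b a')"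
      using th[OF subspace_diff[OF subspace_u u_closed[OF x(1) y(1)] u_closed[OF x(2) y(2)]]
          subspace_add[OF subspace_u u_closed[OF x(1) y(2)] u_closed[OF x(2) y(1)]]] by simp
    then show ?thesis by (simp add: x y th br_simps vec_eq_iff algebra_simps)
  qed
  have th_th: "\<theta> (\<theta> x) = x" for x
  proof -
    obtain a b where x: "a \<in> \<u>" "b \<in> \<u>" "x = a + \<i> *s b" using dec by blast
    have "\<theta> x = a + \<i> *s (- b)" using x th by (simp add: vec.scale_minus_right)
    then show ?thesis using th[OF x(1) subspace_neg[OF subspace_u x(2)]] x(3) by (simp add: vec.scale_minus_right)
  qed
  have bl: "bounded_linear \<theta>" using th_linear linear_linear by blast
  have th_exp: "exp_act br (\<theta> w) [] (\<theta> Y) = \<theta> (exp_act br w [] Y)" for w Y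
  proof -
    have "((\<lambda>t. \<theta> (exp_act br w [] (t *\<^sub>R Y))) has_vector_derivative br (\<theta> Y) (\<theta> (exp_act br w [] (t *\<^sub>R Y)))) (at t)" for t
      using bounded_linear.has_vector_derivative[OF bl ad.exp_act_flow[of w Y t]] by (simp add: th_br)
    from ad.linear_ode_unique[OF this, of 1] show ?thesis by (simp add: ad.exp_act_zero)
  qed
  have th_Ad: "\<theta> (Ad D x v) = Ad D x (\<theta> v)" if x: "x \<in> U" for x v
  proof -
    obtain a b where v: "a \<in> \<u>" "b \<in> \<u>" "v = a + \<i> *s b" using dec by blast
    have "Ad D x v = Ad D x a + \<i> *s Ad D x b"
      by (simp add: v(3) vec.linear_add[OF Ad_complex_linear[OF x]] vec.linear_scale[OF Ad_complex_linear[OF x]])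
    then have "\<theta> (Ad D x v) = Ad D x a - \<i> *s Ad D x b" using th[OF Ad_u[OF x v(1)] Ad_u[OF x v(2)]] by simp
    then show ?thesis
      by (simp add: v th vec.linear_diff[OF Ad_complex_linear[OF x]] vec.linear_scale[OF Ad_complex_linear[OF x]])
  qed
  obtain B where B: "B > 0" "\<And>x. norm (\<theta> x) \<le> norm x * B" using bounded_linear.pos_bounded[OF bl] by blast
  obtain r where r: "r > 0" "\<And>Z Z'. norm Z < r \<Longrightarrow> norm Z' < r \<Longrightarrow> (\<forall>v. Ad D (E Z) v = Ad D (E Z') v) \<Longrightarrow> Z = Z'"
    using Ad_E_locally_injective by blast
  have "Z \<in> \<u>" if Z: "norm Z < min r (r / B)" and ZU: "E Z \<in> U" for Z
  proof -
    have "norm Z * B < r" using Z B(1) by (simp add: pos_less_divide_eq)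
    then have n: "norm (\<theta> Z) < r" using B(2)[of Z] by simp
    have "Ad D (E (\<theta> Z)) v = Ad D (E Z) v" for v
      using th_exp[of "\<theta> v" Z] th_Ad[OF ZU, of "\<theta> v"] by (simp add: th_th Ad_E)
    then have "\<theta> Z = Z" using r(2)[OF n] Z by simp
    then have "Z - \<i> *s ia Z - \<i> *s ia Z = Z" using ia[of Z] unfolding \<theta>_def by (metis add_diff_cancel_right')
    then have "ia Z = 0" by (simp add: vec_eq_iff)
    then show ?thesis using ia[of Z] ra[of Z] by simp
  qed
  moreover have "min r (r / B) > 0" using r(1) B(1) by simp
  ultimately show ?thesis by blast
qed

text \<open>The logarithm of the curve is obtained from the local inverse of the exponential map, which is only
known to be continuous. Its derivative is found from the adjoint action: \<open>\<Psi>(Z(\<tau>))\<close> is a linear function of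
\<open>Ad(c(\<tau>))\<close>, and \<open>\<Psi>\<close> has an inverse that is differentiable at the origin.\<close>

lemma logarithmic_curve:
  assumes c: "continuous_map (top_of_set S) (gtop D) c" "t \<in> S" "c t = \<e>" and cU: "\<And>\<tau>. \<tau> \<in> S \<Longrightarrow> c \<tau> \<in> U"
    and der: "\<And>v. ((\<lambda>\<tau>. Ad D (c \<tau>) v) has_vector_derivative br W v) (at t within S)"
  shows "\<exists>Z d. d > 0 \<and> (\<forall>\<tau>\<in>S. dist \<tau> t < d \<longrightarrow> c \<tau> = E (Z \<tau>)) \<and> (\<forall>\<tau>. Z \<tau> \<in> \<u>) \<and> Z t = 0 \<and>
    (Z has_vector_derivative W) (at t within (S :: real set))"
proof -
  obtain r0 where r0: "r0 > 0" "\<And>Z. norm Z < r0 \<Longrightarrow> E Z \<in> U \<Longrightarrow> Z \<in> \<u>" using log_in_u by blast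
  obtain P :: "'n \<Rightarrow> complex ^ 'n \<Rightarrow> complex ^ 'n" and \<Psi> r1 where r1: "r1 > 0" and P: "\<And>j. bounded_linear (P j)"
    "\<And>h. (\<Sum>j\<in>UNIV. P j (br h (axis j 1))) = h"
    and \<Psi>: "\<And>Z. \<Psi> Z = (\<Sum>j\<in>UNIV. P j (Ad D (E Z) (axis j 1)))" and inj: "inj_on \<Psi> (ball 0 r1)"
    and d\<Psi>: "(\<Psi> has_derivative (\<lambda>h. h)) (at 0)" and cont: "continuous_on UNIV \<Psi>"
    using adjoint_chart by blast
  define r where "r = min inj_radius (min r0 r1)"
  have r: "r > 0" "r \<le> inj_radius" "r \<le> r0" "r \<le> r1" using inj_radius_pos r0 r1 by (auto simp: r_def)
  obtain d where d: "d > 0" "\<And>\<tau>. \<tau> \<in> S \<Longrightarrow> dist \<tau> t < d \<Longrightarrow> c \<tau> \<in> E ` ball 0 r"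
    using eventually_near_unit[OF c r(1,2)] by blast
  define Z where "Z \<tau> = (if \<tau> \<in> S \<and> dist \<tau> t < d then SOME z. norm z < r \<and> E z = c \<tau> else 0)" for \<tau>
  have Z: "norm (Z \<tau>) < r \<and> E (Z \<tau>) = c \<tau>" if "\<tau> \<in> S" "dist \<tau> t < d" for \<tau>
  proof -
    have "\<exists>z. norm z < r \<and> E z = c \<tau>" using d(2)[OF that] by (auto simp: image_iff)
    from someI_ex[OF this] show ?thesis using that by (simp add: Z_def)
  qed
  have Zu: "Z \<tau> \<in> \<u>" for \<tau>
  proof (cases "\<tau> \<in> S \<and> dist \<tau> t < d")
    case True
    then show ?thesis using Z[of \<tau>] r0(2)[of "Z \<tau>"] cU[of \<tau>] r(3) by simp
  next
    case False
    then have "Z \<tau> = 0" unfolding Z_def by (rule if_not_P)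
    then show ?thesis using subspace_0[OF subspace_u] by simp
  qed
  have Zt: "Z t = 0"
    by (rule E_inj_norm) (use Z[OF c(2)] d(1) r(2) inj_radius_pos c(3) E_zero in auto)
  \<comment> \<open>the function \<open>\<Psi>(Z(\<tau>))\<close>, in terms of the curve\<close>
  define Gc where "Gc \<tau> = (\<Sum>j\<in>UNIV. P j (Ad D (c \<tau>) (axis j 1)))" for \<tau>
  have "(Gc has_vector_derivative (\<Sum>j\<in>UNIV. P j (br W (axis j 1)))) (at t within S)"
    unfolding Gc_def by (intro has_vector_derivative_sum bounded_linear.has_vector_derivative[OF P(1)] der)
  then have dG: "(Gc has_vector_derivative W) (at t within S)" unfolding P(2) .
  let ?B = "ball (0 :: complex ^ 'n) r"
  have injB: "inj_on \<Psi> ?B" by (rule inj_on_subset[OF inj]) (use r in auto)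
  have contB: "continuous_on ?B \<Psi>" using cont continuous_on_subset by blast
  obtain g where g: "homeomorphism ?B (\<Psi> ` ?B) \<Psi> g"
    by (rule invariance_of_domain_homeomorphism[OF open_ball contB order_refl injB])
  have oB: "open (\<Psi> ` ?B)" by (rule invariance_of_domain[OF contB open_ball injB])
  have 0: "0 \<in> ?B" using r by simp
  have g0: "g (\<Psi> 0) = 0" using g 0 by (simp add: homeomorphism_def)
  have dg: "(g has_derivative (\<lambda>h. h)) (at (\<Psi> 0))"
  proof (rule has_derivative_inverse_basic[of \<Psi> "\<lambda>h. h"])
    show "(\<Psi> has_derivative (\<lambda>h. h)) (at (g (\<Psi> 0)))" using d\<Psi> g0 by simp
    show "continuous (at (\<Psi> 0)) g"
    proof -
      have "continuous_on (\<Psi> ` ?B) g" using g unfolding homeomorphism_def by blast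
      moreover have "\<Psi> 0 \<in> \<Psi> ` ?B" using 0 by blast
      ultimately show ?thesis using continuous_on_eq_continuous_at[OF oB, of g] by blast
    qed
    show "\<Psi> (g z) = z" if "z \<in> \<Psi> ` ?B" for z using g that by (auto simp: homeomorphism_def)
  qed (use oB 0 in \<open>auto simp: bounded_linear_ident\<close>)
  have Gt: "Gc t = \<Psi> 0" by (simp add: Gc_def \<Psi> c(3) E_zero)
  have "((g \<circ> Gc) has_vector_derivative W) (at t within S)"
    by (rule vector_derivative_diff_chain_within[OF dG has_derivative_at_withinI]) (simp add: Gt dg)
  then have dZ: "(Z has_vector_derivative W) (at t within S)"
  proof (rule has_vector_derivative_transform_within[OF _ d(1) c(2)])
    fix \<tau> assume t: "\<tau> \<in> S" "dist \<tau> t < d"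
    have "Gc \<tau> = \<Psi> (Z \<tau>)" using Z[OF t] by (simp add: Gc_def \<Psi>)
    moreover have "Z \<tau> \<in> ?B" using Z[OF t] by simp
    ultimately show "(g \<circ> Gc) \<tau> = Z \<tau>" using g by (simp add: homeomorphism_def)
  qed
  show ?thesis
    by (intro exI[of _ Z] exI[of _ d] conjI ballI impI allI d(1) Zu Zt dZ) (use Z in simp)
qed

section \<open>Tangent vectors and the invariant metric\<close>

text \<open>The point \<open>xK\<close> of the flag manifold.\<close>

definition point where "point x = act D x (origin D)"

lemma origin_eq: "origin D = K"
  unfolding origin_def by (rule G.lcos_mult_one) (use K_U U_carrier in blast)

lemma K_carrier: "K \<subseteq> carrier G" using K_U U_carrier by blast

lemma act_point: "g \<in> carrier G \<Longrightarrow> x \<in> carrier G \<Longrightarrow> act D g (point x) = point (g \<odot> x)"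
  unfolding point_def origin_eq by (rule G.lcos_m_assoc[OF K_carrier])

lemma mem_point: "y \<in> point x \<longleftrightarrow> (\<exists>k\<in>K. y = x \<odot> k)"
  by (auto simp: point_def origin_eq l_coset_def)

lemma point_self: "x \<in> carrier G \<Longrightarrow> x \<in> point x"
  unfolding mem_point using subgroup.one_closed[OF K_subgroup] by (metis G.r_one)

lemma point_eqD: "x \<in> carrier G \<Longrightarrow> y \<in> carrier G \<Longrightarrow> point x = point y \<Longrightarrow> \<exists>k\<in>K. y = x \<odot> k"
  using point_self[of y] mem_point by metis

lemma point_mult_K:
  assumes x: "x \<in> carrier G" and k: "k \<in> K" shows "point (x \<odot> k) = point x"
proof (rule Set.set_eqI)
  have kc: "k \<in> carrier G" using k K_carrier by blast
  fix y show "y \<in> point (x \<odot> k) \<longleftrightarrow> y \<in> point x"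
  proof
    assume "y \<in> point (x \<odot> k)"
    then obtain k' where k': "k' \<in> K" "y = x \<odot> k \<odot> k'" by (auto simp: mem_point)
    then have "y = x \<odot> (k \<odot> k')" using x kc K_carrier by (simp add: G.m_assoc subset_iff)
    then show "y \<in> point x" unfolding mem_point using subgroup.m_closed[OF K_subgroup k k'(1)] by blast
  next
    assume "y \<in> point x"
    then obtain k' where k': "k' \<in> K" "y = x \<odot> k'" by (auto simp: mem_point)
    have "y = x \<odot> k \<odot> (ginv k \<odot> k')"
    proof -
      have k'c: "k' \<in> carrier G" using k'(1) K_carrier by blast
      have "k \<odot> (ginv k \<odot> k') = k'" using kc k'c by (simp add: G.m_assoc[symmetric])
      then show ?thesis using k' x kc k'c by (simp add: G.m_assoc)
    qed
    then show "y \<in> point (x \<odot> k)" unfolding mem_point using subgroup.m_closed[OF K_subgroup K_inv[OF k] k'(1)] by blast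
  qed
qed

text \<open>Some linear projection onto \<open>\<u>\<close>. It extends functions of \<open>Y\<close> in \<open>\<u>\<close> to the whole space, on which
derivatives are available.\<close>

definition projU :: "complex ^ 'n \<Rightarrow> complex ^ 'n" where "projU = (SOME L. linear L \<and> range L \<subseteq> \<u> \<and> (\<forall>x\<in>\<u>. L x = x))"

lemma projU: "linear projU" "range projU \<subseteq> \<u>" "x \<in> \<u> \<Longrightarrow> projU x = x"
proof -
  have "\<exists>L. linear L \<and> range L \<subseteq> \<u> \<and> (\<forall>x\<in>\<u>. L x = x)"
    using real_vector.linear_exists_left_inverse_on[OF real_vector.linear_id subspace_u, of] by auto
  from someI_ex[OF this] show "linear projU" "range projU \<subseteq> \<u>" "x \<in> \<u> \<Longrightarrow> projU x = x"
    unfolding projU_def by blast+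
qed

abbreviation SF where "SF \<equiv> smooth_funs D"

lemma SF_smooth:
  assumes "\<phi> \<in> SF" "g \<in> U" "linear (L :: complex ^ 'n \<Rightarrow> complex ^ 'n)" "range L \<subseteq> \<u>"
  shows "smooth_on (\<lambda>Y. \<phi> (point (g \<odot> E (L Y)))) UNIV"
proof -
  have "smooth_on (\<lambda>Y. \<phi> (act D g (act D (E (L Y)) (origin D)))) UNIV"
    using assms by (simp add: smooth_funs_def)
  then show ?thesis using act_point[OF U_carrier[OF assms(2)] E_carrier] by (simp add: point_def)
qed

lemma SF_act:
  assumes "\<phi> \<in> SF" "g \<in> U" shows "(\<lambda>x. \<phi> (act D g x)) \<in> SF"
  unfolding smooth_funs_def
proof (intro CollectI ballI allI impI)
  fix g' and L :: "complex ^ 'n \<Rightarrow> complex ^ 'n" assume g': "g' \<in> U" and L: "linear L \<and> range L \<subseteq> \<u>"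
  have "act D g (act D g' (act D (E (L Y)) (origin D))) = point (g \<odot> g' \<odot> E (L Y))" for Y
    using assms(2) g' U_carrier E_carrier by (simp add: point_def[symmetric] act_point G.m_assoc)
  then show "smooth_on (\<lambda>Y. \<phi> (act D g (act D g' (act D (E (L Y)) (origin D))))) UNIV"
    using SF_smooth[OF assms(1) U_mult[OF assms(2) g']] L by simp
qed

text \<open>The linear form \<open>Y \<mapsto> d/dt \<phi>(g exp(tY) o)\<close> at \<open>t = 0\<close>, for \<open>Y\<close> in \<open>\<u>\<close>.\<close>

definition dir_deriv where "dir_deriv \<phi> g = frechet_derivative (\<lambda>Y. \<phi> (point (g \<odot> E (projU Y)))) (at 0)"

lemma dir_deriv_derivative:
  assumes "\<phi> \<in> SF" "g \<in> U"
  shows "((\<lambda>Y. \<phi> (point (g \<odot> E (projU Y)))) has_derivative dir_deriv \<phi> g) (at 0)"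
  using Ck_on_SucD[of 0 "\<lambda>Y. \<phi> (point (g \<odot> E (projU Y)))" UNIV 0] SF_smooth[OF assms projU(1,2)]
  unfolding dir_deriv_def smooth_on_def by blast

lemma dir_deriv_linear: "\<phi> \<in> SF \<Longrightarrow> g \<in> U \<Longrightarrow> linear (dir_deriv \<phi> g)"
  using dir_deriv_derivative has_derivative_linear by blast

lemma dir_deriv_curve:
  assumes "\<phi> \<in> SF" "g \<in> U" and Z: "(Z has_vector_derivative W) (at t within S)" "Z t = 0" "\<And>\<tau>. Z \<tau> \<in> \<u>"
  shows "((\<lambda>\<tau>. \<phi> (point (g \<odot> E (Z \<tau>)))) has_vector_derivative dir_deriv \<phi> g W) (at t within S)"
proof -
  have "((\<lambda>Y. \<phi> (point (g \<odot> E (projU Y)))) has_derivative dir_deriv \<phi> g) (at (Z t) within Z ` S)"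
    unfolding Z(2) by (rule has_derivative_at_withinI[OF dir_deriv_derivative[OF assms(1,2)]])
  from vector_derivative_diff_chain_within[OF Z(1) this] show ?thesis
    by (simp add: o_def projU(3)[OF Z(3)])
qed

lemma dir_deriv_ray:
  assumes "\<phi> \<in> SF" "g \<in> U" "Y \<in> \<u>"
  shows "((\<lambda>t. \<phi> (point (g \<odot> E (t *\<^sub>R Y)))) has_vector_derivative dir_deriv \<phi> g Y) (at 0)"
  by (rule dir_deriv_curve[OF assms(1,2)]) (auto intro!: derivative_eq_intros subspace_scale[OF subspace_u] assms(3))

text \<open>Along the group generated by \<open>Y\<close> the point does not move.\<close>

lemma dir_deriv_levi:
  assumes "\<phi> \<in> SF" "g \<in> U" "Y \<in> levi" shows "dir_deriv \<phi> g Y = 0"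
proof -
  have "point (g \<odot> E (t *\<^sub>R Y)) = point g" for t
    using point_mult_K[OF U_carrier[OF assms(2)]] levi_in_K[OF subspace_scale[OF levi_subspace assms(3)]] by blast
  then have "((\<lambda>t. \<phi> (point g)) has_vector_derivative dir_deriv \<phi> g Y) (at 0)"
    using dir_deriv_ray[OF assms(1,2), of Y] assms(3) levi_subset_u by auto
  then show ?thesis using vector_derivative_unique_at[OF _ has_vector_derivative_const] by blast
qed

lemma dir_deriv_m_part:
  assumes "\<phi> \<in> SF" "g \<in> U" "Y \<in> \<u>" shows "dir_deriv \<phi> g (m_part Y) = dir_deriv \<phi> g Y"
  using dir_deriv_levi[OF assms(1,2) u_decomposition[OF assms(3)]] linear_diff[OF dir_deriv_linear[OF assms(1,2)], of Y "m_part Y"] by simp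

abbreviation TV where "TV g Y \<equiv> dphi D g (tangent_o D Y)"

lemma TV_eq:
  assumes g: "g \<in> U" and Y: "Y \<in> \<u>"
  shows "TV g Y = (\<lambda>\<phi>. if \<phi> \<in> SF then dir_deriv \<phi> g Y else 0)"
proof
  fix \<phi>
  show "TV g Y \<phi> = (if \<phi> \<in> SF then dir_deriv \<phi> g Y else 0)"
  proof (cases "\<phi> \<in> SF")
    case True
    have "TV g Y \<phi> = vector_derivative (\<lambda>t. \<phi> (point (g \<odot> E (t *\<^sub>R Y)))) (at 0)"
      using True SF_act[OF True g] act_point[OF U_carrier[OF g] E_carrier]
      by (simp add: dphi_def tangent_o_def velocity_def point_def)
    also have "\<dots> = dir_deriv \<phi> g Y" by (rule vector_derivative_at[OF dir_deriv_ray[OF True g Y]])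
    finally show ?thesis using True by simp
  qed (simp add: dphi_def)
qed

text \<open>A curve that near time \<open>t\<close> has the form \<open>g exp(Z(\<tau>)) o\<close> with \<open>Z(t) = 0\<close> has the velocity given by the part of
\<open>Z'(t)\<close> in \<open>\<m>\<close>.\<close>

lemma velocity_eq:
  assumes g: "g \<in> U" and p: "\<And>\<tau>. \<tau> \<in> S \<Longrightarrow> dist \<tau> t < d \<Longrightarrow> p \<tau> = point (g \<odot> E (Z \<tau>))" and d: "d > 0" and t: "t \<in> S"
    and Z: "(Z has_vector_derivative W) (at t within S)" "Z t = 0" "\<And>\<tau>. Z \<tau> \<in> \<u>" and W: "W \<in> \<u>"
    and nb: "at t within S \<noteq> bot"
  shows "velocity D S p t = TV g (m_part W)"
proof
  fix \<phi>
  show "velocity D S p t \<phi> = TV g (m_part W) \<phi>"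
  proof (cases "\<phi> \<in> SF")
    case True
    have "((\<lambda>\<tau>. \<phi> (p \<tau>)) has_vector_derivative dir_deriv \<phi> g W) (at t within S)"
      by (rule has_vector_derivative_transform_within[OF dir_deriv_curve[OF True g Z] d t]) (simp add: p)
    then have "velocity D S p t \<phi> = dir_deriv \<phi> g W"
      unfolding velocity_def using True vector_derivative_within[OF nb] by simp
    then show ?thesis using True dir_deriv_m_part[OF True g W] TV_eq[OF g] m_part_in m_subset_u by (auto simp: subset_iff)
  next
    case False
    then show ?thesis by (simp add: velocity_def dphi_def)
  qed
qed

text \<open>Matrix coefficients of \<open>x \<mapsto> Ad(x) \<pi> Ad(x)\<^sup>-\<^sup>1\<close> with \<open>\<pi>\<close> the projection to \<open>mC\<close>, as functions of the coset
\<open>xK\<close>. A representative of the coset is chosen; the value does not depend on it, since \<open>Ad(K)\<close> commutes with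
\<open>\<pi>\<close>.\<close>

definition test_fun where
  "test_fun z b S = Ad D (SOME x. x \<in> S) (mC_part (Ad D (ginv (SOME x. x \<in> S)) z)) \<bullet> b"

lemma test_fun_point:
  assumes x: "x \<in> U" shows "test_fun z b (point x) = Ad D x (mC_part (Ad D (ginv x) z)) \<bullet> b"
proof -
  define y where "y = (SOME y. y \<in> point x)"
  have "y \<in> point x" unfolding y_def by (rule someI[of _ x]) (rule point_self[OF U_carrier[OF x]])
  then obtain k where k: "k \<in> K" "y = x \<odot> k" by (auto simp: mem_point)
  have xc: "x \<in> carrier G" and kc: "k \<in> carrier G" using x k U_carrier K_carrier by auto
  have "Ad D y (mC_part (Ad D (ginv y) z)) = Ad D x (Ad D k (mC_part (Ad D (ginv k) (Ad D (ginv x) z))))"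
    using xc kc by (simp add: k(2) Ad_mult G.inv_mult_group)
  also have "\<dots> = Ad D x (mC_part (Ad D k (Ad D (ginv k) (Ad D (ginv x) z))))"
    using Ad_K_mC_part[OF k(1)] by simp
  also have "\<dots> = Ad D x (mC_part (Ad D (ginv x) z))" by (simp add: Ad_inv[OF kc])
  finally show ?thesis unfolding test_fun_def y_def by simp
qed

lemma test_fun_E:
  assumes g: "g \<in> U" and Y: "Y \<in> \<u>"
  shows "test_fun z b (point (g \<odot> E Y)) = Ad D g (exp_act br (mC_part (exp_act br (Ad D (ginv g) z) [] (- Y))) [] Y) \<bullet> b"
  using test_fun_point[OF U_mult[OF g U_E[OF Y]]] U_carrier[OF g] E_carrier
  by (simp add: Ad_mult G.inv_mult_group E_neg[symmetric] Ad_E)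

lemma exp_act_expand: "exp_act br z [] X = (\<Sum>i\<in>Basis. (z \<bullet> i) *\<^sub>R exp_act br i [] X)"
  using linear_sum[OF ad.linear_exp_act, of "\<lambda>i. (z \<bullet> i) *\<^sub>R i" Basis "[]" X] linear_cmul[OF ad.linear_exp_act]
  by (simp add: euclidean_representation)

lemma mC_part_bounded_linear: "bounded_linear mC_part"
  using linear_smult_real[OF mC_part_linear] linear_linear by blast

lemma Ad_bounded_linear: "g \<in> U \<Longrightarrow> bounded_linear (Ad D g)"
  using Ad_linear linear_linear by blast

lemma test_fun_smooth: "test_fun z b \<in> SF"
  unfolding smooth_funs_def
proof (intro CollectI ballI allI impI)
  fix g and L :: "complex ^ 'n \<Rightarrow> complex ^ 'n" assume g: "g \<in> U" and "linear L \<and> range L \<subseteq> \<u>"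
  then have L: "linear L" "\<And>Y. L Y \<in> \<u>" by auto
  let ?z = "Ad D (ginv g) z"
  have e: "test_fun z b (act D g (act D (E (L Y)) (origin D))) =
     Ad D g (\<Sum>i\<in>Basis. (mC_part (exp_act br ?z [] (- L Y)) \<bullet> i) *\<^sub>R exp_act br i [] (L Y)) \<bullet> b" for Y
  proof -
    have 1: "act D g (act D (E (L Y)) (origin D)) = point (g \<odot> E (L Y))"
      using act_point[OF U_carrier[OF g] E_carrier] by (simp add: point_def)
    show ?thesis
      unfolding 1 test_fun_E[OF g L(2)] exp_act_expand[of "mC_part (exp_act br ?z [] (- L Y))" "L Y"] ..
  qed
  have L': "linear (\<lambda>Y. - L Y)" using linear_compose_neg[OF L(1)] .
  have s: "Ck_on k (\<lambda>Y. exp_act br w [] (M Y)) UNIV" if "linear M" for k w and M :: "complex ^ 'n \<Rightarrow> complex ^ 'n"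
  proof -
    have "Ck_on k (exp_act br w []) UNIV" using ad.smooth_exp_act[of w "[]"] unfolding smooth_on_def by blast
    then show ?thesis by (rule Ck_on_compose_linear[OF that accessible_UNIV accessible_UNIV subset_UNIV])
  qed
  have "Ck_on k (\<lambda>Y. (mC_part (exp_act br ?z [] (- L Y)) \<bullet> i) *\<^sub>R exp_act br i [] (L Y)) UNIV" for k i
    by (rule Ck_on_bilinear[OF bounded_bilinear_scaleR accessible_UNIV
          Ck_on_linear[OF bounded_linear_inner_left accessible_UNIV
            Ck_on_linear[OF mC_part_bounded_linear accessible_UNIV s[OF L']]] s[OF L(1)]])
  then have "Ck_on k (\<lambda>Y. Ad D g (\<Sum>i\<in>Basis. (mC_part (exp_act br ?z [] (- L Y)) \<bullet> i) *\<^sub>R exp_act br i [] (L Y)) \<bullet> b) UNIV" for k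
    by (intro Ck_on_linear[OF bounded_linear_inner_left accessible_UNIV
          Ck_on_linear[OF Ad_bounded_linear[OF g] accessible_UNIV Ck_on_sum[OF accessible_UNIV]]])
  then show "smooth_on (\<lambda>Y. test_fun z b (act D g (act D (E (L Y)) (origin D)))) UNIV"
    unfolding e smooth_on_def by blast
qed

text \<open>The derivative of \<open>Ad(exp(tY)) \<pi> Ad(exp(-tY))\<close> is the commutator of \<open>ad Y\<close> and \<open>\<pi>\<close>.\<close>

lemma test_fun_dir_deriv:
  assumes g: "g \<in> U" and Y: "Y \<in> \<u>"
  shows "dir_deriv (test_fun (Ad D g z) b) g Y = Ad D g (br Y (mC_part z) - mC_part (br Y z)) \<bullet> b"
proof -
  have z: "Ad D (ginv g) (Ad D g z) = z" by (rule Ad_inv(2)[OF U_carrier[OF g]])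
  have d1: "((\<lambda>t. mC_part (exp_act br z [] (t *\<^sub>R (- Y)))) has_vector_derivative - mC_part (br Y z)) (at 0)"
    using bounded_linear.has_vector_derivative[OF mC_part_bounded_linear ad.exp_act_flow[of z "- Y" 0]]
    by (simp add: ad.exp_act_zero br_simps vec.linear_neg[OF mC_part_linear])
  have "((\<lambda>t. exp_act br (mC_part (exp_act br z [] (t *\<^sub>R (- Y)))) [] (t *\<^sub>R Y)) has_vector_derivative
      - mC_part (br Y z) + br Y (mC_part z)) (at 0)"
    using ad.exp_act_varying[OF d1, of Y] by (simp add: ad.exp_act_zero)
  from bounded_linear.has_vector_derivative[OF bounded_linear_inner_left
      bounded_linear.has_vector_derivative[OF Ad_bounded_linear[OF g] this], of b]
  have "((\<lambda>t. test_fun (Ad D g z) b (point (g \<odot> E (t *\<^sub>R Y)))) has_vector_derivative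
      Ad D g (- mC_part (br Y z) + br Y (mC_part z)) \<bullet> b) (at 0)"
    unfolding test_fun_E[OF g subspace_scale[OF subspace_u Y]] z by simp
  from vector_derivative_unique_at[OF dir_deriv_ray[OF test_fun_smooth g Y] this] show ?thesis by simp
qed

text \<open>If the two tangent vectors agree on all test functions, then \<open>ad (Y - Y')\<close> commutes with the projection
to \<open>mC\<close>.\<close>

lemma TV_injective:
  assumes g: "g \<in> U" and Y: "Y \<in> \<m>" "Y' \<in> \<m>" and e: "TV g Y = TV g Y'"
  shows "Y = Y'"
proof -
  have u: "Y \<in> \<u>" "Y' \<in> \<u>" using Y m_subset_u by auto
  have "Y - Y' = 0"
  proof (rule commuting_with_mC_part_trivial)
    show m: "Y - Y' \<in> \<m>" by (rule subspace_diff[OF m_subspace Y])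
    fix z
    let ?c = "\<lambda>Y. br Y (mC_part z) - mC_part (br Y z)"
    have "Ad D g (?c Y) \<bullet> b = Ad D g (?c Y') \<bullet> b" for b
      using fun_cong[OF e, of "test_fun (Ad D g z) b"] test_fun_smooth test_fun_dir_deriv[OF g u(1)] test_fun_dir_deriv[OF g u(2)]
      by (simp add: TV_eq[OF g u(1)] TV_eq[OF g u(2)])
    then have "Ad D g (?c Y) = Ad D g (?c Y')" by (rule vector_eq_rdot[THEN iffD1, rule_format])
    then have "?c Y = ?c Y'" using Ad_inv(2)[OF U_carrier[OF g]] by metis
    then show "br (Y - Y') (mC_part z) = mC_part (br (Y - Y') z)"
      by (simp add: br_diff_left vec.linear_diff[OF mC_part_linear] algebra_simps)
  qed
  then show ?thesis by simp
qed

text \<open>\<open>g exp(t Ad(k) Y) = g k exp(tY) k\<^sup>-\<^sup>1\<close>, and the last factor disappears in the quotient.\<close>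

lemma TV_mult_K:
  assumes g: "g \<in> U" and k: "k \<in> K" and Y: "Y \<in> \<m>"
  shows "TV (g \<odot> k) Y = TV g (Ad D k Y)"
proof -
  have u: "Y \<in> \<u>" "Ad D k Y \<in> \<u>" using Y m_subset_u Ad_K_m[OF k Y] by auto
  have gc: "g \<in> carrier G" and kc: "k \<in> carrier G" using g k U_carrier K_carrier by auto
  have "dir_deriv \<phi> (g \<odot> k) Y = dir_deriv \<phi> g (Ad D k Y)" if \<phi>: "\<phi> \<in> SF" for \<phi>
  proof -
    have "point (g \<odot> E (t *\<^sub>R Ad D k Y)) = point (g \<odot> k \<odot> E (t *\<^sub>R Y))" for t
    proof -
      have "g \<odot> E (t *\<^sub>R Ad D k Y) = g \<odot> k \<odot> E (t *\<^sub>R Y) \<odot> ginv k"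
        using gc kc E_carrier by (simp add: Ad_spec[OF kc] G.m_assoc)
      then show ?thesis using point_mult_K[OF _ K_inv[OF k], of "g \<odot> k \<odot> E (t *\<^sub>R Y)"] gc kc E_carrier by simp
    qed
    then show ?thesis
      using vector_derivative_unique_at[OF dir_deriv_ray[OF \<phi> U_mult[OF g K_U[OF k]] u(1)]] dir_deriv_ray[OF \<phi> g u(2)] by simp
  qed
  then show ?thesis using TV_eq[OF g u(2)] TV_eq[OF U_mult[OF g K_U[OF k]] u(1)] by auto
qed

text \<open>The value does not depend on the representative \<open>g\<close>: a change by \<open>k\<close> in \<open>K\<close> transforms the vectors in
\<open>\<m>\<close> by \<open>Ad(k)\<close>, and they are determined by the tangent vectors.\<close>

lemma metric_eq:
  assumes g: "g \<in> U" and Y: "Y \<in> \<m>" and Z: "Z \<in> \<m>"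
  shows "metric D lam (point g) (TV g Y) (TV g Z) = B_form D lam Y Z"
  unfolding metric_def
proof (rule the_equality)
  show "\<exists>g'\<in>U. \<exists>Y'\<in>\<m>. \<exists>Z'\<in>\<m>. point g = act D g' (origin D) \<and> TV g Y = TV g' Y' \<and> TV g Z = TV g' Z' \<and>
      B_form D lam Y Z = B_form D lam Y' Z'"
    using assms by (auto simp: point_def)
  fix r assume "\<exists>g'\<in>U. \<exists>Y'\<in>\<m>. \<exists>Z'\<in>\<m>. point g = act D g' (origin D) \<and> TV g Y = TV g' Y' \<and> TV g Z = TV g' Z' \<and>
      r = B_form D lam Y' Z'"
  then obtain g' Y' Z' where h: "g' \<in> U" "Y' \<in> \<m>" "Z' \<in> \<m>" "point g = point g'" "TV g Y = TV g' Y'" "TV g Z = TV g' Z'"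
    "r = B_form D lam Y' Z'" unfolding point_def[symmetric] by blast
  obtain k where k: "k \<in> K" "g' = g \<odot> k" using point_eqD[OF U_carrier[OF g] U_carrier[OF h(1)] h(4)] by blast
  have "Y = Ad D k Y'" using TV_injective[OF g Y Ad_K_m[OF k(1) h(2)]] h(5) TV_mult_K[OF g k(1) h(2)] k(2) by simp
  moreover have "Z = Ad D k Z'" using TV_injective[OF g Z Ad_K_m[OF k(1) h(3)]] h(6) TV_mult_K[OF g k(1) h(3)] k(2) by simp
  ultimately show "r = B_form D lam Y Z" using Ad_K_B_form[OF k(1) h(2)] h(7) by simp
qed

section \<open>The derivative of the exponential map\<close>

definition ad_retraction :: "'n \<Rightarrow> complex ^ 'n \<Rightarrow> complex ^ 'n" where
  "ad_retraction = (SOME P. (\<forall>j. bounded_linear (P j)) \<and> (\<forall>h. (\<Sum>j\<in>UNIV. P j (br h (axis j 1))) = h))"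

lemma ad_retraction: "bounded_linear (ad_retraction j)" "(\<Sum>j\<in>UNIV. ad_retraction j (br h (axis j 1))) = h"
  using someI_ex[OF bracket_left_inverse] unfolding ad_retraction_def by blast+

text \<open>The derivative of \<open>exp\<close> at \<open>sY\<close> in the direction \<open>s v\<close>, translated back to the unit from the left, that is,
the integral of \<open>Ad(exp(-rY)) v\<close> over \<open>0 \<le> r \<le> s\<close>. In the adjoint representation this derivative is \<open>exp_act\<close>
with one direction, and the retraction returns from there to the Lie algebra. Compared with the
integral, this form shows at once that the value depends continuously on all arguments.\<close>

definition left_dexp where
  "left_dexp Y v s = (\<Sum>j\<in>UNIV. ad_retraction j (exp_act br (exp_act br (axis j 1) [s *\<^sub>R v] (s *\<^sub>R Y)) [] (s *\<^sub>R (- Y))))"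

lemma exp_act_inverse_both: "exp_act br (exp_act br w [] (s *\<^sub>R Y)) [] (s *\<^sub>R (- Y)) = w"
  "exp_act br (exp_act br w [] (s *\<^sub>R (- Y))) [] (s *\<^sub>R Y) = w"
  using ad.exp_act_inverse[of w s Y] ad.exp_act_inverse[of w s "- Y"] by simp_all

lemma exp_act_bracket:
  "Y \<in> \<u> \<Longrightarrow> exp_act br (br w z) [] Y = br (exp_act br w [] Y) (exp_act br z [] Y)"
  using Ad_bracket[OF U_E] by (simp add: Ad_E)

text \<open>The product rule for the flow of \<open>-Y\<close>, applied to the derivative of the flow of \<open>Y\<close>: the terms with \<open>Y\<close>
cancel.\<close>

lemma left_dexp_integrand:
  assumes Y: "Y \<in> \<u>"
  shows "((\<lambda>s. exp_act br (exp_act br z [s *\<^sub>R v] (s *\<^sub>R Y)) [] (s *\<^sub>R (- Y))) has_vector_derivative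
    br (exp_act br v [] (s *\<^sub>R (- Y))) z) (at s)"
proof -
  have d: "((\<lambda>s. exp_act br z [s *\<^sub>R v] (s *\<^sub>R Y)) has_vector_derivative
      br Y (exp_act br z [s *\<^sub>R v] (s *\<^sub>R Y)) + br v (exp_act br z [] (s *\<^sub>R Y))) (at s)"
    using ad.exp_act_time_derivative[of z "[v]" Y s] by simp
  let ?F = "exp_act br z [s *\<^sub>R v] (s *\<^sub>R Y)"
  have "exp_act br (br Y ?F + br v (exp_act br z [] (s *\<^sub>R Y))) [] (s *\<^sub>R (- Y)) + br (- Y) (exp_act br ?F [] (s *\<^sub>R (- Y)))
      = exp_act br (br v (exp_act br z [] (s *\<^sub>R Y))) [] (s *\<^sub>R (- Y))"
    using ad.exp_act_commute[of Y ?F "- s"] by (simp add: linear_add[OF ad.linear_exp_act] br_simps)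
  also have "\<dots> = br (exp_act br v [] (s *\<^sub>R (- Y))) z"
    unfolding exp_act_bracket[OF subspace_scale[OF subspace_u subspace_neg[OF subspace_u Y]]] exp_act_inverse_both ..
  finally show ?thesis using ad.exp_act_varying[OF d, of "- Y"] by simp
qed

lemma left_dexp_derivative:
  assumes "Y \<in> \<u>"
  shows "((\<lambda>s. left_dexp Y v s) has_vector_derivative exp_act br v [] (s *\<^sub>R (- Y))) (at s)"
proof -
  have "((\<lambda>s. left_dexp Y v s) has_vector_derivative (\<Sum>j\<in>UNIV. ad_retraction j (br (exp_act br v [] (s *\<^sub>R (- Y))) (axis j 1)))) (at s)"
    unfolding left_dexp_def
    by (intro has_vector_derivative_sum bounded_linear.has_vector_derivative[OF ad_retraction(1)] left_dexp_integrand[OF assms])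
  then show ?thesis unfolding ad_retraction(2) .
qed

lemma left_dexp_zero: "left_dexp Y v 0 = 0"
  unfolding left_dexp_def
  by (simp add: ad.exp_act_zero_direction ad.exp_act_zero br_simps linear_0[OF bounded_linear.linear[OF ad_retraction(1)]])

lemma vanishing_from_derivative:
  assumes "\<And>s. (f has_vector_derivative 0) (at s)" "f 0 = 0" shows "f s = (0 :: 'v::real_normed_vector)"
proof -
  from has_vector_derivative_zero_constant[OF convex_UNIV, of f] assms(1) obtain c where "\<And>s. f s = c" by auto
  then show ?thesis using assms(2) by metis
qed

text \<open>Both sides, after applying the inverse flow, have the same derivative in \<open>s\<close> and vanish at \<open>s = 0\<close>.\<close>

lemma left_dexp_bracket:
  assumes Y: "Y \<in> \<u>"
  shows "exp_act br z [s *\<^sub>R v] (s *\<^sub>R Y) = exp_act br (br (left_dexp Y v s) z) [] (s *\<^sub>R Y)"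
proof -
  let ?k = "\<lambda>s. exp_act br (exp_act br z [s *\<^sub>R v] (s *\<^sub>R Y)) [] (s *\<^sub>R (- Y))"
  have bl: "bounded_linear (\<lambda>x. br x z)" using bounded_bilinear.bounded_linear_left[OF bounded_bilinear_br] .
  have "?k s - br (left_dexp Y v s) z = 0"
  proof (rule vanishing_from_derivative)
    show "((\<lambda>s. ?k s - br (left_dexp Y v s) z) has_vector_derivative 0) (at s)" for s
      using has_vector_derivative_diff[OF left_dexp_integrand[OF Y, where z=z and v=v and s=s]
          bounded_linear.has_vector_derivative[OF bl left_dexp_derivative[OF Y, where v=v and s=s]]] by simp
    show "?k 0 - br (left_dexp Y v 0) z = 0"
      by (simp add: left_dexp_zero br_simps ad.exp_act_zero_direction ad.exp_act_zero)
  qed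
  then have "?k s = br (left_dexp Y v s) z" by simp
  then show ?thesis by (metis exp_act_inverse_both(2))
qed

lemma left_dexp_in_u:
  assumes Y: "Y \<in> \<u>" and v: "v \<in> \<u>" shows "left_dexp Y v s \<in> \<u>"
proof -
  have bl: "bounded_linear projU" using projU(1) linear_linear by blast
  have mem: "exp_act br v [] (s *\<^sub>R (- Y)) \<in> \<u>" for s
    by (rule ad.exp_act_in_subspace[OF subspace_u u_closed v])
      (rule subspace_scale[OF subspace_u subspace_neg[OF subspace_u Y]])
  have "projU (left_dexp Y v s) - left_dexp Y v s = 0"
  proof (rule vanishing_from_derivative)
    show "((\<lambda>s. projU (left_dexp Y v s) - left_dexp Y v s) has_vector_derivative 0) (at s)" for s
      using has_vector_derivative_diff[OF bounded_linear.has_vector_derivative[OF bl left_dexp_derivative[OF Y, where v=v and s=s]]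
          left_dexp_derivative[OF Y, where v=v and s=s]] projU(3)[OF mem] by simp
    show "projU (left_dexp Y v 0) - left_dexp Y v 0 = 0" by (simp add: left_dexp_zero linear_0[OF projU(1)])
  qed
  then have "left_dexp Y v s = projU (left_dexp Y v s)" by simp
  then show ?thesis using projU(2) by (metis range_subsetD)
qed

lemma derivative_in_u:
  assumes "(f has_vector_derivative f') (at t within S)" "\<And>\<tau>. \<tau> \<in> S \<Longrightarrow> f \<tau> \<in> \<u>" "t \<in> S" "at t within S \<noteq> bot"
  shows "f' \<in> \<u>"
proof -
  have bl: "bounded_linear projU" using projU(1) linear_linear by blast
  have "((\<lambda>\<tau>. projU (f \<tau>)) has_vector_derivative projU f') (at t within S)"
    by (rule bounded_linear.has_vector_derivative[OF bl assms(1)])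
  then have "(f has_vector_derivative projU f') (at t within S)"
    by (rule has_vector_derivative_transform[OF assms(3), rotated]) (simp add: projU(3) assms(2))
  then have "f' = projU f'" using vector_derivative_unique_within[OF assms(4) assms(1)] by blast
  then show ?thesis using projU(2) by (metis range_subsetD)
qed

lemma continuous_on_exp_act:
  assumes "continuous_on T v" "continuous_on T f"
  shows "continuous_on T (\<lambda>x. exp_act br (v x) [] (f x))"
proof -
  have "continuous_on UNIV (exp_act br i [])" for i
    using ad.smooth_exp_act[of i "[]"] Ck_on.simps(1) unfolding smooth_on_def by blast
  then have "continuous_on T (\<lambda>x. exp_act br i [] (f x))" for i
    using continuous_on_compose2[OF _ assms(2)] by blast
  then have "continuous_on T (\<lambda>x. \<Sum>i\<in>Basis. (v x \<bullet> i) *\<^sub>R exp_act br i [] (f x))"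
    by (intro continuous_intros assms(1))
  then show ?thesis unfolding exp_act_expand[symmetric] .
qed

lemma continuous_on_left_dexp:
  assumes "continuous_on T Y" "continuous_on T v" "continuous_on T s"
  shows "continuous_on T (\<lambda>x. left_dexp (Y x) (v x) (s x))"
proof -
  have dir: "continuous_on T (\<lambda>x. exp_act br z [s x *\<^sub>R v x] (s x *\<^sub>R Y x))" for z
  proof -
    have e: "exp_act br z [h] X = (\<Sum>i\<in>Basis. (h \<bullet> i) *\<^sub>R exp_act br z [i] X)" for h X
    proof -
      have l: "linear (\<lambda>h. exp_act br z [h] X)" using has_derivative_linear[OF ad.exp_act_derivative[of z "[]" X]] .
      show ?thesis using linear_sum[OF l, of "\<lambda>i. (h \<bullet> i) *\<^sub>R i" Basis] linear_cmul[OF l]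
        by (simp add: euclidean_representation)
    qed
    have f: "continuous_on T (\<lambda>x. s x *\<^sub>R Y x)" by (intro continuous_intros assms)
    have "continuous_on UNIV (exp_act br z [i])" for i
      using ad.smooth_exp_act[of z "[i]"] Ck_on.simps(1) unfolding smooth_on_def by blast
    then have "continuous_on T (\<lambda>x. exp_act br z [i] (s x *\<^sub>R Y x))" for i
      using continuous_on_compose2[OF _ f] by blast
    then have "continuous_on T (\<lambda>x. \<Sum>i\<in>Basis. (s x *\<^sub>R v x \<bullet> i) *\<^sub>R exp_act br z [i] (s x *\<^sub>R Y x))"
      by (intro continuous_intros assms)
    then show ?thesis unfolding e[symmetric] .
  qed
  have "continuous_on T (\<lambda>x. s x *\<^sub>R (- Y x))" by (intro continuous_intros assms)
  from continuous_on_exp_act[OF dir this]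
  have "continuous_on T (\<lambda>x. ad_retraction j (exp_act br (exp_act br (axis j 1) [s x *\<^sub>R v x] (s x *\<^sub>R Y x)) [] (s x *\<^sub>R (- Y x))))" for j
    by (rule bounded_linear.continuous_on[OF ad_retraction(1)])
  then show ?thesis unfolding left_dexp_def by (intro continuous_on_sum)
qed

lemma exp_act_fixed: "exp_act br X [] (t *\<^sub>R X) = X"
proof -
  have "((\<lambda>t. X) has_vector_derivative br X X) (at t)" for t by (simp add: br_self)
  from ad.linear_ode_unique[OF this, of t] show ?thesis by simp
qed

section \<open>The energy of the variation\<close>

text \<open>The left logarithmic derivative in \<open>t\<close> of \<open>exp(s q(t)) exp(tX)\<close>; the first factor contributes
\<open>left_dexp\<close>, transported by \<open>Ad(exp(-tX))\<close>.\<close>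

definition left_velocity where
  "left_velocity X q a s t = X + exp_act br (left_dexp (q t) (vector_derivative q (at t within {0..a})) s) [] (t *\<^sub>R (- X))"

text \<open>Put \<open>h = exp(s q(t)) exp(tX)\<close>. The curve \<open>c(\<tau>) = h\<^sup>-\<^sup>1 exp(s q(\<tau>)) exp(\<tau>X)\<close> passes through the unit at \<open>\<tau> = t\<close>, and
the product rule for \<open>Ad(exp(s q(\<tau>))) Ad(exp(\<tau>X))\<close> shows that \<open>Ad(c(\<tau>))\<close> has derivative \<open>ad W\<close> there. So \<open>c\<close>
has a logarithm with derivative \<open>W\<close>.\<close>

lemma velocity_variation:
  assumes X: "X \<in> \<m>" and a: "0 < a" and q: "smooth_on q {0..a}" "\<forall>t\<in>{0..a}. q t \<in> \<u>" and t: "t \<in> {0..a}"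
  shows "velocity D {0..a} (variation D X q s) t = TV (E (s *\<^sub>R q t) \<odot> E (t *\<^sub>R X)) (m_part (left_velocity X q a s t))"
    and "variation D X q s t = point (E (s *\<^sub>R q t) \<odot> E (t *\<^sub>R X))"
    and "left_velocity X q a s t \<in> \<u>" and "E (s *\<^sub>R q t) \<odot> E (t *\<^sub>R X) \<in> U"
    and "vector_derivative q (at t within {0..a}) \<in> \<u>"
proof -
  let ?S = "{0..a}"
  let ?q' = "vector_derivative q (at t within ?S)"
  let ?h = "E (s *\<^sub>R q t) \<odot> E (t *\<^sub>R X)"
  let ?W = "left_velocity X q a s t"
  let ?w = "left_dexp (q t) ?q' s"
  have nb: "at t within ?S \<noteq> bot" using a t by (simp add: trivial_limit_within islimpt_Icc)
  have acc: "accessible ?S" by (rule accessible_interval[OF a])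
  have dq: "(q has_vector_derivative ?q') (at t within ?S)" by (rule smooth_on_vector_derivative(2)[OF q(1) acc t])
  show q'u: "?q' \<in> \<u>" by (rule derivative_in_u[OF dq bspec[OF q(2)] t nb])
  have Xu: "X \<in> \<u>" using X m_subset_u by auto
  have su: "r *\<^sub>R Y \<in> \<u>" if "Y \<in> \<u>" for r Y by (rule subspace_scale[OF subspace_u that])
  have mem: "E (s *\<^sub>R q \<tau>) \<odot> E (\<tau> *\<^sub>R X) \<in> U" if "\<tau> \<in> ?S" for \<tau>
    by (intro U_mult U_E su bspec[OF q(2)] Xu that)
  show hU: "?h \<in> U" by (rule mem[OF t])
  have hc: "?h \<in> carrier G" by (rule U_carrier[OF hU])
  have wu: "?w \<in> \<u>" by (rule left_dexp_in_u[OF bspec[OF q(2) t] q'u])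
  have nX: "t *\<^sub>R (- X) \<in> \<u>" by (rule su[OF subspace_neg[OF subspace_u Xu]])
  show Wu: "?W \<in> \<u>"
    unfolding left_velocity_def
    by (rule subspace_add[OF subspace_u Xu ad.exp_act_in_subspace[OF subspace_u u_closed[OF nX] wu]])
  have var: "variation D X q s \<tau> = point (E (s *\<^sub>R q \<tau>) \<odot> E (\<tau> *\<^sub>R X))" for \<tau>
    using act_point[OF E_carrier E_carrier] by (simp add: variation_def hom_curve_def point_def)
  show "variation D X q s t = point ?h" by (rule var)
  define c where "c \<tau> = ginv ?h \<odot> (E (s *\<^sub>R q \<tau>) \<odot> E (\<tau> *\<^sub>R X))" for \<tau>
  have qc: "continuous_on ?S q" using q(1) Ck_on.simps(1)[of q ?S] unfolding smooth_on_def by blast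
  have cc: "continuous_map (top_of_set ?S) (gtop D) c"
    unfolding c_def using hc
    by (intro continuous_map_mul continuous_map_const_G continuous_map_E G.inv_closed continuous_intros qc)
  have ct: "c t = \<e>" unfolding c_def using hc by simp
  have cU: "c \<tau> \<in> U" if "\<tau> \<in> ?S" for \<tau> unfolding c_def by (rule U_mult[OF U_inv[OF hU] mem[OF that]])
  have der: "((\<lambda>\<tau>. Ad D (c \<tau>) v) has_vector_derivative br ?W v) (at t within ?S)" for v
  proof -
    have e: "Ad D (c \<tau>) v = Ad D (ginv ?h) (exp_act br (exp_act br v [] (\<tau> *\<^sub>R X)) [] (s *\<^sub>R q \<tau>))" for \<tau>
      unfolding c_def using hc E_carrier by (simp add: Ad_mult Ad_E)
    have sq: "((\<lambda>\<tau>. s *\<^sub>R q \<tau>) has_vector_derivative s *\<^sub>R ?q') (at t within ?S)"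
      by (rule bounded_linear.has_vector_derivative[OF bounded_linear_scaleR_right dq])
    \<comment> \<open>first factor of the product rule\<close>
    have M: "((\<lambda>\<tau>. exp_act br z [] (s *\<^sub>R q \<tau>)) has_vector_derivative exp_act br (br ?w z) [] (s *\<^sub>R q t)) (at t within ?S)" for z
      using vector_derivative_diff_chain_within[OF sq has_derivative_at_withinI[OF ad.exp_act_derivative[of z "[]"]]]
      unfolding left_dexp_bracket[OF bspec[OF q(2) t]] by (simp add: o_def)
    have lM: "linear (\<lambda>z. exp_act br (br ?w z) [] (s *\<^sub>R q t))"
      using linear_compose[OF bounded_linear.linear[OF bounded_bilinear.bounded_linear_right[OF bounded_bilinear_br]] ad.linear_exp_act]
      by (simp add: o_def)
    let ?y = "exp_act br v [] (t *\<^sub>R X)"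
    have "((\<lambda>\<tau>. exp_act br (exp_act br v [] (\<tau> *\<^sub>R X)) [] (s *\<^sub>R q \<tau>)) has_vector_derivative
        exp_act br (br ?w ?y) [] (s *\<^sub>R q t) + exp_act br (br X ?y) [] (s *\<^sub>R q t)) (at t within ?S)"
      by (rule moving_linear_derivative[OF ad.linear_exp_act M lM has_vector_derivative_at_within[OF ad.exp_act_flow]])
    moreover have "exp_act br (br ?w ?y) [] (s *\<^sub>R q t) + exp_act br (br X ?y) [] (s *\<^sub>R q t) =
        Ad D (E (s *\<^sub>R q t)) (br (?w + X) ?y)"
      unfolding Ad_E br_add_left linear_add[OF ad.linear_exp_act] ..
    ultimately have "((\<lambda>\<tau>. Ad D (c \<tau>) v) has_vector_derivative Ad D (ginv ?h) (Ad D (E (s *\<^sub>R q t)) (br (?w + X) ?y))) (at t within ?S)"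
      unfolding e using bounded_linear.has_vector_derivative[OF Ad_bounded_linear[OF U_inv[OF hU]]] by simp
    moreover have "Ad D (ginv ?h) (Ad D (E (s *\<^sub>R q t)) (br (?w + X) ?y)) = br ?W v"
    proof -
      have "Ad D (ginv ?h) (Ad D (E (s *\<^sub>R q t)) (br (?w + X) ?y)) = Ad D (E (t *\<^sub>R (- X))) (br (?w + X) ?y)"
        using E_carrier E_neg[of "t *\<^sub>R X"] by (simp add: G.inv_mult_group Ad_mult Ad_inv)
      also have "\<dots> = br (exp_act br (?w + X) [] (t *\<^sub>R (- X))) v"
        unfolding Ad_E exp_act_bracket[OF nX] exp_act_inverse_both ..
      \<comment> \<open>\<open>X\<close> is fixed by the flow that it generates\<close>
      also have "exp_act br (?w + X) [] (t *\<^sub>R (- X)) = ?W"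
        using exp_act_fixed[of X "- t"] by (simp add: left_velocity_def linear_add[OF ad.linear_exp_act] add.commute)
      finally show ?thesis .
    qed
    ultimately show ?thesis by simp
  qed
  obtain Z d where Z: "d > 0" "\<And>\<tau>. \<tau> \<in> ?S \<Longrightarrow> dist \<tau> t < d \<Longrightarrow> c \<tau> = E (Z \<tau>)" "\<And>\<tau>. Z \<tau> \<in> \<u>" "Z t = 0"
    "(Z has_vector_derivative ?W) (at t within ?S)"
    using logarithmic_curve[OF cc t ct cU der] by blast
  show "velocity D ?S (variation D X q s) t = TV ?h (m_part ?W)"
  proof (rule velocity_eq[OF hU _ Z(1) t Z(5) Z(4) Z(3) Wu nb])
    fix \<tau> assume \<tau>: "\<tau> \<in> ?S" "dist \<tau> t < d"
    have "?h \<odot> c \<tau> = E (s *\<^sub>R q \<tau>) \<odot> E (\<tau> *\<^sub>R X)"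
    proof -
      have "E (s *\<^sub>R q \<tau>) \<odot> E (\<tau> *\<^sub>R X) \<in> carrier G" using E_carrier by simp
      then show ?thesis unfolding c_def using inv_mult_cancel[of "ginv ?h" "E (s *\<^sub>R q \<tau>) \<odot> E (\<tau> *\<^sub>R X)"] hc by simp
    qed
    then show "variation D X q s \<tau> = point (?h \<odot> E (Z \<tau>))" unfolding var Z(2)[OF \<tau>, symmetric] by simp
  qed
qed

lemma coord_A_m_part: "\<alpha> \<in> compl \<Longrightarrow> coord_A \<alpha> (m_part Y) = coord_A \<alpha> Y" "\<alpha> \<in> compl \<Longrightarrow> coord_S \<alpha> (m_part Y) = coord_S \<alpha> Y"
  unfolding m_part_def using coord_A_sum[of \<alpha> compl] by simp_all

text \<open>The metric at the point \<open>h o\<close> is the form \<open>B_form\<close> of the parts of \<open>W\<close> in \<open>\<m>\<close>, which have the same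
coordinates as \<open>W\<close>.\<close>

lemma energy_variation:
  assumes X: "X \<in> \<m>" and a: "0 < a" and q: "smooth_on q {0..a}" "\<forall>t\<in>{0..a}. q t \<in> \<u>"
    and c: "\<And>\<alpha>. continuous_on {0..a} (\<lambda>t. coord_A \<alpha> (left_velocity X q a s t))" "\<And>\<alpha>. continuous_on {0..a} (\<lambda>t. coord_S \<alpha> (left_velocity X q a s t))"
  shows "energy D lam a (variation D X q s) =
    (\<Sum>\<sigma>\<in>isotropy D. \<Sum>\<alpha>\<in>\<sigma>. 2 * lam \<sigma> * (integral {0..a} (\<lambda>t. (coord_A \<alpha> (left_velocity X q a s t))\<^sup>2) +
       integral {0..a} (\<lambda>t. (coord_S \<alpha> (left_velocity X q a s t))\<^sup>2)))"
proof -
  let ?W = "left_velocity X q a s"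
  have "energy D lam a (variation D X q s) =
    integral {0..a} (\<lambda>t. \<Sum>\<sigma>\<in>isotropy D. \<Sum>\<alpha>\<in>\<sigma>. 2 * lam \<sigma> * ((coord_A \<alpha> (?W t))\<^sup>2 + (coord_S \<alpha> (?W t))\<^sup>2))"
    unfolding energy_def
  proof (rule integral_cong)
    fix t assume t: "t \<in> {0..a}"
    note v = velocity_variation(1-4)[OF X a q t, where s=s]
    have "metric D lam (variation D X q s t) (velocity D {0..a} (variation D X q s) t) (velocity D {0..a} (variation D X q s) t)
      = B_form D lam (m_part (?W t)) (m_part (?W t))"
      unfolding v(1,2) by (rule metric_eq[OF v(4) m_part_in m_part_in])
    also have "\<dots> = (\<Sum>\<sigma>\<in>isotropy D. \<Sum>\<alpha>\<in>\<sigma>. 2 * lam \<sigma> * ((coord_A \<alpha> (?W t))\<^sup>2 + (coord_S \<alpha> (?W t))\<^sup>2))"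
      unfolding B_form_coordinates[OF m_part_in]
    proof (intro sum.cong refl)
      fix \<sigma> \<alpha> assume "\<sigma> \<in> isotropy D" "\<alpha> \<in> \<sigma>"
      then have "\<alpha> \<in> compl" using isotropy_subset by blast
      then show "2 * lam \<sigma> * (coord_A \<alpha> (m_part (?W t)) * coord_A \<alpha> (m_part (?W t)) + coord_S \<alpha> (m_part (?W t)) * coord_S \<alpha> (m_part (?W t))) =
          2 * lam \<sigma> * ((coord_A \<alpha> (?W t))\<^sup>2 + (coord_S \<alpha> (?W t))\<^sup>2)"
        by (simp add: coord_A_m_part power2_eq_square)
    qed
    finally show "metric D lam (variation D X q s t) (velocity D {0..a} (variation D X q s) t) (velocity D {0..a} (variation D X q s) t)
      = (\<Sum>\<sigma>\<in>isotropy D. \<Sum>\<alpha>\<in>\<sigma>. 2 * lam \<sigma> * ((coord_A \<alpha> (?W t))\<^sup>2 + (coord_S \<alpha> (?W t))\<^sup>2))" .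
  qed
  also have "\<dots> = (\<Sum>\<sigma>\<in>isotropy D. \<Sum>\<alpha>\<in>\<sigma>. integral {0..a} (\<lambda>t. 2 * lam \<sigma> * ((coord_A \<alpha> (?W t))\<^sup>2 + (coord_S \<alpha> (?W t))\<^sup>2)))"
  proof -
    have i: "(\<lambda>t. 2 * lam \<sigma> * ((coord_A \<alpha> (?W t))\<^sup>2 + (coord_S \<alpha> (?W t))\<^sup>2)) integrable_on {0..a}" for \<sigma> \<alpha>
      by (intro integrable_continuous_interval continuous_intros c)
    have fs: "finite \<sigma>" if "\<sigma> \<in> isotropy D" for \<sigma> using finite_subset[OF isotropy_subset[OF that] finite_compl] .
    have "integral {0..a} (\<lambda>t. \<Sum>\<sigma>\<in>isotropy D. \<Sum>\<alpha>\<in>\<sigma>. 2 * lam \<sigma> * ((coord_A \<alpha> (?W t))\<^sup>2 + (coord_S \<alpha> (?W t))\<^sup>2)) =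
      (\<Sum>\<sigma>\<in>isotropy D. integral {0..a} (\<lambda>t. \<Sum>\<alpha>\<in>\<sigma>. 2 * lam \<sigma> * ((coord_A \<alpha> (?W t))\<^sup>2 + (coord_S \<alpha> (?W t))\<^sup>2)))"
      by (rule integral_sum[OF finite_isotropy]) (rule integrable_sum[OF fs i])
    also have "\<dots> = (\<Sum>\<sigma>\<in>isotropy D. \<Sum>\<alpha>\<in>\<sigma>. integral {0..a} (\<lambda>t. 2 * lam \<sigma> * ((coord_A \<alpha> (?W t))\<^sup>2 + (coord_S \<alpha> (?W t))\<^sup>2)))"
      by (rule sum.cong[OF refl]) (rule integral_sum[OF fs i])
    finally show ?thesis .
  qed
  also have "\<dots> = (\<Sum>\<sigma>\<in>isotropy D. \<Sum>\<alpha>\<in>\<sigma>. 2 * lam \<sigma> * (integral {0..a} (\<lambda>t. (coord_A \<alpha> (?W t))\<^sup>2) +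
       integral {0..a} (\<lambda>t. (coord_S \<alpha> (?W t))\<^sup>2)))"
  proof (intro sum.cong refl)
    fix \<sigma> \<alpha>
    have "(\<lambda>t. (coord_A \<alpha> (?W t))\<^sup>2) integrable_on {0..a}" "(\<lambda>t. (coord_S \<alpha> (?W t))\<^sup>2) integrable_on {0..a}"
      by (intro integrable_continuous_interval continuous_intros c)+
    then show "integral {0..a} (\<lambda>t. 2 * lam \<sigma> * ((coord_A \<alpha> (?W t))\<^sup>2 + (coord_S \<alpha> (?W t))\<^sup>2)) =
      2 * lam \<sigma> * (integral {0..a} (\<lambda>t. (coord_A \<alpha> (?W t))\<^sup>2) + integral {0..a} (\<lambda>t. (coord_S \<alpha> (?W t))\<^sup>2))"
      by (simp add: integral_add)
  qed
  finally show ?thesis .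
qed

text \<open>At \<open>t = 0\<close> the velocity of the curve is the tangent vector of \<open>X\<close>. As tangent vectors at the origin
determine their representatives in \<open>\<m>\<close>, the coefficients in the definition of subordination are the
coordinates of \<open>X\<close>.\<close>

lemma subordinated_coordinates:
  assumes X: "X \<in> \<m>" and a: "0 < a" and sub: "subordinated D P X a"
    and s: "\<sigma> \<in> isotropy D - P" and \<alpha>: "\<alpha> \<in> \<sigma>"
  shows "coord_A \<alpha> X = 0" "coord_S \<alpha> X = 0"
proof -
  obtain f g :: "'n functional \<Rightarrow> real \<Rightarrow> real" where
    v: "\<forall>t\<in>{0..a}. velocity D {0..a} (hom_curve D X) t =
        (\<lambda>h. \<Sum>\<alpha>\<in>compl. f \<alpha> t * TV (E (t *\<^sub>R X)) (Av \<alpha>) h + g \<alpha> t * TV (E (t *\<^sub>R X)) (Sv \<alpha>) h)"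
    and z: "\<forall>\<sigma>\<in>isotropy D - P. \<forall>\<alpha>\<in>\<sigma>. \<forall>t\<in>{0..a}. f \<alpha> t = 0 \<and> g \<alpha> t = 0"
    using sub unfolding subordinated_def by blast
  have t0: "0 \<in> {0..a}" using a by simp
  have Xu: "X \<in> \<u>" using X m_subset_u by auto
  have "velocity D {0..a} (hom_curve D X) 0 = TV \<e> (m_part X)"
  proof (rule velocity_eq[OF U_one, where d=1 and Z="\<lambda>\<tau>. \<tau> *\<^sub>R X"])
    show "hom_curve D X \<tau> = point (\<e> \<odot> E (\<tau> *\<^sub>R X))" for \<tau> using E_carrier by (simp add: hom_curve_def point_def)
    show "((\<lambda>\<tau>. \<tau> *\<^sub>R X) has_vector_derivative X) (at 0 within {0..a})" by (auto intro!: derivative_eq_intros)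
    show "\<tau> *\<^sub>R X \<in> \<u>" for \<tau> by (rule subspace_scale[OF subspace_u Xu])
    show "at 0 within {0..a} \<noteq> bot" using a by (simp add: trivial_limit_within islimpt_Icc)
  qed (use t0 Xu in auto)
  then have vX: "velocity D {0..a} (hom_curve D X) 0 = TV \<e> X" unfolding m_part_id[OF X] .
  define Y where "Y = (\<Sum>\<alpha>\<in>compl. f \<alpha> 0 *\<^sub>R Av \<alpha> + g \<alpha> 0 *\<^sub>R Sv \<alpha>)"
  have Ym: "Y \<in> \<m>" unfolding Y_def m_Theta_def by (rule m_of_sum)
  have gu: "Av \<alpha> \<in> \<u>" "Sv \<alpha> \<in> \<u>" if "\<alpha> \<in> compl" for \<alpha>
    using that compl_subset u_generators by auto
  have "TV \<e> X = TV \<e> Y"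
  proof
    fix \<phi>
    have "TV \<e> X \<phi> = (\<Sum>\<alpha>\<in>compl. f \<alpha> 0 * TV \<e> (Av \<alpha>) \<phi> + g \<alpha> 0 * TV \<e> (Sv \<alpha>) \<phi>)"
      using bspec[OF v t0] unfolding vX by (simp add: E_zero)
    also have "\<dots> = TV \<e> Y \<phi>"
    proof (cases "\<phi> \<in> SF")
      case True
      have l: "linear (dir_deriv \<phi> \<e>)" by (rule dir_deriv_linear[OF True U_one])
      have "TV \<e> Y \<phi> = dir_deriv \<phi> \<e> Y" using TV_eq[OF U_one] Ym m_subset_u True by auto
      also have "\<dots> = (\<Sum>\<alpha>\<in>compl. f \<alpha> 0 * dir_deriv \<phi> \<e> (Av \<alpha>) + g \<alpha> 0 * dir_deriv \<phi> \<e> (Sv \<alpha>))"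
        unfolding Y_def linear_sum[OF l] linear_add[OF l] linear_cmul[OF l] by simp
      also have "\<dots> = (\<Sum>\<alpha>\<in>compl. f \<alpha> 0 * TV \<e> (Av \<alpha>) \<phi> + g \<alpha> 0 * TV \<e> (Sv \<alpha>) \<phi>)"
        by (rule sum.cong) (simp_all add: TV_eq[OF U_one] gu True)
      finally show ?thesis by simp
    next
      case False
      then show ?thesis by (simp add: dphi_def)
    qed
    finally show "TV \<e> X \<phi> = TV \<e> Y \<phi>" .
  qed
  then have XY: "X = Y" by (rule TV_injective[OF U_one X Ym])
  have ac: "\<alpha> \<in> compl" using s \<alpha> isotropy_subset by blast
  have "f \<alpha> 0 = 0 \<and> g \<alpha> 0 = 0" using z s \<alpha> t0 by blast
  then show "coord_A \<alpha> X = 0" "coord_S \<alpha> X = 0"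
    unfolding XY Y_def using coord_A_sum[OF ac subset_refl, of "\<lambda>\<alpha>. f \<alpha> 0" "\<lambda>\<alpha>. g \<alpha> 0"] ac by simp_all
qed

context
  fixes X :: "complex ^ 'n" and a :: real and q :: "real \<Rightarrow> complex ^ 'n"
  assumes X: "X \<in> \<m>" and a: "0 < a" and q: "smooth_on q {0..a}" "\<forall>t\<in>{0..a}. q t \<in> \<u>"
begin

abbreviation q' where "q' t \<equiv> vector_derivative q (at t within {0..a})"
abbreviation W where "W s t \<equiv> left_velocity X q a s t"

text \<open>The first and the second derivative of \<open>W\<close> with respect to \<open>s\<close>.\<close>

definition W1 where "W1 s t = exp_act br (exp_act br (q' t) [] (s *\<^sub>R (- q t))) [] (t *\<^sub>R (- X))"
definition W2 where "W2 s t = exp_act br (br (- q t) (exp_act br (q' t) [] (s *\<^sub>R (- q t)))) [] (t *\<^sub>R (- X))"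

lemma exp_act_bounded_linear: "bounded_linear (\<lambda>w. exp_act br w [] Y)"
  using ad.linear_exp_act linear_linear by blast

lemma W_zero: "W 0 t = X"
  by (simp add: left_velocity_def left_dexp_zero linear_0[OF ad.linear_exp_act])

lemma W_derivative: "t \<in> {0..a} \<Longrightarrow> ((\<lambda>s. W s t) has_vector_derivative W1 s t) (at s)"
  using has_vector_derivative_add[OF has_vector_derivative_const[of X]
      bounded_linear.has_vector_derivative[OF exp_act_bounded_linear left_dexp_derivative[OF bspec[OF q(2), of t]]]]
  unfolding left_velocity_def W1_def by simp

lemma W1_derivative: "((\<lambda>s. W1 s t) has_vector_derivative W2 s t) (at s)"
  unfolding W1_def W2_def
  by (rule bounded_linear.has_vector_derivative[OF exp_act_bounded_linear ad.exp_act_flow])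

lemma q_continuous: "continuous_on {0..a} q" and q'_continuous: "continuous_on {0..a} q'"
  and q'_smooth: "smooth_on q' {0..a}"
proof -
  show "continuous_on {0..a} q" using q(1) Ck_on.simps(1)[of q "{0..a}"] unfolding smooth_on_def by blast
  show s: "smooth_on q' {0..a}" by (rule smooth_on_vector_derivative(1)[OF q(1) accessible_interval[OF a]])
  show "continuous_on {0..a} q'" using s Ck_on.simps(1)[of q' "{0..a}"] unfolding smooth_on_def by blast
qed

lemma W_continuous:
  "continuous_on (UNIV \<times> {0..a}) (\<lambda>x. W (fst x) (snd x))"
  "continuous_on (UNIV \<times> {0..a}) (\<lambda>x. W1 (fst x) (snd x))"
  "continuous_on (UNIV \<times> {0..a}) (\<lambda>x. W2 (fst x) (snd x))"
proof -
  let ?T = "(UNIV :: real set) \<times> {0..a}"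
  have qs: "continuous_on ?T (\<lambda>x. q (snd x))"
    by (rule continuous_on_compose2[OF q_continuous continuous_on_snd[OF continuous_on_id]]) auto
  have q's: "continuous_on ?T (\<lambda>x. q' (snd x))"
    by (rule continuous_on_compose2[OF q'_continuous continuous_on_snd[OF continuous_on_id]]) auto
  have f: "continuous_on ?T (\<lambda>x. fst x)" and sX: "continuous_on ?T (\<lambda>x. snd x *\<^sub>R (- X))"
    and fq: "continuous_on ?T (\<lambda>x. fst x *\<^sub>R (- q (snd x)))" and nq: "continuous_on ?T (\<lambda>x. - q (snd x))"
    by (intro continuous_intros qs)+
  show "continuous_on ?T (\<lambda>x. W (fst x) (snd x))"
    unfolding left_velocity_def
    by (rule continuous_on_add[OF continuous_on_const continuous_on_exp_act[OF continuous_on_left_dexp[OF qs q's f] sX]])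
  have e: "continuous_on ?T (\<lambda>x. exp_act br (q' (snd x)) [] (fst x *\<^sub>R (- q (snd x))))"
    by (rule continuous_on_exp_act[OF q's fq])
  show "continuous_on ?T (\<lambda>x. W1 (fst x) (snd x))"
    unfolding W1_def by (rule continuous_on_exp_act[OF e sX])
  show "continuous_on ?T (\<lambda>x. W2 (fst x) (snd x))"
    unfolding W2_def
    by (rule continuous_on_exp_act[OF bounded_bilinear.continuous_on[OF bounded_bilinear_br nq e] sX])
qed

lemma coordinate_integral_derivatives:
  assumes l: "linear l"
  shows "((\<lambda>s. integral {0..a} (\<lambda>t. (l (W s t))\<^sup>2)) has_real_derivative
           integral {0..a} (\<lambda>t. 2 * l (W s t) * l (W1 s t))) (at s)"
    and "((\<lambda>s. integral {0..a} (\<lambda>t. 2 * l (W s t) * l (W1 s t))) has_real_derivative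
           integral {0..a} (\<lambda>t. 2 * ((l (W1 s t))\<^sup>2 + l (W s t) * l (W2 s t)))) (at s)"
    and "continuous_on {0..a} (\<lambda>t. l (W s t))"
proof -
  have bl: "bounded_linear l" using l linear_linear by blast
  have d: "((\<lambda>s. l (W s t)) has_real_derivative l (W1 s t)) (at s)" if "t \<in> {0..a}" for s t
    using bounded_linear.has_vector_derivative[OF bl W_derivative[OF that]]
    by (simp add: has_real_derivative_iff_has_vector_derivative)
  have d1: "((\<lambda>s. l (W1 s t)) has_real_derivative l (W2 s t)) (at s)" for s t
    using bounded_linear.has_vector_derivative[OF bl W1_derivative]
    by (simp add: has_real_derivative_iff_has_vector_derivative)
  have c: "continuous_on (UNIV \<times> {0..a}) (\<lambda>(s, t). l (W s t))" "continuous_on (UNIV \<times> {0..a}) (\<lambda>(s, t). l (W1 s t))"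
    "continuous_on (UNIV \<times> {0..a}) (\<lambda>(s, t). l (W2 s t))"
    unfolding case_prod_unfold by (rule bounded_linear.continuous_on[OF bl W_continuous(1)]
      bounded_linear.continuous_on[OF bl W_continuous(2)] bounded_linear.continuous_on[OF bl W_continuous(3)])+
  show "((\<lambda>s. integral {0..a} (\<lambda>t. (l (W s t))\<^sup>2)) has_real_derivative
           integral {0..a} (\<lambda>t. 2 * l (W s t) * l (W1 s t))) (at s)"
    and "((\<lambda>s. integral {0..a} (\<lambda>t. 2 * l (W s t) * l (W1 s t))) has_real_derivative
           integral {0..a} (\<lambda>t. 2 * ((l (W1 s t))\<^sup>2 + l (W s t) * l (W2 s t)))) (at s)"
    by (rule integral_square_derivatives[OF d d1 c]; assumption)+
  have p: "continuous_on {0..a} (\<lambda>t. (s, t))" by (intro continuous_intros)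
  have "(\<lambda>t. (s, t)) ` {0..a} \<subseteq> UNIV \<times> {0..a}" by auto
  from continuous_on_compose2[OF c(1) p this] show "continuous_on {0..a} (\<lambda>t. l (W s t))" by simp
qed

text \<open>The second derivative of \<open>w\<^sup>2\<close> is \<open>2 (w'\<^sup>2 + w w'')\<close>, for each coordinate \<open>w\<close> of \<open>W\<close>, and \<open>W = X\<close> at
\<open>s = 0\<close>.\<close>

lemma second_variation_formula:
  "second_variation D lam a X q = (\<Sum>\<sigma>\<in>isotropy D. \<Sum>\<alpha>\<in>\<sigma>. 2 * lam \<sigma> *
     (integral {0..a} (\<lambda>t. 2 * ((coord_A \<alpha> (W1 0 t))\<^sup>2 + coord_A \<alpha> X * coord_A \<alpha> (W2 0 t))) +
      integral {0..a} (\<lambda>t. 2 * ((coord_S \<alpha> (W1 0 t))\<^sup>2 + coord_S \<alpha> X * coord_S \<alpha> (W2 0 t)))))"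
proof -
  have E0: "energy D lam a (variation D X q s) = (\<Sum>\<sigma>\<in>isotropy D. \<Sum>\<alpha>\<in>\<sigma>. 2 * lam \<sigma> *
     (integral {0..a} (\<lambda>t. (coord_A \<alpha> (W s t))\<^sup>2) + integral {0..a} (\<lambda>t. (coord_S \<alpha> (W s t))\<^sup>2)))" for s
    by (rule energy_variation[OF X a q coordinate_integral_derivatives(3)[OF coord_A_linear] coordinate_integral_derivatives(3)[OF coord_S_linear]])
  have "((\<lambda>s. energy D lam a (variation D X q s)) has_real_derivative (\<Sum>\<sigma>\<in>isotropy D. \<Sum>\<alpha>\<in>\<sigma>. 2 * lam \<sigma> *
     (integral {0..a} (\<lambda>t. 2 * coord_A \<alpha> (W s t) * coord_A \<alpha> (W1 s t)) + integral {0..a} (\<lambda>t. 2 * coord_S \<alpha> (W s t) * coord_S \<alpha> (W1 s t))))) (at s)" for s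
    unfolding E0
    by (intro DERIV_sum DERIV_cmult DERIV_add coordinate_integral_derivatives(1)[OF coord_A_linear] coordinate_integral_derivatives(1)[OF coord_S_linear])
  then have E1: "deriv (\<lambda>s. energy D lam a (variation D X q s)) = (\<lambda>s. \<Sum>\<sigma>\<in>isotropy D. \<Sum>\<alpha>\<in>\<sigma>. 2 * lam \<sigma> *
     (integral {0..a} (\<lambda>t. 2 * coord_A \<alpha> (W s t) * coord_A \<alpha> (W1 s t)) + integral {0..a} (\<lambda>t. 2 * coord_S \<alpha> (W s t) * coord_S \<alpha> (W1 s t))))"
    by (intro ext DERIV_imp_deriv)
  have "((\<lambda>s. \<Sum>\<sigma>\<in>isotropy D. \<Sum>\<alpha>\<in>\<sigma>. 2 * lam \<sigma> *
     (integral {0..a} (\<lambda>t. 2 * coord_A \<alpha> (W s t) * coord_A \<alpha> (W1 s t)) + integral {0..a} (\<lambda>t. 2 * coord_S \<alpha> (W s t) * coord_S \<alpha> (W1 s t))))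
     has_real_derivative (\<Sum>\<sigma>\<in>isotropy D. \<Sum>\<alpha>\<in>\<sigma>. 2 * lam \<sigma> *
     (integral {0..a} (\<lambda>t. 2 * ((coord_A \<alpha> (W1 0 t))\<^sup>2 + coord_A \<alpha> (W 0 t) * coord_A \<alpha> (W2 0 t))) +
      integral {0..a} (\<lambda>t. 2 * ((coord_S \<alpha> (W1 0 t))\<^sup>2 + coord_S \<alpha> (W 0 t) * coord_S \<alpha> (W2 0 t)))))) (at 0)"
    by (intro DERIV_sum DERIV_cmult DERIV_add coordinate_integral_derivatives(2)[OF coord_A_linear] coordinate_integral_derivatives(2)[OF coord_S_linear])
  then show ?thesis unfolding second_variation_def E1 W_zero by (rule DERIV_imp_deriv)
qed

lemma W1_zero: "W1 0 t = exp_act br (q' t) [] (t *\<^sub>R (- X))"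
  by (simp add: W1_def ad.exp_act_zero)

text \<open>\<open>W1 0 t\<close> is \<open>Ad(exp(-tX)) q'(t)\<close>, and the coordinates of its part in \<open>\<m>\<close> are unique.\<close>

lemma component_functions_iff:
  "component_functions D a X q f g \<longleftrightarrow>
     (\<forall>t\<in>{0..a}. \<forall>\<alpha>\<in>compl. f \<alpha> t = coord_A \<alpha> (W1 0 t) \<and> g \<alpha> t = coord_S \<alpha> (W1 0 t))"
proof -
  have e: "proj_m D (Ad D (E (- t *\<^sub>R X)) (q' t)) = m_part (W1 0 t)" if t: "t \<in> {0..a}" for t
  proof -
    have "Ad D (E (- t *\<^sub>R X)) (q' t) = W1 0 t" by (simp add: W1_zero Ad_E)
    moreover have "Ad D (E (- t *\<^sub>R X)) (q' t) \<in> \<u>"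
      using X m_subset_u velocity_variation(5)[OF X a q t] by (intro Ad_u U_E subspace_scale[OF subspace_u]) auto
    ultimately show ?thesis using proj_m_eq_m_part by simp
  qed
  have "m_part (W1 0 t) = (\<Sum>\<alpha>\<in>compl. f \<alpha> t *\<^sub>R Av \<alpha> + g \<alpha> t *\<^sub>R Sv \<alpha>) \<longleftrightarrow>
      (\<forall>\<alpha>\<in>compl. f \<alpha> t = coord_A \<alpha> (W1 0 t) \<and> g \<alpha> t = coord_S \<alpha> (W1 0 t))" for t
  proof
    assume eq: "m_part (W1 0 t) = (\<Sum>\<alpha>\<in>compl. f \<alpha> t *\<^sub>R Av \<alpha> + g \<alpha> t *\<^sub>R Sv \<alpha>)"
    show "\<forall>\<alpha>\<in>compl. f \<alpha> t = coord_A \<alpha> (W1 0 t) \<and> g \<alpha> t = coord_S \<alpha> (W1 0 t)"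
    proof
      fix \<alpha> assume c: "\<alpha> \<in> compl"
      show "f \<alpha> t = coord_A \<alpha> (W1 0 t) \<and> g \<alpha> t = coord_S \<alpha> (W1 0 t)"
        unfolding coord_A_m_part(1)[OF c, symmetric, of "W1 0 t"] coord_A_m_part(2)[OF c, symmetric, of "W1 0 t"] eq
        using coord_A_sum[OF c subset_refl, of "\<lambda>\<alpha>. f \<alpha> t" "\<lambda>\<alpha>. g \<alpha> t"] c by simp
    qed
  next
    assume "\<forall>\<alpha>\<in>compl. f \<alpha> t = coord_A \<alpha> (W1 0 t) \<and> g \<alpha> t = coord_S \<alpha> (W1 0 t)"
    then show "m_part (W1 0 t) = (\<Sum>\<alpha>\<in>compl. f \<alpha> t *\<^sub>R Av \<alpha> + g \<alpha> t *\<^sub>R Sv \<alpha>)"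
      unfolding m_part_def by (intro sum.cong) auto
  qed
  then show ?thesis unfolding component_functions_def using e by simp
qed

lemma component_functions_smooth:
  assumes l: "linear (l :: complex ^ 'n \<Rightarrow> real)" shows "smooth_on (\<lambda>t. l (W1 0 t)) {0..a}"
  unfolding smooth_on_def
proof
  fix k
  have acc: "accessible {0..a}" by (rule accessible_interval[OF a])
  have bl: "bounded_linear l" using l linear_linear by blast
  have "linear (\<lambda>t :: real. t *\<^sub>R (- X))" by (rule linearI) (simp_all add: algebra_simps)
  moreover have "Ck_on k (exp_act br i []) UNIV" for i using ad.smooth_exp_act[of i "[]"] unfolding smooth_on_def by blast
  ultimately have "Ck_on k (\<lambda>t. exp_act br i [] (t *\<^sub>R (- X))) {0..a}" for i
    by (rule Ck_on_compose_linear[OF _ accessible_UNIV acc subset_UNIV])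
  moreover have "Ck_on k q' {0..a}" using q'_smooth unfolding smooth_on_def by blast
  ultimately have "Ck_on k (\<lambda>t. (q' t \<bullet> i) *\<^sub>R exp_act br i [] (t *\<^sub>R (- X))) {0..a}" for i
    by (intro Ck_on_bilinear[OF bounded_bilinear_scaleR acc] Ck_on_linear[OF bounded_linear_inner_left acc])
  then have "Ck_on k (\<lambda>t. \<Sum>i\<in>Basis. (q' t \<bullet> i) *\<^sub>R exp_act br i [] (t *\<^sub>R (- X))) {0..a}"
    by (rule Ck_on_sum[OF acc])
  from Ck_on_linear[OF bl acc this] show "Ck_on k (\<lambda>t. l (W1 0 t)) {0..a}"
    unfolding W1_zero exp_act_expand[symmetric] .
qed

end

end

theorem theoremA:
  fixes D :: "('n::finite, 'a) flag_data"
    and X :: "complex ^ 'n" and a :: real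
    and P :: "'n functional set set"
    and lam\<^sub>1 lam\<^sub>2 \<xi> :: "'n functional set \<Rightarrow> real"
    and q :: "real \<Rightarrow> complex ^ 'n"
  assumes "generalized_flag_manifold D"
    and "X \<in> m_Theta D" and "0 < a"
    and "P \<subseteq> isotropy D"
    and "invariant_metric D lam\<^sub>1"
    and "perturbation D P lam\<^sub>1 lam\<^sub>2 \<xi>"
    and "subordinated D P X a"
    and "geodesic_vector D lam\<^sub>1 X" and "geodesic_vector D lam\<^sub>2 X"
    and "smooth_on q {0..a}" and "\<forall>t\<in>{0..a}. q t \<in> u_alg D"
  shows "(\<exists>f g. component_functions D a X q f g \<and>
            (\<forall>\<alpha>\<in>compl_roots D. smooth_on (f \<alpha>) {0..a} \<and> smooth_on (g \<alpha>) {0..a})) \<and>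
         (\<forall>f g. component_functions D a X q f g \<longrightarrow>
            second_variation D lam\<^sub>2 a X q = second_variation D lam\<^sub>1 a X q +
              4 * (\<Sum>\<sigma>\<in>isotropy D - P. \<Sum>\<alpha>\<in>\<sigma>.
                     \<xi> \<sigma> * integral {0..a} (\<lambda>t. (f \<alpha> t)\<^sup>2 + (g \<alpha> t)\<^sup>2)))"
proof -
  interpret flag_manifold D by (rule flag_manifold.intro[OF assms(1)])
  note X = assms(2) and a = assms(3) and q = assms(10,11)
  let ?V = "W1 X a q 0"
  show ?thesis
  proof (intro conjI allI impI)
    show "\<exists>f g. component_functions D a X q f g \<and>
            (\<forall>\<alpha>\<in>compl_roots D. smooth_on (f \<alpha>) {0..a} \<and> smooth_on (g \<alpha>) {0..a})"
    proof (intro exI conjI ballI)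
      show "component_functions D a X q (\<lambda>\<alpha> t. coord_A \<alpha> (?V t)) (\<lambda>\<alpha> t. coord_S \<alpha> (?V t))"
        unfolding component_functions_iff[OF X a q] by blast
      show "smooth_on (\<lambda>t. coord_A \<alpha> (?V t)) {0..a}" "smooth_on (\<lambda>t. coord_S \<alpha> (?V t)) {0..a}" for \<alpha>
        by (rule component_functions_smooth[OF X a q coord_A_linear] component_functions_smooth[OF X a q coord_S_linear])+
    qed
  next
    fix f g assume fg: "component_functions D a X q f g"
    \<comment> \<open>the contributions of \<open>A\<^sub>\<alpha>\<close> and \<open>S\<^sub>\<alpha>\<close> to the second variation; they do not depend on the metric\<close>
    define FA where "FA \<alpha> = integral {0..a} (\<lambda>t. 2 * ((coord_A \<alpha> (?V t))\<^sup>2 + coord_A \<alpha> X * coord_A \<alpha> (W2 X a q 0 t)))" for \<alpha>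
    define FS where "FS \<alpha> = integral {0..a} (\<lambda>t. 2 * ((coord_S \<alpha> (?V t))\<^sup>2 + coord_S \<alpha> X * coord_S \<alpha> (W2 X a q 0 t)))" for \<alpha>
    have sv: "second_variation D lam a X q = (\<Sum>\<sigma>\<in>isotropy D. \<Sum>\<alpha>\<in>\<sigma>. 2 * lam \<sigma> * (FA \<alpha> + FS \<alpha>))" for lam
      unfolding FA_def FS_def by (rule second_variation_formula[OF X a q])
    have same: "lam\<^sub>2 \<sigma> = lam\<^sub>1 \<sigma>" if "\<sigma> \<in> P" for \<sigma> using assms(6) that by (simp add: perturbation_def)
    have pert: "lam\<^sub>2 \<sigma> = lam\<^sub>1 \<sigma> + \<xi> \<sigma>" if "\<sigma> \<in> isotropy D - P" for \<sigma> using assms(6) that by (simp add: perturbation_def)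
    have F: "FA \<alpha> + FS \<alpha> = 2 * integral {0..a} (\<lambda>t. (f \<alpha> t)\<^sup>2 + (g \<alpha> t)\<^sup>2)"
      if s: "\<sigma> \<in> isotropy D - P" and \<alpha>: "\<alpha> \<in> \<sigma>" for \<sigma> \<alpha>
    proof -
      have c: "\<alpha> \<in> compl_roots D" using s \<alpha> isotropy_subset by blast
      have z: "coord_A \<alpha> X = 0" "coord_S \<alpha> X = 0" by (rule subordinated_coordinates[OF X a assms(7) s \<alpha>])+
      have cont: "continuous_on {0..a} (\<lambda>t. l (?V t))" if "linear l" for l :: "complex ^ 'n \<Rightarrow> real"
        using component_functions_smooth[OF X a q that] Ck_on.simps(1)[of "\<lambda>t. l (?V t)" "{0..a}"] unfolding smooth_on_def by blast
      have i: "(\<lambda>t. 2 * (coord_A \<alpha> (?V t))\<^sup>2) integrable_on {0..a}" "(\<lambda>t. 2 * (coord_S \<alpha> (?V t))\<^sup>2) integrable_on {0..a}"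
        by (intro integrable_continuous_interval continuous_intros cont coord_A_linear coord_S_linear)+
      have "FA \<alpha> + FS \<alpha> = integral {0..a} (\<lambda>t. 2 * (coord_A \<alpha> (?V t))\<^sup>2 + 2 * (coord_S \<alpha> (?V t))\<^sup>2)"
        unfolding FA_def FS_def z using integral_add[OF i] by simp
      also have "\<dots> = integral {0..a} (\<lambda>t. 2 * ((f \<alpha> t)\<^sup>2 + (g \<alpha> t)\<^sup>2))"
        by (rule integral_cong) (use fg c in \<open>simp add: component_functions_iff[OF X a q]\<close>)
      also have "\<dots> = 2 * integral {0..a} (\<lambda>t. (f \<alpha> t)\<^sup>2 + (g \<alpha> t)\<^sup>2)" by (rule integral_mult_right)
      finally show ?thesis .
    qed
    have "second_variation D lam\<^sub>2 a X q - second_variation D lam\<^sub>1 a X q =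
        (\<Sum>\<sigma>\<in>isotropy D. \<Sum>\<alpha>\<in>\<sigma>. 2 * (lam\<^sub>2 \<sigma> - lam\<^sub>1 \<sigma>) * (FA \<alpha> + FS \<alpha>))"
      unfolding sv sum_subtractf[symmetric] by (intro sum.cong refl) (simp add: algebra_simps)
    also have "\<dots> = (\<Sum>\<sigma>\<in>isotropy D - P. \<Sum>\<alpha>\<in>\<sigma>. 2 * (lam\<^sub>2 \<sigma> - lam\<^sub>1 \<sigma>) * (FA \<alpha> + FS \<alpha>))"
      by (rule sum.mono_neutral_right[OF finite_isotropy]) (auto simp: same)
    also have "\<dots> = (\<Sum>\<sigma>\<in>isotropy D - P. \<Sum>\<alpha>\<in>\<sigma>. 4 * (\<xi> \<sigma> * integral {0..a} (\<lambda>t. (f \<alpha> t)\<^sup>2 + (g \<alpha> t)\<^sup>2)))"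
      by (intro sum.cong refl) (simp add: F pert)
    also have "\<dots> = 4 * (\<Sum>\<sigma>\<in>isotropy D - P. \<Sum>\<alpha>\<in>\<sigma>. \<xi> \<sigma> * integral {0..a} (\<lambda>t. (f \<alpha> t)\<^sup>2 + (g \<alpha> t)\<^sup>2))"
      by (simp only: sum_distrib_left)
    finally show "second_variation D lam\<^sub>2 a X q = second_variation D lam\<^sub>1 a X q +
              4 * (\<Sum>\<sigma>\<in>isotropy D - P. \<Sum>\<alpha>\<in>\<sigma>. \<xi> \<sigma> * integral {0..a} (\<lambda>t. (f \<alpha> t)\<^sup>2 + (g \<alpha> t)\<^sup>2))"
      by simp
  qed
qed

end
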